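(* Let $G$ be a unimodular locally compact second countable group and let $P_o\subset G$ be a measured set of finite local complexity (FLC) of finite Voronoi volume. Then for every $k\ge 0$ $$\mathrm{H}_{\mathrm b}^k(P_o;\mathbb R)=\{[\mathrm{H}_{\mathrm{cb}}^k(G;\mathrm L^\infty(X(P_o),\mu))]\;:\;\mu\in\mathrm{Prob}_{\mathrm{erg}}(X(P_o))^G\},$$ where $[\cdot]$ denotes the equivalence class of a seminormed space up to isometric isomorphism.
   Context: Hull. $G$ acts continuously on the space $\mathrm{Cl}(G)$ of closed subsets of $G$ (Chabauty–Fell topology) by $g\cdot P=Pg^{-1}$. For a locally finite $P_o\subset G$ let $X^+(P_o)$ be the orbit closure of $P_o$ and $X(P_o)=X^+(P_o)\setminus\{\emptyset\}$ its hull; $Y(P_o)=\{Q\in X(P_o): e\in Q\}$. $P_o$ is FLC if for every bounded $B\subset G$ the set $\{B\cap P_og^{-1}: g\in P_o\}$ is finite (so that $P_oP_o^{-1}$ is locally finite). $\mathrm{Prob}_{\mathrm{erg}}(X(P_o))^G$ is the set of ergodic $G$-invariant Borel probability measures on $X(P_o)$; $P_o$ is measured if this set is non-empty. $P_o$ has finite Voronoi volume if the Voronoi cells $\{g\in G: d(g,p)\le d(g,q)\ \forall q\in P_o\}$, $p\in P_o$, have uniformly bounded Haar measure (for a fixed proper compatible right-invariant metric $d$ on $G$). Transverse groupoid. Fix a Haar measure $m_G$. For $\mu\in\mathrm{Prob}_{\mathrm{erg}}(X(P_o))^G$, writing $X=X(P_o)$, $Y=Y(P_o)$ and $Y_x=\{g\in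 G: gx\in Y\}$, the triple $(X,\mu,Y)$ is an integrable transverse $G$-system (each $Y_x$ is locally finite, $GY=X$, and $\int_X|Y_x\cap L|\,d\mu<\infty$ for compact $L$). The transverse measure $\nu$ is the unique (here finite) Borel measure on $Y$ with $\int_Y f\,d\nu=\int_X\sum_{g\in Y_x}f(gx)w(g)\,d\mu(x)$ for all Borel $f:Y\to[0,\infty]$ and Borel $w:G\to[0,\infty]$ with $\int_G w\,dm_G=1$. The pattern groupoid $\mathcal G_{P_o}$ has objects $Y$, morphisms $\{(g,y)\in G\times Y: gy\in Y\}$, $s(g,y)=y$, $t(g,y)=gy$, $(g,hy)(h,y)=(gh,y)$; its $t$-fibers are countable, and $\nu$ is invariant. Cohomology. Write $\mathcal G=\mathcal G_{P_o}$, $\mathcal G^y=t^{-1}(y)$ and $\mathcal G^{[n]}=\{(\gamma_0,\dots,\gamma_{n-1}): t(\gamma_0)=\dots=t(\gamma_{n-1})\}$ with the measure integrating counting measures on $(\mathcal G^y)^n$ against $\nu$. $\mathrm L^\infty(\mathcal G^{[n]})^{\mathcal G}$ consists of the classes $[f]$ with $f(\gamma^{-1}\gamma_0,\dots,\gamma^{-1}\gamma_{n-1})=f(\gamma_0,\dots,\gamma_{n-1})$ for almost all $(\gamma_0,\dots,\gamma_{n-1})$ and all $\gamma$ with $t(\gamma)=t(\gamma_0)$. $\mathrm{H}_{\mathrm{mb}}^k((\mathcal G,\nu);\underline{\mathbb R})$ is the cohomology of $0\to \mathrm L^\infty(\mathcal G^{[1]})^{\mathcal G}\to \mathrm L^\infty(\mathcal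 G^{[2]})^{\mathcal G}\to\cdots$ (homogeneous differential), with the quotient seminorm. Define $\mathrm{H}_{\mathrm b}^k((P_o,\mu);\mathbb R)=\mathrm{H}_{\mathrm{mb}}^k((\mathcal G_{P_o},\nu);\underline{\mathbb R})$ and $\mathrm{H}_{\mathrm b}^k(P_o;\mathbb R)=\{[\mathrm{H}_{\mathrm b}^k((P_o,\mu);\mathbb R)]:\mu\in\mathrm{Prob}_{\mathrm{erg}}(X(P_o))^G\}$. Finally $\mathrm{H}_{\mathrm{cb}}^k(G;\mathrm L^\infty(X,\mu))$ is continuous bounded cohomology, i.e. the cohomology of $0\to \mathrm L^\infty(G\times X)^G\to \mathrm L^\infty(G^2\times X)^G\to\cdots$ (diagonal action, homogeneous differential), with the quotient seminorm. *)

theory Defs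
  imports "HOL-Probability.Probability"
begin

text \<open>
  The group \<open>G\<close> is the universe of a type \<open>'g\<close> of class \<open>topological_group_add\<close>. This class is not
  commutative: the group law is merely written additively, so \<open>0\<close> is the identity \<open>e\<close>,
  \<open>g + h\<close> is \<open>gh\<close> and \<open>p - g\<close> is \<open>p g\<inverse>\<close>.
\<close>


section \<open>Seminormed spaces up to isometric isomorphism\<close>

record 'a snspace =
  carr :: "'a set"
  add :: "'a \<Rightarrow> 'a \<Rightarrow> 'a"
  scale :: "real \<Rightarrow> 'a \<Rightarrow> 'a"
  zero :: 'a
  snorm :: "'a \<Rightarrow> real"

definition quotient_sn :: "'a snspace \<Rightarrow> 'a set \<Rightarrow> 'a set snspace" where
  "quotient_sn V W =
    \<lparr>carr = (\<lambda>x. add V x ` W) ` carr V,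
     add = (\<lambda>A B. {add V a b | a b. a \<in> A \<and> b \<in> B}),
     scale = (\<lambda>c A. {add V (scale V c a) w | a w. a \<in> A \<and> w \<in> W}),
     zero = W,
     snorm = (\<lambda>A. Inf (snorm V ` A))\<rparr>"

definition isometric :: "'a snspace \<Rightarrow> 'b snspace \<Rightarrow> bool" where
  "isometric V W \<longleftrightarrow>
    (\<exists>\<phi>. bij_betw \<phi> (carr V) (carr W) \<and>
         (\<forall>x\<in>carr V. \<forall>y\<in>carr V. \<phi> (add V x y) = add W (\<phi> x) (\<phi> y)) \<and>
         (\<forall>c. \<forall>x\<in>carr V. \<phi> (scale V c x) = scale W c (\<phi> x)) \<and>
         (\<forall>x\<in>carr V. snorm W (\<phi> x) = snorm V x))"

text \<open>
  An isometry class is formed inside a type \<open>'u\<close>. To compare spaces over \<open>'a\<close> with spaces over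
  \<open>'b\<close> we take \<open>'u = 'a + 'b\<close>, which contains a copy of each of them; the lemma
  \<open>iso_class_eq_iff\<close> below confirms that nothing is lost.
\<close>

definition iso_class :: "'a snspace \<Rightarrow> 'u snspace set" where
  "iso_class V = {W. isometric V W}"

definition closed_ops :: "'a snspace \<Rightarrow> bool" where
  "closed_ops V \<longleftrightarrow> (\<forall>x\<in>carr V. \<forall>y\<in>carr V. add V x y \<in> carr V) \<and> (\<forall>c. \<forall>x\<in>carr V. scale V c x \<in> carr V)"

lemma isometric_sym:
  assumes "closed_ops V" "isometric V W"
  shows "isometric W V"
proof -
  obtain \<phi> where b: "bij_betw \<phi> (carr V) (carr W)"
    and a: "\<And>x y. x \<in> carr V \<Longrightarrow> y \<in> carr V \<Longrightarrow> \<phi> (add V x y) = add W (\<phi> x) (\<phi> y)"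
    and s: "\<And>c x. x \<in> carr V \<Longrightarrow> \<phi> (scale V c x) = scale W c (\<phi> x)"
    and n: "\<And>x. x \<in> carr V \<Longrightarrow> snorm W (\<phi> x) = snorm V x"
    using assms(2) unfolding isometric_def by blast
  define \<psi> where "\<psi> = inv_into (carr V) \<phi>"
  have b': "bij_betw \<psi> (carr W) (carr V)"
    unfolding \<psi>_def using b by (rule bij_betw_inv_into)
  have l: "\<psi> (\<phi> x) = x" if "x \<in> carr V" for x
    unfolding \<psi>_def using b that by (rule bij_betw_inv_into_left)
  have surj: "\<exists>x\<in>carr V. u = \<phi> x" if "u \<in> carr W" for u
    using b that unfolding bij_betw_def by blast
  show ?thesis
    unfolding isometric_def
  proof (intro exI conjI ballI allI)
    show "bij_betw \<psi> (carr W) (carr V)" by (rule b')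
    fix u v c assume u: "u \<in> carr W"
    obtain x where x: "x \<in> carr V" "u = \<phi> x" using surj[OF u] by blast
    show "\<psi> (scale W c u) = scale V c (\<psi> u)"
      using x s[of x c] l assms(1) unfolding closed_ops_def by metis
    show "snorm V (\<psi> u) = snorm W u"
      using x n l by simp
    assume v: "v \<in> carr W"
    obtain y where y: "y \<in> carr V" "v = \<phi> y" using surj[OF v] by blast
    show "\<psi> (add W u v) = add V (\<psi> u) (\<psi> v)"
      using x y a[of x y] l assms(1) unfolding closed_ops_def by metis
  qed
qed

lemma isometric_trans:
  assumes "isometric U V" "isometric V W"
  shows "isometric U W"
proof -
  obtain \<phi> where p: "bij_betw \<phi> (carr U) (carr V)"
         "\<forall>x\<in>carr U. \<forall>y\<in>carr U. \<phi> (add U x y) = add V (\<phi> x) (\<phi> y)"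
         "\<forall>c. \<forall>x\<in>carr U. \<phi> (scale U c x) = scale V c (\<phi> x)"
         "\<forall>x\<in>carr U. snorm V (\<phi> x) = snorm U x"
    using assms(1) unfolding isometric_def by blast
  obtain \<psi> where q: "bij_betw \<psi> (carr V) (carr W)"
         "\<forall>x\<in>carr V. \<forall>y\<in>carr V. \<psi> (add V x y) = add W (\<psi> x) (\<psi> y)"
         "\<forall>c. \<forall>x\<in>carr V. \<psi> (scale V c x) = scale W c (\<psi> x)"
         "\<forall>x\<in>carr V. snorm W (\<psi> x) = snorm V x"
    using assms(2) unfolding isometric_def by blast
  have i: "\<phi> x \<in> carr V" if "x \<in> carr U" for x
    using p(1) that by (rule bij_betw_apply)
  show ?thesis
    unfolding isometric_def
    using p q i bij_betw_trans[OF p(1) q(1)] by (intro exI[of _ "\<psi> \<circ> \<phi>"]) auto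
qed

lemma isometric_copy:
  fixes V :: "'a snspace" and j :: "'a \<Rightarrow> 'u"
  assumes "inj j"
  shows "\<exists>W :: 'u snspace. isometric V W"
proof -
  define W where "W = \<lparr>carr = j ` carr V,
     add = (\<lambda>x y. j (add V (inv j x) (inv j y))),
     scale = (\<lambda>c x. j (scale V c (inv j x))),
     zero = j (zero V),
     snorm = (\<lambda>x. snorm V (inv j x))\<rparr>"
  have "isometric V W"
    unfolding isometric_def W_def using assms
    by (intro exI[of _ j]) (auto simp: bij_betw_def inj_on_def)
  then show ?thesis by blast
qed

lemma iso_class_eq_iff:
  fixes V :: "'a snspace" and W :: "'b snspace"
  assumes "closed_ops V" "closed_ops W"
  shows "(iso_class V :: ('a + 'b) snspace set) = iso_class W \<longleftrightarrow> isometric V W"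
proof
  assume eq: "(iso_class V :: ('a + 'b) snspace set) = iso_class W"
  obtain U :: "('a + 'b) snspace" where U: "isometric V U"
    using isometric_copy[of "Inl :: 'a \<Rightarrow> 'a + 'b" V] by auto
  then have "isometric W U"
    using eq unfolding iso_class_def by auto
  then show "isometric V W"
    by (intro isometric_trans[OF U] isometric_sym[OF assms(2)])
next
  assume VW: "isometric V W"
  have "isometric V U \<longleftrightarrow> isometric W U" for U :: "('a + 'b) snspace"
    using isometric_trans[OF VW, of U] isometric_trans[OF isometric_sym[OF assms(1) VW], of U] by iprover
  then show "(iso_class V :: ('a + 'b) snspace set) = iso_class W"
    unfolding iso_class_def by (intro Collect_cong)
qed

definition cohomology :: "(nat \<Rightarrow> 'a snspace) \<Rightarrow> (nat \<Rightarrow> 'a \<Rightarrow> 'a) \<Rightarrow> nat \<Rightarrow> 'a set snspace" where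
  "cohomology C d k =
    quotient_sn ((C k)\<lparr>carr := {x \<in> carr (C k). d k x = zero (C (Suc k))}\<rparr>)
      (case k of 0 \<Rightarrow> {zero (C 0)} | Suc j \<Rightarrow> d j ` carr (C j))"


section \<open>Spaces of essentially bounded functions\<close>

definition ess_bounded :: "'x measure \<Rightarrow> ('x \<Rightarrow> real) snspace" where
  "ess_bounded M =
    \<lparr>carr = {f \<in> borel_measurable M. \<exists>C. AE x in M. \<bar>f x\<bar> \<le> C},
     add = (\<lambda>f g x. f x + g x),
     scale = (\<lambda>c f x. c * f x),
     zero = (\<lambda>x. 0),
     snorm = (\<lambda>f. real_of_ereal (esssup M (\<lambda>x. ereal \<bar>f x\<bar>)))\<rparr>"

definition null_functions :: "'x measure \<Rightarrow> ('x \<Rightarrow> real) set" where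
  "null_functions M = {f \<in> carr (ess_bounded M). AE x in M. f x = 0}"

definition L_infinity :: "'x measure \<Rightarrow> ('x \<Rightarrow> real) set snspace" where
  "L_infinity M = quotient_sn (ess_bounded M) (null_functions M)"

definition ess_class :: "'x measure \<Rightarrow> ('x \<Rightarrow> real) \<Rightarrow> ('x \<Rightarrow> real) set" where
  "ess_class M f = {h \<in> carr (ess_bounded M). AE x in M. h x = f x}"

definition L_infinity_classes :: "'x measure \<Rightarrow> (('x \<Rightarrow> real) \<Rightarrow> bool) \<Rightarrow> ('x \<Rightarrow> real) set snspace" where
  "L_infinity_classes M I =
    (L_infinity M)\<lparr>carr := ess_class M ` {f \<in> carr (ess_bounded M). I f}\<rparr>"

text \<open>The map of classes \<open>[f] \<mapsto> [D f]\<close>, for an operator \<open>D\<close> respecting almost everywhere equality.\<close>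

definition map_classes ::
  "'y measure \<Rightarrow> (('x \<Rightarrow> real) \<Rightarrow> 'y \<Rightarrow> real) \<Rightarrow> ('x \<Rightarrow> real) set \<Rightarrow> ('y \<Rightarrow> real) set" where
  "map_classes N D A = (\<Union>f\<in>A. ess_class N (D f))"


section \<open>Homogeneous differential\<close>

text \<open>
  An \<open>n\<close>-tuple is a function in an extensional product over \<open>{..<n}\<close>; \<open>face n i\<close> omits the entry
  with index \<open>i\<close> from an \<open>(n+1)\<close>-tuple.
\<close>

definition face :: "nat \<Rightarrow> nat \<Rightarrow> (nat \<Rightarrow> 'a) \<Rightarrow> nat \<Rightarrow> 'a" where
  "face n i t = (\<lambda>j\<in>{..<n}. if j < i then t j else t (Suc j))"

definition differential :: "nat \<Rightarrow> ((nat \<Rightarrow> 'a) \<Rightarrow> real) \<Rightarrow> (nat \<Rightarrow> 'a) \<Rightarrow> real" where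
  "differential n f t = (\<Sum>i\<le>n. (- 1) ^ i * f (face n i t))"


section \<open>Continuous bounded cohomology with coefficients in \<open>L\<^sup>\<infinity>(X,\<mu>)\<close>\<close>

definition cochain_measure :: "'g measure \<Rightarrow> 'x measure \<Rightarrow> nat \<Rightarrow> ((nat \<Rightarrow> 'g) \<times> 'x) measure" where
  "cochain_measure m \<mu> n = PiM {..<n} (\<lambda>_. m) \<Otimes>\<^sub>M \<mu>"

definition invariant_cochain ::
  "'g::group_add measure \<Rightarrow> ('g \<Rightarrow> 'x \<Rightarrow> 'x) \<Rightarrow> 'x measure \<Rightarrow> nat \<Rightarrow> ((nat \<Rightarrow> 'g) \<times> 'x \<Rightarrow> real) \<Rightarrow> bool" where
  "invariant_cochain m a \<mu> n f \<longleftrightarrow>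
    (\<forall>g. AE (t, x) in cochain_measure m \<mu> n. f (\<lambda>i\<in>{..<n}. g + t i, a g x) = f (t, x))"

definition Hcb ::
  "nat \<Rightarrow> 'g::group_add measure \<Rightarrow> ('g \<Rightarrow> 'x \<Rightarrow> 'x) \<Rightarrow> 'x measure
    \<Rightarrow> ((nat \<Rightarrow> 'g) \<times> 'x \<Rightarrow> real) set set snspace" where
  "Hcb k m a \<mu> = cohomology
    (\<lambda>k. L_infinity_classes (cochain_measure m \<mu> (Suc k)) (invariant_cochain m a \<mu> (Suc k)))
    (\<lambda>k. map_classes (cochain_measure m \<mu> (Suc (Suc k)))
      (\<lambda>f (t, x). differential (Suc k) (\<lambda>s. f (s, x)) t))
    k"


section \<open>Measurable bounded cohomology of measured groupoids\<close>

text \<open>Of the measure on \<open>arrows\<close> only the measurable space is used; \<open>objects\<close> carries \<open>\<nu>\<close>.\<close>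

record ('a, 'y) mgroupoid =
  objects :: "'y measure"
  arrows :: "'a measure"
  source :: "'a \<Rightarrow> 'y"
  target :: "'a \<Rightarrow> 'y"
  compose :: "'a \<Rightarrow> 'a \<Rightarrow> 'a"
  inverse_arrow :: "'a \<Rightarrow> 'a"

definition target_fiber :: "('a, 'y) mgroupoid \<Rightarrow> 'y \<Rightarrow> 'a set" where
  "target_fiber \<G> y = {\<gamma> \<in> space (arrows \<G>). target \<G> \<gamma> = y}"

definition fiber_tuples :: "('a, 'y) mgroupoid \<Rightarrow> nat \<Rightarrow> (nat \<Rightarrow> 'a) set" where
  "fiber_tuples \<G> n = {\<gamma> \<in> {..<n} \<rightarrow>\<^sub>E space (arrows \<G>).
    \<forall>i<n. \<forall>j<n. target \<G> (\<gamma> i) = target \<G> (\<gamma> j)}"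

definition tuple_measure :: "('a, 'y) mgroupoid \<Rightarrow> nat \<Rightarrow> (nat \<Rightarrow> 'a) measure" where
  "tuple_measure \<G> n = measure_of (fiber_tuples \<G> n)
    (sets (restrict_space (PiM {..<n} (\<lambda>_. arrows \<G>)) (fiber_tuples \<G> n)))
    (\<lambda>A. \<integral>\<^sup>+ y. emeasure (count_space UNIV) (A \<inter> ({..<n} \<rightarrow>\<^sub>E target_fiber \<G> y)) \<partial>objects \<G>)"

definition invariant_tuple_function ::
  "('a, 'y) mgroupoid \<Rightarrow> nat \<Rightarrow> ((nat \<Rightarrow> 'a) \<Rightarrow> real) \<Rightarrow> bool" where
  "invariant_tuple_function \<G> n f \<longleftrightarrow>
    (AE \<gamma> in tuple_measure \<G> n. \<forall>\<alpha>\<in>target_fiber \<G> (target \<G> (\<gamma> 0)).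
       f (\<lambda>i\<in>{..<n}. compose \<G> (inverse_arrow \<G> \<alpha>) (\<gamma> i)) = f \<gamma>)"

definition Hmb :: "nat \<Rightarrow> ('a, 'y) mgroupoid \<Rightarrow> ((nat \<Rightarrow> 'a) \<Rightarrow> real) set set snspace" where
  "Hmb k \<G> = cohomology
    (\<lambda>k. L_infinity_classes (tuple_measure \<G> (Suc k)) (invariant_tuple_function \<G> (Suc k)))
    (\<lambda>k. map_classes (tuple_measure \<G> (Suc (Suc k))) (differential (Suc k)))
    k"


section \<open>Haar measure and metrics\<close>

text \<open>On a locally compact second countable group the usual regularity conditions are automatic.\<close>

definition haar_measure :: "'g::topological_group_add measure \<Rightarrow> bool" where
  "haar_measure m \<longleftrightarrow> sets m = sets borel \<and>
    (\<forall>K. compact K \<longrightarrow> emeasure m K < \<infinity>) \<and>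
    (\<forall>U. open U \<and> U \<noteq> {} \<longrightarrow> emeasure m U > 0) \<and>
    (\<forall>g. distr m borel (\<lambda>x. g + x) = m)"

definition unimodular :: "'g::topological_group_add itself \<Rightarrow> bool" where
  "unimodular _ \<longleftrightarrow>
    (\<forall>m :: 'g measure. haar_measure m \<longrightarrow> (\<forall>g. distr m borel (\<lambda>x. x + g) = m))"

definition proper_right_invariant_metric :: "('g::topological_group_add \<Rightarrow> 'g \<Rightarrow> real) \<Rightarrow> bool" where
  "proper_right_invariant_metric d \<longleftrightarrow> Metric_space UNIV d \<and>
    Metric_space.mtopology UNIV d = euclidean \<and>
    (\<forall>x r. compact {y. d x y \<le> r}) \<and>
    (\<forall>x y g. d (x + g) (y + g) = d x y)"


section \<open>Hulls\<close>

text \<open>The action \<open>g \<cdot> P = P g\<inverse>\<close>.\<close>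

definition act :: "'g::group_add \<Rightarrow> 'g set \<Rightarrow> 'g set" where
  "act g P = (\<lambda>p. p - g) ` P"

definition fell_topology :: "'g::topological_space set topology" where
  "fell_topology = topology_generated_by
    ({{F. closed F \<and> F \<inter> K = {}} | K. compact K} \<union> {{F. closed F \<and> F \<inter> U \<noteq> {}} | U. open U})"

definition pattern_hull :: "'g::topological_group_add set \<Rightarrow> 'g set set" where
  "pattern_hull P = (fell_topology closure_of (range (\<lambda>g. act g P))) - {{}}"

definition transversal :: "'g::topological_group_add set \<Rightarrow> 'g set set" where
  "transversal P = {Q \<in> pattern_hull P. 0 \<in> Q}"

definition hull_borel :: "'g::topological_group_add set \<Rightarrow> 'g set measure" where
  "hull_borel P = sigma (pattern_hull P) {U. openin (subtopology fell_topology (pattern_hull P)) U}"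

definition ergodic_measures :: "'g::topological_group_add set \<Rightarrow> 'g set measure set" where
  "ergodic_measures P = {\<mu>. sets \<mu> = sets (hull_borel P) \<and> prob_space \<mu> \<and>
    (\<forall>g. distr \<mu> \<mu> (act g) = \<mu>) \<and>
    (\<forall>A\<in>sets \<mu>. (\<forall>g. act g ` A = A) \<longrightarrow> measure \<mu> A = 0 \<or> measure \<mu> A = 1)}"

definition measured_set :: "'g::topological_group_add set \<Rightarrow> bool" where
  "measured_set P \<longleftrightarrow> ergodic_measures P \<noteq> {}"

definition locally_finite_set :: "'g::topological_space set \<Rightarrow> bool" where
  "locally_finite_set P \<longleftrightarrow> (\<forall>B. compact (closure B) \<longrightarrow> finite (B \<inter> P))"

definition FLC :: "'g::topological_group_add set \<Rightarrow> bool" where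
  "FLC P \<longleftrightarrow> (\<forall>B. compact (closure B) \<longrightarrow> finite {B \<inter> act g P | g. g \<in> P})"

definition voronoi_cell :: "('g \<Rightarrow> 'g \<Rightarrow> real) \<Rightarrow> 'g set \<Rightarrow> 'g \<Rightarrow> 'g set" where
  "voronoi_cell d P p = {g. \<forall>q\<in>P. d g p \<le> d g q}"

definition finite_voronoi_volume :: "('g \<Rightarrow> 'g \<Rightarrow> real) \<Rightarrow> 'g measure \<Rightarrow> 'g set \<Rightarrow> bool" where
  "finite_voronoi_volume d m P \<longleftrightarrow>
    (\<exists>C::real. \<forall>p\<in>P. emeasure m (voronoi_cell d P p) \<le> ennreal C)"


section \<open>The transverse measure and the pattern groupoid\<close>

definition transversal_borel :: "'g::topological_group_add set \<Rightarrow> 'g set measure" where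
  "transversal_borel P = restrict_space (hull_borel P) (transversal P)"

definition return_times :: "'g::topological_group_add set \<Rightarrow> 'g set \<Rightarrow> 'g set" where
  "return_times P x = {g. act g x \<in> transversal P}"

definition is_transverse_measure ::
  "'g::topological_group_add measure \<Rightarrow> 'g set \<Rightarrow> 'g set measure \<Rightarrow> 'g set measure \<Rightarrow> bool" where
  "is_transverse_measure m P \<mu> \<nu> \<longleftrightarrow> sets \<nu> = sets (transversal_borel P) \<and>
    (\<forall>f \<in> transversal_borel P \<rightarrow>\<^sub>M (borel :: ennreal measure).
     \<forall>w \<in> borel \<rightarrow>\<^sub>M (borel :: ennreal measure).
       (\<integral>\<^sup>+ g. w g \<partial>m) = 1 \<longrightarrow>
       (\<integral>\<^sup>+ y. f y \<partial>\<nu>) =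
       (\<integral>\<^sup>+ x. (\<integral>\<^sup>+ g. f (act g x) * w g \<partial>count_space (return_times P x)) \<partial>\<mu>))"

definition transverse_measure ::
  "'g::topological_group_add measure \<Rightarrow> 'g set \<Rightarrow> 'g set measure \<Rightarrow> 'g set measure" where
  "transverse_measure m P \<mu> = (THE \<nu>. is_transverse_measure m P \<mu> \<nu>)"

definition pattern_groupoid ::
  "'g::topological_group_add measure \<Rightarrow> 'g set \<Rightarrow> 'g set measure \<Rightarrow> ('g \<times> 'g set, 'g set) mgroupoid" where
  "pattern_groupoid m P \<mu> =
    \<lparr>objects = transverse_measure m P \<mu>,
     arrows = restrict_space (borel \<Otimes>\<^sub>M transversal_borel P)
       {(g, y). y \<in> transversal P \<and> act g y \<in> transversal P},
     source = (\<lambda>(g, y). y),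
     target = (\<lambda>(g, y). act g y),
     compose = (\<lambda>(g, z) (h, y). (g + h, y)),
     inverse_arrow = (\<lambda>(g, y). (- g, act g y))\<rparr>"

text \<open>
  A sum type containing copies of both the cohomology of the pattern groupoid and that of the
  group, in which isometry classes are formed.
\<close>

type_synonym 'g class_carrier =
  "((nat \<Rightarrow> 'g \<times> 'g set) \<Rightarrow> real) set set + ((nat \<Rightarrow> 'g) \<times> 'g set \<Rightarrow> real) set set"

definition Hb_pattern ::
  "nat \<Rightarrow> 'g::topological_group_add measure \<Rightarrow> 'g set \<Rightarrow> 'g set measure
    \<Rightarrow> ((nat \<Rightarrow> 'g \<times> 'g set) \<Rightarrow> real) set set snspace" where
  "Hb_pattern k m P \<mu> = Hmb k (pattern_groupoid m P \<mu>)"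

definition Hb ::
  "nat \<Rightarrow> 'g::topological_group_add measure \<Rightarrow> 'g set \<Rightarrow> 'g class_carrier snspace set set" where
  "Hb k m P = {iso_class (Hb_pattern k m P \<mu>) | \<mu>. \<mu> \<in> ergodic_measures P}"

end

theory Submission
  imports Defs
begin

text \<open>
  For \<open>x\<close> in the hull, the set of return times of \<open>x\<close> is \<open>x\<close> itself, so an \<open>n\<close>-tuple of the pattern
  groupoid over \<open>y\<close> is a tuple \<open>t\<close> of group elements with all \<open>- t\<^sub>i \<in> y\<close>. Both complexes then consist of
  \<open>G\<close>-invariant functions of \<open>(t, x)\<close>, considered up to different null sets: almost every \<open>x\<close> and almost
  every \<open>t\<close> for the group, almost every \<open>x\<close> and every \<open>t\<close> with entries in \<open>- x\<close> for the groupoid; here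
  \<open>\<nu>\<close> and \<open>\<mu>\<close> have the same invariant null sets. Averaging each entry of \<open>t\<close> over a right translate by a
  random element with a positive density turns statements about almost every \<open>t\<close> into statements about
  every \<open>t\<close>, and moving each entry of \<open>t\<close> equivariantly into \<open>- x\<close> goes the other way. These two
  operations do not increase norms, and the prism operators show that they are inverse to each other
  in cohomology. Finite local complexity makes all patterns of the hull uniformly discrete, hence
  measurably enumerable, which provides the equivariant map into \<open>- x\<close> and the measurability of all
  counting functions.
\<close>

section \<open>Cohomology of complexes of essentially bounded functions\<close>

text \<open>Tuples with entries in \<open>- x\<close> usually form a null set for the Haar powers,
  so a class cannot simply be restricted to them; moreover, a group cochain is invariant under each
  \<open>g\<close> only off a null set depending on \<open>g\<close>. A cochain is therefore first
  replaced by a Borel function that is invariant and bounded at every point; its average then has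
  values at every tuple. The two composites are smearings along the kernels
  \<open>near t x + s\<close> and \<open>near (t + s) x\<close>. The prism homotopy needs the
  cocycle equation at tuples mixed from \<open>t\<close> and its smeared version. The first kernel
  has an absolutely continuous law in \<open>s\<close>, so validity almost everywhere suffices; the
  second stays in \<open>- x\<close>, where validity at every tuple is known. The variables
  \<open>s\<close> follow a probability measure equivalent to Haar measure: forgetting one of them
  preserves the law, so smearing commutes with faces. Unimodularity gives right invariance, hence
  invariance of orbit averages and, through inversion, independence of the transverse measure from
  the weight.\<close>

lemma snorm_ess_bounded_nonneg: "0 \<le> snorm (ess_bounded M) f"
proof (cases "(\<lambda>x. ereal \<bar>f x\<bar>) \<in> borel_measurable M \<and> \<not> (AE x in M. False)")
  case True
  have "0 \<le> esssup M (\<lambda>x. ereal \<bar>f x\<bar>)"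
  proof (rule ccontr)
    assume "\<not> 0 \<le> esssup M (\<lambda>x. ereal \<bar>f x\<bar>)"
    then have "AE x in M. False"
      using esssup_AE[where M = M and f = "\<lambda>x. ereal \<bar>f x\<bar>"] by (auto elim!: eventually_mono simp: not_le dest: le_less_trans[of "ereal \<bar>_\<bar>"])
    with True show False by simp
  qed
  then show ?thesis by (simp add: ess_bounded_def real_of_ereal_pos)
next
  \<comment> \<open>The essential supremum is \<infinity> for a non-measurable function and
    -\<infinity> over a null measure; \<open>real_of_ereal\<close> sends both to 0.\<close>
  case False
  then consider "(\<lambda>x. ereal \<bar>f x\<bar>) \<notin> borel_measurable M" | "(\<lambda>x. ereal \<bar>f x\<bar>) \<in> borel_measurable M" "AE x in M. False" by blast
  then show ?thesis
  proof cases
    case 1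
    then show ?thesis by (simp add: ess_bounded_def esssup_non_measurable top_ereal_def)
  next
    case 2
    then have "esssup M (\<lambda>x. ereal \<bar>f x\<bar>) \<le> c" for c
      by (intro esssup_I) (auto elim!: eventually_mono)
    from this[of "-\<infinity>"] show ?thesis by (simp add: ess_bounded_def)
  qed
qed

text \<open>Replaces essential suprema by almost everywhere bounds. The sign of \<open>C\<close>
  matters: over a null measure every bound holds almost everywhere while the seminorm is 0.\<close>

lemma snorm_ess_bounded_le_iff:
  assumes f: "f \<in> carr (ess_bounded M)" and "0 \<le> C"
  shows "snorm (ess_bounded M) f \<le> C \<longleftrightarrow> (AE x in M. \<bar>f x\<bar> \<le> C)"
proof
  have [measurable]: "f \<in> borel_measurable M" using f by (simp add: ess_bounded_def)
  let ?S = "esssup M (\<lambda>x. ereal \<bar>f x\<bar>)"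
  { assume "AE x in M. \<bar>f x\<bar> \<le> C"
    then have "?S \<le> ereal C" by (intro esssup_I) auto
    then show "snorm (ess_bounded M) f \<le> C"
      using \<open>0 \<le> C\<close> by (cases ?S) (auto simp: ess_bounded_def) }
  assume le: "snorm (ess_bounded M) f \<le> C"
  obtain C' where "AE x in M. \<bar>f x\<bar> \<le> C'" using f by (auto simp: ess_bounded_def)
  then have "?S \<le> ereal C'" by (intro esssup_I) auto
  then have "?S \<le> ereal C"
    using le by (cases ?S) (auto simp: ess_bounded_def)
  then show "AE x in M. \<bar>f x\<bar> \<le> C"
    using esssup_AE[where M = M and f = "\<lambda>x. ereal \<bar>f x\<bar>"]
    by (auto elim!: eventually_mono dest: order_trans)
qed

lemma carr_ess_bounded_add:
  assumes "f \<in> carr (ess_bounded M)" "g \<in> carr (ess_bounded M)"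
  shows "(\<lambda>x. f x + g x) \<in> carr (ess_bounded M)"
proof -
  obtain C D where "AE x in M. \<bar>f x\<bar> \<le> C" "AE x in M. \<bar>g x\<bar> \<le> D"
    using assms by (auto simp: ess_bounded_def)
  then have "AE x in M. \<bar>f x + g x\<bar> \<le> C + D"
    by eventually_elim (simp add: abs_triangle_ineq[THEN order_trans] add_mono)
  then show ?thesis using assms by (auto simp: ess_bounded_def)
qed

lemma carr_ess_bounded_scale:
  assumes "f \<in> carr (ess_bounded M)"
  shows "(\<lambda>x. c * f x) \<in> carr (ess_bounded M)"
proof -
  obtain C where "AE x in M. \<bar>f x\<bar> \<le> C"
    using assms by (auto simp: ess_bounded_def)
  then have "AE x in M. \<bar>c * f x\<bar> \<le> \<bar>c\<bar> * C"
    by eventually_elim (simp add: abs_mult mult_left_mono)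
  then show ?thesis using assms by (auto simp: ess_bounded_def)
qed

lemma carr_ess_bounded_zero: "(\<lambda>x. 0) \<in> carr (ess_bounded M)"
  by (auto simp: ess_bounded_def)

lemma carr_ess_bounded_diff:
  assumes "f \<in> carr (ess_bounded M)" "g \<in> carr (ess_bounded M)"
  shows "(\<lambda>x. f x - g x) \<in> carr (ess_bounded M)"
  using carr_ess_bounded_add[OF assms(1) carr_ess_bounded_scale[OF assms(2), of "-1"]] by simp

section \<open>Arithmetic of classes modulo null functions\<close>

lemma ess_class_eq:
  assumes "AE x in M. f x = g x"
  shows "ess_class M f = ess_class M g"
  using assms unfolding ess_class_def by (auto elim!: eventually_elim2)

lemma ess_class_eq_iff:
  assumes "f \<in> carr (ess_bounded M)"
  shows "ess_class M f = ess_class M g \<longleftrightarrow> (AE x in M. f x = g x)"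
  using assms ess_class_eq[where M = M and f = f and g = g] unfolding ess_class_def by auto

lemma add_L_infinity_ess_class:
  assumes f: "f \<in> carr (ess_bounded M)" and g: "g \<in> carr (ess_bounded M)"
  shows "add (L_infinity M) (ess_class M f) (ess_class M g) = ess_class M (\<lambda>x. f x + g x)"
proof (intro set_eqI iffI)
  fix h assume "h \<in> add (L_infinity M) (ess_class M f) (ess_class M g)"
  then obtain a b where "a \<in> ess_class M f" "b \<in> ess_class M g" "h = (\<lambda>x. a x + b x)"
    by (auto simp: L_infinity_def quotient_sn_def ess_bounded_def)
  then show "h \<in> ess_class M (\<lambda>x. f x + g x)"
    by (auto simp: ess_class_def intro!: carr_ess_bounded_add)
next
  fix h assume h: "h \<in> ess_class M (\<lambda>x. f x + g x)"
  have "(\<lambda>x. h x - g x) \<in> ess_class M f" "g \<in> ess_class M g"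
    using h g by (auto simp: ess_class_def intro!: carr_ess_bounded_diff)
  then show "h \<in> add (L_infinity M) (ess_class M f) (ess_class M g)"
    by (force simp: L_infinity_def quotient_sn_def ess_bounded_def)
qed

lemma scale_L_infinity_ess_class:
  assumes f: "f \<in> carr (ess_bounded M)"
  shows "scale (L_infinity M) c (ess_class M f) = ess_class M (\<lambda>x. c * f x)"
proof (intro set_eqI iffI)
  fix h assume "h \<in> scale (L_infinity M) c (ess_class M f)"
  then obtain a w where "a \<in> ess_class M f" "w \<in> null_functions M" "h = (\<lambda>x. c * a x + w x)"
    by (auto simp: L_infinity_def quotient_sn_def ess_bounded_def)
  then show "h \<in> ess_class M (\<lambda>x. c * f x)"
    by (auto simp: ess_class_def null_functions_def
        intro!: carr_ess_bounded_add carr_ess_bounded_scale)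
next
  fix h assume h: "h \<in> ess_class M (\<lambda>x. c * f x)"
  have "(\<lambda>x. h x - c * f x) \<in> null_functions M" "f \<in> ess_class M f"
    using h f by (auto simp: ess_class_def null_functions_def
        intro!: carr_ess_bounded_diff carr_ess_bounded_scale)
  then show "h \<in> scale (L_infinity M) c (ess_class M f)"
    by (force simp: L_infinity_def quotient_sn_def ess_bounded_def)
qed

lemma snorm_ess_bounded_cong:
  assumes "f \<in> carr (ess_bounded M)" "g \<in> carr (ess_bounded M)" "AE x in M. f x = g x"
  shows "snorm (ess_bounded M) f = snorm (ess_bounded M) g"
proof -
  have "snorm (ess_bounded M) f \<le> C \<longleftrightarrow> snorm (ess_bounded M) g \<le> C" if "0 \<le> C" for C
    using assms that by (auto simp: snorm_ess_bounded_le_iff elim!: eventually_elim2)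
  from this[OF snorm_ess_bounded_nonneg] show ?thesis by (meson antisym order_refl)
qed

lemma snorm_L_infinity_ess_class:
  assumes f: "f \<in> carr (ess_bounded M)"
  shows "snorm (L_infinity M) (ess_class M f) = snorm (ess_bounded M) f"
proof -
  have "snorm (ess_bounded M) h = snorm (ess_bounded M) f" if "h \<in> ess_class M f" for h
    using that f by (intro snorm_ess_bounded_cong) (auto simp: ess_class_def)
  moreover have "f \<in> ess_class M f" using f by (simp add: ess_class_def)
  ultimately have "snorm (ess_bounded M) ` ess_class M f = {snorm (ess_bounded M) f}" by blast
  then show ?thesis by (simp add: L_infinity_def quotient_sn_def)
qed

lemma zero_L_infinity: "zero (L_infinity M) = ess_class M (\<lambda>x. 0)"
  by (simp add: L_infinity_def quotient_sn_def null_functions_def ess_class_def)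

lemma L_infinity_classes_simps:
  "carr (L_infinity_classes M I) = ess_class M ` {f \<in> carr (ess_bounded M). I f}"
  "add (L_infinity_classes M I) = add (L_infinity M)"
  "scale (L_infinity_classes M I) = scale (L_infinity M)"
  "zero (L_infinity_classes M I) = zero (L_infinity M)"
  "snorm (L_infinity_classes M I) = snorm (L_infinity M)"
  by (simp_all add: L_infinity_classes_def)

text \<open>Treats cochains as functions, so that both complexes are instances and the passage to
  classes is done only once. \<open>D_AE\<close> makes the differential well defined on
  classes.\<close>

locale fn_complex =
  fixes M :: "nat \<Rightarrow> 'x measure"
    and I :: "nat \<Rightarrow> ('x \<Rightarrow> real) \<Rightarrow> bool"
    and D :: "nat \<Rightarrow> ('x \<Rightarrow> real) \<Rightarrow> 'x \<Rightarrow> real"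
  assumes I_zero: "I k (\<lambda>x. 0)"
    and I_add: "\<lbrakk>f \<in> carr (ess_bounded (M k)); g \<in> carr (ess_bounded (M k)); I k f; I k g\<rbrakk>
      \<Longrightarrow> I k (\<lambda>x. f x + g x)"
    and I_scale: "\<lbrakk>f \<in> carr (ess_bounded (M k)); I k f\<rbrakk> \<Longrightarrow> I k (\<lambda>x. c * f x)"
    and D_carr: "\<lbrakk>f \<in> carr (ess_bounded (M k)); I k f\<rbrakk> \<Longrightarrow> D k f \<in> carr (ess_bounded (M (Suc k)))"
    and D_I: "\<lbrakk>f \<in> carr (ess_bounded (M k)); I k f\<rbrakk> \<Longrightarrow> I (Suc k) (D k f)"
    and D_add: "D k (\<lambda>x. f x + g x) = (\<lambda>x. D k f x + D k g x)"
    and D_scale: "D k (\<lambda>x. c * f x) = (\<lambda>x. c * D k f x)"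
    and D_AE: "\<lbrakk>f \<in> carr (ess_bounded (M k)); g \<in> carr (ess_bounded (M k)); AE x in M k. f x = g x\<rbrakk>
      \<Longrightarrow> AE x in M (Suc k). D k f x = D k g x"
begin

definition cochains :: "nat \<Rightarrow> ('x \<Rightarrow> real) set" where
  "cochains k = {f \<in> carr (ess_bounded (M k)). I k f}"

definition coboundaries :: "nat \<Rightarrow> ('x \<Rightarrow> real) set" where
  "coboundaries k = (case k of 0 \<Rightarrow> {\<lambda>x. 0} | Suc j \<Rightarrow> D j ` cochains j)"

definition cocycles :: "nat \<Rightarrow> ('x \<Rightarrow> real) set" where
  "cocycles k = {f \<in> cochains k. AE x in M (Suc k). D k f x = 0}"

definition cohomologous :: "nat \<Rightarrow> ('x \<Rightarrow> real) \<Rightarrow> ('x \<Rightarrow> real) \<Rightarrow> bool" where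
  "cohomologous k f g \<longleftrightarrow> (\<exists>c\<in>coboundaries k. AE x in M k. f x = g x + c x)"

definition cohomology_class :: "nat \<Rightarrow> ('x \<Rightarrow> real) \<Rightarrow> ('x \<Rightarrow> real) set set" where
  "cohomology_class k f = (\<lambda>c. ess_class (M k) (\<lambda>x. f x + c x)) ` coboundaries k"

abbreviation H where
  "H k \<equiv> cohomology (\<lambda>k. L_infinity_classes (M k) (I k)) (\<lambda>k. map_classes (M (Suc k)) (D k)) k"

lemma cochains_carr: "f \<in> cochains k \<Longrightarrow> f \<in> carr (ess_bounded (M k))"
  by (simp add: cochains_def)

lemma cochains_zero: "(\<lambda>x. 0) \<in> cochains k"
  by (simp add: cochains_def I_zero carr_ess_bounded_zero)

lemma cochains_add: "f \<in> cochains k \<Longrightarrow> g \<in> cochains k \<Longrightarrow> (\<lambda>x. f x + g x) \<in> cochains k"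
  by (simp add: cochains_def I_add carr_ess_bounded_add)

lemma cochains_scale: "f \<in> cochains k \<Longrightarrow> (\<lambda>x. c * f x) \<in> cochains k"
  by (simp add: cochains_def I_scale carr_ess_bounded_scale)

lemma D_cochains: "f \<in> cochains k \<Longrightarrow> D k f \<in> cochains (Suc k)"
  by (simp add: cochains_def D_carr D_I)

lemma D_zero: "D k (\<lambda>x. 0) = (\<lambda>x. 0)"
  using D_scale[of k 0 "\<lambda>x. 0"] by simp

lemma coboundaries_cochains: "c \<in> coboundaries k \<Longrightarrow> c \<in> cochains k"
  by (cases k) (auto simp: coboundaries_def cochains_zero D_cochains)

lemma coboundaries_zero: "(\<lambda>x. 0) \<in> coboundaries k"
proof (cases k)
  case (Suc j)
  then show ?thesis
    using cochains_zero[of j] D_zero[of j] by (force simp: coboundaries_def image_iff)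
qed (simp add: coboundaries_def)

lemma coboundaries_add:
  "c \<in> coboundaries k \<Longrightarrow> c' \<in> coboundaries k \<Longrightarrow> (\<lambda>x. c x + c' x) \<in> coboundaries k"
  by (cases k) (auto simp: coboundaries_def D_add[symmetric] cochains_add)

lemma coboundaries_scale:
  "c \<in> coboundaries k \<Longrightarrow> (\<lambda>x. r * c x) \<in> coboundaries k"
  by (cases k) (auto simp: coboundaries_def D_scale[symmetric] cochains_scale)

lemma cocycles_cochains: "f \<in> cocycles k \<Longrightarrow> f \<in> cochains k"
  by (simp add: cocycles_def)

lemma cocycles_carr: "f \<in> cocycles k \<Longrightarrow> f \<in> carr (ess_bounded (M k))"
  by (simp add: cocycles_def cochains_def)

lemma cocycles_add: "f \<in> cocycles k \<Longrightarrow> g \<in> cocycles k \<Longrightarrow> (\<lambda>x. f x + g x) \<in> cocycles k"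
  by (auto simp: cocycles_def cochains_add D_add)

lemma cocycles_scale: "f \<in> cocycles k \<Longrightarrow> (\<lambda>x. c * f x) \<in> cocycles k"
  by (auto simp: cocycles_def cochains_scale D_scale)

lemma cohomologousI: "c \<in> coboundaries k \<Longrightarrow> AE x in M k. f x = g x + c x \<Longrightarrow> cohomologous k f g"
  by (auto simp: cohomologous_def)

lemma cohomologous_AE: "AE x in M k. f x = g x \<Longrightarrow> cohomologous k f g"
  by (rule cohomologousI[OF coboundaries_zero]) simp

lemma cohomologous_sym:
  assumes "cohomologous k f g" shows "cohomologous k g f"
proof -
  obtain c where c: "c \<in> coboundaries k" "AE x in M k. f x = g x + c x"
    using assms by (auto simp: cohomologous_def)
  from c(2) have "AE x in M k. g x = f x + (- 1) * c x"
    by eventually_elim simp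
  then show ?thesis by (rule cohomologousI[OF coboundaries_scale[OF c(1)]])
qed

lemma cohomologous_trans:
  assumes "cohomologous k f g" "cohomologous k g h" shows "cohomologous k f h"
proof -
  obtain c c' where c: "c \<in> coboundaries k" "AE x in M k. f x = g x + c x"
    and c': "c' \<in> coboundaries k" "AE x in M k. g x = h x + c' x"
    using assms by (auto simp: cohomologous_def)
  from c(2) c'(2) have "AE x in M k. f x = h x + (c x + c' x)"
    by eventually_elim simp
  then show ?thesis by (rule cohomologousI[OF coboundaries_add[OF c(1) c'(1)]])
qed

text \<open>The coboundary relating \<open>f\<close> to \<open>g\<close> is absorbed into the
  varying one. The reverse inclusion follows by symmetry of \<open>cohomologous\<close>.\<close>

lemma cohomology_class_subset:
  assumes "cohomologous k f g"
  shows "cohomology_class k f \<subseteq> cohomology_class k g"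
proof
  obtain c where c: "c \<in> coboundaries k" "AE x in M k. f x = g x + c x"
    using assms by (auto simp: cohomologous_def)
  fix A assume "A \<in> cohomology_class k f"
  then obtain c' where c': "c' \<in> coboundaries k" "A = ess_class (M k) (\<lambda>x. f x + c' x)"
    by (auto simp: cohomology_class_def)
  have "A = ess_class (M k) (\<lambda>x. g x + (c x + c' x))"
    unfolding c'(2) using c(2) by (intro ess_class_eq) (auto elim!: eventually_mono)
  then show "A \<in> cohomology_class k g"
    using coboundaries_add[OF c(1) c'(1)] by (auto simp: cohomology_class_def)
qed

lemma cohomology_class_eq_iff:
  assumes "f \<in> carr (ess_bounded (M k))"
  shows "cohomology_class k f = cohomology_class k g \<longleftrightarrow> cohomologous k f g"
proof
  assume "cohomologous k f g"
  then show "cohomology_class k f = cohomology_class k g"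
    using cohomology_class_subset cohomologous_sym by blast
next
  assume "cohomology_class k f = cohomology_class k g"
  moreover have "ess_class (M k) f \<in> cohomology_class k f"
    unfolding cohomology_class_def by (rule image_eqI[OF _ coboundaries_zero]) simp
  ultimately obtain c where "c \<in> coboundaries k" "ess_class (M k) f = ess_class (M k) (\<lambda>x. g x + c x)"
    by (auto simp: cohomology_class_def)
  then show "cohomologous k f g"
    using assms by (auto simp: ess_class_eq_iff intro: cohomologousI)
qed

lemma map_classes_D:
  assumes "f \<in> carr (ess_bounded (M k))"
  shows "map_classes (M (Suc k)) (D k) (ess_class (M k) f) = ess_class (M (Suc k)) (D k f)"
proof -
  have "ess_class (M (Suc k)) (D k g) = ess_class (M (Suc k)) (D k f)" if "g \<in> ess_class (M k) f" for g
    using that assms by (intro ess_class_eq D_AE) (auto simp: ess_class_def)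
  moreover have "f \<in> ess_class (M k) f" using assms by (simp add: ess_class_def)
  ultimately show ?thesis unfolding map_classes_def by (intro SUP_eq_const) blast+
qed

lemma coboundary_classes:
  "(case k of 0 \<Rightarrow> {zero (L_infinity_classes (M 0) (I 0))}
    | Suc j \<Rightarrow> map_classes (M (Suc j)) (D j) ` carr (L_infinity_classes (M j) (I j)))
   = ess_class (M k) ` coboundaries k"
proof (cases k)
  case 0
  then show ?thesis by (simp add: coboundaries_def L_infinity_classes_simps zero_L_infinity)
next
  case (Suc j)
  then show ?thesis
    by (auto simp: coboundaries_def L_infinity_classes_simps cochains_def map_classes_D image_image
        intro!: image_cong)
qed

lemma H_eq: "H k = quotient_sn
    ((L_infinity (M k))\<lparr>carr := ess_class (M k) ` cocycles k\<rparr>) (ess_class (M k) ` coboundaries k)"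
proof -
  have "map_classes (M (Suc k)) (D k) (ess_class (M k) f) = zero (L_infinity (M (Suc k)))
      \<longleftrightarrow> (AE x in M (Suc k). D k f x = 0)" if "f \<in> cochains k" for f
    using that D_cochains[OF that]
    by (simp add: zero_L_infinity map_classes_D ess_class_eq_iff cochains_carr)
  then have "{x \<in> carr (L_infinity_classes (M k) (I k)).
      map_classes (M (Suc k)) (D k) x = zero (L_infinity_classes (M (Suc k)) (I (Suc k)))}
    = ess_class (M k) ` cocycles k"
    unfolding L_infinity_classes_simps cocycles_def cochains_def[symmetric] by blast
  then show ?thesis
    by (simp only: cohomology_def coboundary_classes) (simp add: L_infinity_classes_def)
qed

lemma carr_H: "carr (H k) = cohomology_class k ` cocycles k"
  unfolding H_eq quotient_sn_def
  by (auto simp: cohomology_class_def image_image add_L_infinity_ess_class cocycles_carr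
      coboundaries_cochains[THEN cochains_carr] intro!: image_cong)

lemma add_H:
  assumes f: "f \<in> carr (ess_bounded (M k))" and g: "g \<in> carr (ess_bounded (M k))"
  shows "add (H k) (cohomology_class k f) (cohomology_class k g) = cohomology_class k (\<lambda>x. f x + g x)"
proof -
  have *: "add (L_infinity (M k)) (ess_class (M k) (\<lambda>x. f x + c x)) (ess_class (M k) (\<lambda>x. g x + c' x))
    = ess_class (M k) (\<lambda>x. (f x + g x) + (c x + c' x))"
    if "c \<in> coboundaries k" "c' \<in> coboundaries k" for c c'
    using that f g
    by (subst add_L_infinity_ess_class)
      (auto intro!: carr_ess_bounded_add simp: ac_simps coboundaries_cochains[THEN cochains_carr])
  have "add (H k) (cohomology_class k f) (cohomology_class k g) =
     {add (L_infinity (M k)) (ess_class (M k) (\<lambda>x. f x + c x)) (ess_class (M k) (\<lambda>x. g x + c' x))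
       | c c'. c \<in> coboundaries k \<and> c' \<in> coboundaries k}"
    unfolding H_eq quotient_sn_def cohomology_class_def by auto
  also have "\<dots> = {ess_class (M k) (\<lambda>x. (f x + g x) + (c x + c' x))
       | c c'. c \<in> coboundaries k \<and> c' \<in> coboundaries k}"
    by (intro Collect_cong ex_cong1) (use * in auto)
  also have "\<dots> = cohomology_class k (\<lambda>x. f x + g x)"
    unfolding cohomology_class_def
  proof (intro equalityI subsetI)
    fix A assume "A \<in> (\<lambda>c. ess_class (M k) (\<lambda>x. f x + g x + c x)) ` coboundaries k"
    then obtain c where c: "c \<in> coboundaries k" "A = ess_class (M k) (\<lambda>x. f x + g x + (c x + 0))"
      by auto
    then show "A \<in> {ess_class (M k) (\<lambda>x. f x + g x + (c x + c' x)) | c c'.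
        c \<in> coboundaries k \<and> c' \<in> coboundaries k}"
      by (intro CollectI exI[of _ c] exI[of _ "\<lambda>x. 0"] conjI coboundaries_zero)
  next
    fix A assume "A \<in> {ess_class (M k) (\<lambda>x. f x + g x + (c x + c' x)) | c c'.
        c \<in> coboundaries k \<and> c' \<in> coboundaries k}"
    then obtain c c' where c: "c \<in> coboundaries k" "c' \<in> coboundaries k"
      and A: "A = ess_class (M k) (\<lambda>x. f x + g x + (c x + c' x))" by blast
    show "A \<in> (\<lambda>c. ess_class (M k) (\<lambda>x. f x + g x + c x)) ` coboundaries k"
      by (rule image_eqI[where f = "\<lambda>c. ess_class (M k) (\<lambda>x. f x + g x + c x)",
            OF A coboundaries_add[OF c]])
  qed
  finally show ?thesis .
qed

text \<open>\<open>quotient_sn\<close> adds all of \<open>W\<close> after scaling, so that the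
  scalar 0 gives the zero coset and not a single point; the summand \<open>c'\<close> below comes
  from this \<open>W\<close>.\<close>

lemma scale_H:
  assumes f: "f \<in> carr (ess_bounded (M k))"
  shows "scale (H k) r (cohomology_class k f) = cohomology_class k (\<lambda>x. r * f x)"
proof -
  have *: "add (L_infinity (M k)) (scale (L_infinity (M k)) r (ess_class (M k) (\<lambda>x. f x + c x))) (ess_class (M k) c')
    = ess_class (M k) (\<lambda>x. r * f x + (r * c x + c' x))"
    if "c \<in> coboundaries k" "c' \<in> coboundaries k" for c c'
    using that f
    by (subst scale_L_infinity_ess_class, simp add: carr_ess_bounded_add coboundaries_cochains[THEN cochains_carr],
        subst add_L_infinity_ess_class)
      (auto intro!: carr_ess_bounded_add carr_ess_bounded_scale
        simp: algebra_simps coboundaries_cochains[THEN cochains_carr])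
  have "scale (H k) r (cohomology_class k f) =
     {add (L_infinity (M k)) (scale (L_infinity (M k)) r (ess_class (M k) (\<lambda>x. f x + c x))) (ess_class (M k) c')
       | c c'. c \<in> coboundaries k \<and> c' \<in> coboundaries k}"
    unfolding H_eq quotient_sn_def cohomology_class_def by auto
  also have "\<dots> = {ess_class (M k) (\<lambda>x. r * f x + (r * c x + c' x))
       | c c'. c \<in> coboundaries k \<and> c' \<in> coboundaries k}"
    by (intro Collect_cong ex_cong1) (use * in auto)
  also have "\<dots> = cohomology_class k (\<lambda>x. r * f x)"
    unfolding cohomology_class_def
  proof (intro equalityI subsetI)
    fix A assume "A \<in> (\<lambda>c. ess_class (M k) (\<lambda>x. r * f x + c x)) ` coboundaries k"
    then obtain c where c: "c \<in> coboundaries k" "A = ess_class (M k) (\<lambda>x. r * f x + (r * 0 + c x))"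
      by auto
    then show "A \<in> {ess_class (M k) (\<lambda>x. r * f x + (r * c x + c' x)) | c c'.
        c \<in> coboundaries k \<and> c' \<in> coboundaries k}"
      by (intro CollectI exI[of _ "\<lambda>x. 0"] exI[of _ c] conjI coboundaries_zero)
  next
    fix A assume "A \<in> {ess_class (M k) (\<lambda>x. r * f x + (r * c x + c' x)) | c c'.
        c \<in> coboundaries k \<and> c' \<in> coboundaries k}"
    then obtain c c' where c: "c \<in> coboundaries k" "c' \<in> coboundaries k"
      and A: "A = ess_class (M k) (\<lambda>x. r * f x + (r * c x + c' x))" by blast
    show "A \<in> (\<lambda>c. ess_class (M k) (\<lambda>x. r * f x + c x)) ` coboundaries k"
      by (rule image_eqI[where f = "\<lambda>c. ess_class (M k) (\<lambda>x. r * f x + c x)",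
            OF A coboundaries_add[OF coboundaries_scale[OF c(1)] c(2)]])
  qed
  finally show ?thesis .
qed

text \<open>All functions of one essential class have the same norm, so the infimum over the classes
  of a coset becomes an infimum over coboundary functions.\<close>

lemma snorm_H:
  assumes f: "f \<in> carr (ess_bounded (M k))"
  shows "snorm (H k) (cohomology_class k f)
    = (INF c\<in>coboundaries k. snorm (ess_bounded (M k)) (\<lambda>x. f x + c x))"
proof -
  have "snorm (L_infinity (M k)) ` cohomology_class k f
    = (\<lambda>c. snorm (ess_bounded (M k)) (\<lambda>x. f x + c x)) ` coboundaries k"
    unfolding cohomology_class_def image_image using f
    by (intro image_cong refl snorm_L_infinity_ess_class carr_ess_bounded_add)
      (auto intro: cochains_carr coboundaries_cochains)
  then show ?thesis unfolding H_eq quotient_sn_def by simp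
qed

lemma closed_ops_H: "closed_ops (H k)"
  by (auto simp: closed_ops_def carr_H add_H scale_H cocycles_carr cocycles_add cocycles_scale
      intro!: imageI)

end

text \<open>All identities are required only almost everywhere and only on cochains, because
  averaging goes through a chosen representative. \<open>A_bound\<close> serves twice: for general
  \<open>C\<close> it says that norms do not increase, for \<open>C = 0\<close> that null functions
  go to null functions.\<close>

locale fn_chain_map = C1: fn_complex M1 I1 D1 + C2: fn_complex M2 I2 D2
  for M1 :: "nat \<Rightarrow> 'x measure" and I1 D1 and M2 :: "nat \<Rightarrow> 'y measure" and I2 D2 +
  fixes A :: "nat \<Rightarrow> ('x \<Rightarrow> real) \<Rightarrow> 'y \<Rightarrow> real"
  assumes A_cochains: "f \<in> C1.cochains k \<Longrightarrow> A k f \<in> C2.cochains k"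
    and A_add: "\<lbrakk>f \<in> C1.cochains k; g \<in> C1.cochains k\<rbrakk>
      \<Longrightarrow> AE y in M2 k. A k (\<lambda>x. f x + g x) y = A k f y + A k g y"
    and A_scale: "f \<in> C1.cochains k \<Longrightarrow> AE y in M2 k. A k (\<lambda>x. c * f x) y = c * A k f y"
    and A_bound: "\<lbrakk>f \<in> C1.cochains k; 0 \<le> C; AE x in M1 k. \<bar>f x\<bar> \<le> C\<rbrakk> \<Longrightarrow> AE y in M2 k. \<bar>A k f y\<bar> \<le> C"
    and A_D: "f \<in> C1.cochains k \<Longrightarrow> AE y in M2 (Suc k). D2 k (A k f) y = A (Suc k) (D1 k f) y"
begin

lemma A_null:
  assumes "f \<in> C1.cochains k" "AE x in M1 k. f x = 0"
  shows "AE y in M2 k. A k f y = 0"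
  using A_bound[of f k 0] assms by simp

text \<open>The difference of \<open>f\<close> and \<open>g\<close> is a null cochain, and
  \<open>A\<close> is additive and homogeneous almost everywhere.\<close>

lemma A_AE:
  assumes f: "f \<in> C1.cochains k" and g: "g \<in> C1.cochains k" and "AE x in M1 k. f x = g x"
  shows "AE y in M2 k. A k f y = A k g y"
proof -
  have g': "(\<lambda>x. (-1) * g x) \<in> C1.cochains k" using g by (rule C1.cochains_scale)
  have "AE x in M1 k. f x + (-1) * g x = 0" using assms(3) by eventually_elim simp
  from A_null[OF C1.cochains_add[OF f g'] this] A_add[OF f g'] A_scale[OF g, of "-1"]
  show ?thesis by eventually_elim simp
qed

lemma A_cocycles:
  assumes "f \<in> C1.cocycles k" shows "A k f \<in> C2.cocycles k"
proof -
  have "AE y in M2 (Suc k). A (Suc k) (D1 k f) y = 0"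
    using assms by (intro A_null C1.D_cochains) (auto simp: C1.cocycles_def)
  with A_D[of f k] show ?thesis using assms
    by (auto simp: C1.cocycles_def C2.cocycles_def A_cochains elim!: eventually_elim2)
qed

lemma A_coboundary:
  assumes "c \<in> C1.coboundaries k"
  shows "\<exists>c'\<in>C2.coboundaries k. AE y in M2 k. A k c y = c' y"
proof (cases k)
  case 0
  then show ?thesis
    using assms A_null[OF C1.cochains_zero, of 0] by (auto simp: C1.coboundaries_def C2.coboundaries_def)
next
  case (Suc j)
  then obtain g where g: "g \<in> C1.cochains j" "c = D1 j g"
    using assms by (auto simp: C1.coboundaries_def)
  have "AE y in M2 k. A k c y = D2 j (A j g) y"
    unfolding Suc g(2) using A_D[OF g(1)] by (auto elim!: eventually_mono)
  then show ?thesis using A_cochains[OF g(1)] Suc by (auto simp: C2.coboundaries_def)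
qed

lemma A_plus_coboundary:
  assumes f: "f \<in> C1.cochains k" and c: "c \<in> C1.coboundaries k"
  shows "C2.cohomologous k (A k (\<lambda>x. f x + c x)) (A k f)"
proof -
  obtain c' where c': "c' \<in> C2.coboundaries k" "AE y in M2 k. A k c y = c' y"
    using A_coboundary[OF c] by blast
  have "AE y in M2 k. A k (\<lambda>x. f x + c x) y = A k f y + c' y"
    using A_add[OF f C1.coboundaries_cochains[OF c]] c'(2) by eventually_elim simp
  then show ?thesis by (rule C2.cohomologousI[OF c'(1)])
qed

lemma A_cohomologous:
  assumes f: "f \<in> C1.cochains k" and g: "g \<in> C1.cochains k" and "C1.cohomologous k f g"
  shows "C2.cohomologous k (A k f) (A k g)"
proof -
  obtain c where c: "c \<in> C1.coboundaries k" "AE x in M1 k. f x = g x + c x"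
    using assms(3) by (auto simp: C1.cohomologous_def)
  have "AE y in M2 k. A k f y = A k (\<lambda>x. g x + c x) y"
    using c f g by (auto intro!: A_AE C1.cochains_add dest: C1.coboundaries_cochains)
  then show ?thesis
    by (rule C2.cohomologous_trans[OF C2.cohomologous_AE A_plus_coboundary[OF g c(1)]])
qed

lemma snorm_A_le:
  assumes "f \<in> C1.cochains k"
  shows "snorm (ess_bounded (M2 k)) (A k f) \<le> snorm (ess_bounded (M1 k)) f"
  using assms A_cochains[OF assms] snorm_ess_bounded_nonneg[of "M1 k" f]
    A_bound[OF assms snorm_ess_bounded_nonneg] snorm_ess_bounded_le_iff[of f "M1 k"]
  by (subst snorm_ess_bounded_le_iff) (auto intro: C1.cochains_carr C2.cochains_carr)

text \<open>For every competitor \<open>f + c\<close> in the class of \<open>f\<close>, its image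
  agrees almost everywhere with some \<open>g + c'\<close> and has no larger norm; compare the two
  infima.\<close>

lemma snorm_H_le:
  assumes f: "f \<in> C1.cochains k" and g: "g \<in> C2.cochains k" and "C2.cohomologous k (A k f) g"
  shows "snorm (C2.H k) (C2.cohomology_class k g) \<le> snorm (C1.H k) (C1.cohomology_class k f)"
proof -
  have "\<exists>c'\<in>C2.coboundaries k. snorm (ess_bounded (M2 k)) (\<lambda>x. g x + c' x)
      \<le> snorm (ess_bounded (M1 k)) (\<lambda>x. f x + c x)" if c: "c \<in> C1.coboundaries k" for c
  proof -
    have fc: "(\<lambda>x. f x + c x) \<in> C1.cochains k"
      by (intro C1.cochains_add f C1.coboundaries_cochains c)
    obtain c' where c': "c' \<in> C2.coboundaries k" "AE y in M2 k. A k (\<lambda>x. f x + c x) y = g y + c' y"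
      using C2.cohomologous_trans[OF A_plus_coboundary[OF f c] assms(3)]
      by (auto simp: C2.cohomologous_def)
    have "snorm (ess_bounded (M2 k)) (\<lambda>x. g x + c' x) = snorm (ess_bounded (M2 k)) (A k (\<lambda>x. f x + c x))"
      using c' g A_cochains[OF fc]
      by (intro snorm_ess_bounded_cong carr_ess_bounded_add C2.cochains_carr)
        (auto elim!: eventually_mono dest: C2.coboundaries_cochains)
    with snorm_A_le[OF fc] c'(1) show ?thesis by (intro bexI[of _ c']) simp_all
  qed
  then show ?thesis
    using f g C1.coboundaries_zero
    by (subst C1.snorm_H, simp add: C1.cochains_carr, subst C2.snorm_H, simp add: C2.cochains_carr)
      (intro cINF_mono, auto intro!: bdd_belowI2[of _ 0] simp: snorm_ess_bounded_nonneg)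
qed

end

text \<open>Two norm non-increasing chain maps that are mutually inverse on cohomology induce an
  isometry, since each of them gives one of the two inequalities between the quotient
  seminorms.\<close>

theorem isometric_cohomology:
  assumes AA: "fn_chain_map M1 I1 D1 M2 I2 D2 A" and BB: "fn_chain_map M2 I2 D2 M1 I1 D1 B"
    and BA: "\<And>f. f \<in> fn_complex.cocycles M1 I1 D1 k \<Longrightarrow> fn_complex.cohomologous M1 I1 D1 k (B k (A k f)) f"
    and AB: "\<And>f. f \<in> fn_complex.cocycles M2 I2 D2 k \<Longrightarrow> fn_complex.cohomologous M2 I2 D2 k (A k (B k f)) f"
  shows "isometric
    (cohomology (\<lambda>k. L_infinity_classes (M1 k) (I1 k)) (\<lambda>k. map_classes (M1 (Suc k)) (D1 k)) k)
    (cohomology (\<lambda>k. L_infinity_classes (M2 k) (I2 k)) (\<lambda>k. map_classes (M2 (Suc k)) (D2 k)) k)"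
proof -
  interpret A: fn_chain_map M1 I1 D1 M2 I2 D2 A by fact
  interpret B: fn_chain_map M2 I2 D2 M1 I1 D1 B by fact
  let ?cls1 = "A.C1.cohomology_class k" and ?cls2 = "A.C2.cohomology_class k"
  \<comment> \<open>The map on cohomology is defined through a chosen cocycle; \<open>phi\<close>
    shows that the choice is immaterial.\<close>
  define rep where "rep \<xi> = (SOME f. f \<in> A.C1.cocycles k \<and> ?cls1 f = \<xi>)" for \<xi>
  define \<phi> where "\<phi> \<xi> = ?cls2 (A k (rep \<xi>))" for \<xi>
  have phi: "\<phi> (?cls1 f) = ?cls2 (A k f)" if f: "f \<in> A.C1.cocycles k" for f
  proof -
    have "rep (?cls1 f) \<in> A.C1.cocycles k \<and> ?cls1 (rep (?cls1 f)) = ?cls1 f"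
      unfolding rep_def by (rule someI[of _ f]) (use f in auto)
    then have r: "rep (?cls1 f) \<in> A.C1.cocycles k" "A.C1.cohomologous k (rep (?cls1 f)) f"
      by (auto simp: A.C1.cohomology_class_eq_iff A.C1.cocycles_carr)
    show ?thesis unfolding \<phi>_def
      using r f by (subst A.C2.cohomology_class_eq_iff)
        (auto intro!: A.A_cohomologous A.C1.cocycles_cochains A.A_cochains A.C2.cochains_carr)
  qed
  have carr2: "A k f \<in> carr (ess_bounded (M2 k))" if "f \<in> A.C1.cocycles k" for f
    using that by (intro A.C2.cocycles_carr A.A_cocycles)
  have bij: "bij_betw \<phi> (carr (A.C1.H k)) (carr (A.C2.H k))"
    unfolding A.C1.carr_H A.C2.carr_H
  proof (intro bij_betw_imageI)
    show "inj_on \<phi> (?cls1 ` A.C1.cocycles k)"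
    proof (rule inj_onI, elim imageE)
      fix \<xi> \<eta> f g assume *: "\<phi> \<xi> = \<phi> \<eta>" and fg: "\<xi> = ?cls1 f" "\<eta> = ?cls1 g"
        and f: "f \<in> A.C1.cocycles k" and g: "g \<in> A.C1.cocycles k"
      have "A.C2.cohomologous k (A k f) (A k g)"
        using * f g by (simp add: fg phi A.C2.cohomology_class_eq_iff carr2)
      then have "A.C1.cohomologous k (B k (A k f)) (B k (A k g))"
        using f g by (intro B.A_cohomologous A.A_cochains A.C1.cocycles_cochains)
      then have "A.C1.cohomologous k f g"
        using BA[OF f] BA[OF g] A.C1.cohomologous_trans A.C1.cohomologous_sym by blast
      then show "\<xi> = \<eta>" using f g by (simp add: fg A.C1.cohomology_class_eq_iff A.C1.cocycles_carr)
    qed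
    show "\<phi> ` ?cls1 ` A.C1.cocycles k = ?cls2 ` A.C2.cocycles k"
    proof (intro equalityI subsetI)
      fix \<eta> assume "\<eta> \<in> \<phi> ` ?cls1 ` A.C1.cocycles k"
      then show "\<eta> \<in> ?cls2 ` A.C2.cocycles k" by (auto simp: phi A.A_cocycles)
    next
      fix \<eta> assume "\<eta> \<in> ?cls2 ` A.C2.cocycles k"
      then obtain g where g: "g \<in> A.C2.cocycles k" "\<eta> = ?cls2 g" by blast
      have Bg: "B k g \<in> A.C1.cocycles k" by (rule B.A_cocycles[OF g(1)])
      have "\<phi> (?cls1 (B k g)) = \<eta>"
        using AB[OF g(1)] Bg by (simp add: phi g(2) A.C2.cohomology_class_eq_iff carr2)
      with Bg show "\<eta> \<in> \<phi> ` ?cls1 ` A.C1.cocycles k" by blast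
    qed
  qed
  show ?thesis
    unfolding isometric_def
  proof (intro exI[of _ \<phi>] conjI ballI allI bij)
    fix \<xi> assume "\<xi> \<in> carr (A.C1.H k)"
    then obtain f where f: "f \<in> A.C1.cocycles k" "\<xi> = ?cls1 f" by (auto simp: A.C1.carr_H)
    note f' = A.C1.cocycles_cochains[OF f(1)]
    have "snorm (A.C2.H k) (?cls2 (A k f)) = snorm (A.C1.H k) (?cls1 f)"
    \<comment> \<open>The second inequality applies \<open>B\<close> to \<open>A k f\<close>, which
      leads back to a cocycle cohomologous to \<open>f\<close>.\<close>
    proof (intro antisym)
      show "snorm (A.C2.H k) (?cls2 (A k f)) \<le> snorm (A.C1.H k) (?cls1 f)"
        using f' by (intro A.snorm_H_le A.A_cochains A.C2.cohomologous_AE) auto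
      show "snorm (A.C1.H k) (?cls1 f) \<le> snorm (A.C2.H k) (?cls2 (A k f))"
        using f' BA[OF f(1)] by (intro B.snorm_H_le A.A_cochains) auto
    qed
    then show "snorm (A.C2.H k) (\<phi> \<xi>) = snorm (A.C1.H k) \<xi>"
      by (simp add: f(2) phi[OF f(1)])
    fix c
    have "?cls2 (A k (\<lambda>x. c * f x)) = ?cls2 (\<lambda>y. c * A k f y)"
      using f f' by (subst A.C2.cohomology_class_eq_iff)
        (auto intro!: A.C2.cohomologous_AE A.A_scale carr2 A.C1.cocycles_scale)
    then show "\<phi> (scale (A.C1.H k) c \<xi>) = scale (A.C2.H k) c (\<phi> \<xi>)"
      using f by (simp add: phi A.C1.scale_H A.C2.scale_H A.C1.cocycles_carr carr2 A.C1.cocycles_scale)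
  next
    fix \<xi> \<eta> assume "\<xi> \<in> carr (A.C1.H k)" "\<eta> \<in> carr (A.C1.H k)"
    then obtain f g where f: "f \<in> A.C1.cocycles k" "\<xi> = ?cls1 f"
      and g: "g \<in> A.C1.cocycles k" "\<eta> = ?cls1 g" by (auto simp: A.C1.carr_H)
    have "?cls2 (A k (\<lambda>x. f x + g x)) = ?cls2 (\<lambda>y. A k f y + A k g y)"
      using f g by (subst A.C2.cohomology_class_eq_iff)
        (auto intro!: A.C2.cohomologous_AE A.A_add carr2 A.C1.cocycles_add A.C1.cocycles_cochains)
    then show "\<phi> (add (A.C1.H k) \<xi> \<eta>) = add (A.C2.H k) (\<phi> \<xi>) (\<phi> \<eta>)"
      using f g by (simp add: phi A.C1.add_H A.C2.add_H A.C1.cocycles_carr carr2 A.C1.cocycles_add)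
  qed
qed

section \<open>The hull of a pattern of finite local complexity\<close>

lemma borel_measurable_group_uminus [measurable (raw)]:
  fixes f :: "'a \<Rightarrow> 'b::{second_countable_topology, topological_group_add}"
  assumes "f \<in> borel_measurable M"
  shows "(\<lambda>x. - f x) \<in> borel_measurable M"
  by (rule borel_measurable_continuous_on[OF _ assms]) (intro continuous_intros)

lemma borel_measurable_group_diff [measurable (raw)]:
  fixes f g :: "'a \<Rightarrow> 'b::{second_countable_topology, topological_group_add}"
  assumes "f \<in> borel_measurable M" "g \<in> borel_measurable M"
  shows "(\<lambda>x. f x - g x) \<in> borel_measurable M"
  using borel_measurable_add[OF assms(1) borel_measurable_group_uminus[OF assms(2)]] by simp

text \<open>Preimage of the diagonal, which is closed in a Hausdorff space; second countability
  makes the pair Borel measurable into the product.\<close>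

lemma sets_Collect_eq_borel:
  fixes f g :: "'a \<Rightarrow> 'b::{second_countable_topology, t2_space}"
  assumes [measurable]: "f \<in> borel_measurable M" "g \<in> borel_measurable M"
  shows "{x \<in> space M. f x = g x} \<in> sets M"
proof -
  have "(\<lambda>x. (f x, g x)) \<in> borel_measurable M" by measurable
  then have "(\<lambda>x. (f x, g x)) -` {y. \<exists>x. y = (x, x)} \<inter> space M \<in> sets M"
    by (rule measurable_sets) (intro borel_closed closed_diagonal)
  moreover have "(\<lambda>x. (f x, g x)) -` {y. \<exists>x. y = (x, x)} \<inter> space M = {x \<in> space M. f x = g x}"
    by auto
  ultimately show ?thesis by simp
qed

section \<open>The action on closed sets and the Fell topology\<close>

lemma mem_act: "p \<in> act g Q \<longleftrightarrow> p + g \<in> Q"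
  by (force simp: act_def intro: image_eqI[of _ _ "p + g"])

lemma act_act: "act g (act h Q) = act (g + h) Q"
  by (simp add: set_eq_iff mem_act add.assoc)

lemma act_zero [simp]: "act 0 Q = Q"
  by (simp add: set_eq_iff mem_act)

lemma act_vimage: "act g Q = (\<lambda>p. p + g) -` Q"
  by (auto simp: mem_act)

lemma closed_act:
  fixes Q :: "'g::topological_group_add set"
  assumes "closed Q" shows "closed (act g Q)"
  unfolding act_vimage by (intro continuous_closed_vimage assms continuous_intros)

lemma topspace_fell: "topspace (fell_topology :: 'g::topological_space set topology) = {F. closed F}"
proof -
  have "{F. closed F} \<in> {{F. closed F \<and> F \<inter> K = {}} | K :: 'g set. compact K}"
    by (intro CollectI exI[of _ "{}"]) simp
  then have "{F. closed F} \<subseteq> topspace (fell_topology :: 'g set topology)"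
    unfolding fell_topology_def topology_generated_by_topspace by (intro Union_upper UnI1)
  moreover have "topspace (fell_topology :: 'g set topology) \<subseteq> {F. closed F}"
    unfolding fell_topology_def topology_generated_by_topspace by (intro Union_least) blast
  ultimately show ?thesis by (rule antisym[rotated])
qed

lemma openin_fell_hit: "open U \<Longrightarrow> openin fell_topology {F. closed F \<and> F \<inter> U \<noteq> {}}"
  unfolding fell_topology_def by (rule topology_generated_by_Basis) blast

lemma openin_fell_miss: "compact K \<Longrightarrow> openin fell_topology {F. closed F \<and> F \<inter> K = {}}"
  unfolding fell_topology_def by (rule topology_generated_by_Basis) blast

lemma continuous_map_act:
  fixes g :: "'g::topological_group_add"
  shows "continuous_map fell_topology fell_topology (act g)"
proof -
  have 1: "openin fell_topology (act g -` {F. closed F \<and> F \<inter> K = {}} \<inter> topspace fell_topology)"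
    if "compact K" for K
  proof -
    have "act g -` {F. closed F \<and> F \<inter> K = {}} \<inter> topspace fell_topology
      = {F. closed F \<and> F \<inter> (\<lambda>p. p + g) ` K = {}}"
      by (auto simp: topspace_fell closed_act mem_act)
    moreover have "compact ((\<lambda>p. p + g) ` K)"
      by (intro compact_continuous_image that continuous_intros)
    ultimately show ?thesis by (simp add: openin_fell_miss)
  qed
  have 2: "openin fell_topology (act g -` {F. closed F \<and> F \<inter> U \<noteq> {}} \<inter> topspace fell_topology)"
    if "open U" for U
  proof -
    have "act g -` {F. closed F \<and> F \<inter> U \<noteq> {}} \<inter> topspace fell_topology
      = {F. closed F \<and> F \<inter> (\<lambda>p. p - g) -` U \<noteq> {}}"
      by (auto simp: topspace_fell closed_act disjoint_iff mem_act) (metis add_diff_cancel diff_add_cancel)+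
    moreover have "open ((\<lambda>p. p - g) -` U)"
      using continuous_on_add[OF continuous_on_id continuous_on_const, of UNIV "- g"] that
      by (intro open_vimage) auto
    ultimately show ?thesis by (simp add: openin_fell_hit)
  qed
  have "continuous_map fell_topology (topology_generated_by
    ({{F. closed F \<and> F \<inter> K = {}} | K. compact K} \<union> {{F. closed F \<and> F \<inter> U \<noteq> {}} | U. open U})) (act g)"
    (is "continuous_map _ (topology_generated_by ?S) _")
  proof (rule continuous_on_generated_topo)
    have "act g ` topspace fell_topology \<subseteq> topspace fell_topology"
      by (auto simp: topspace_fell closed_act)
    then show "act g ` topspace fell_topology \<subseteq> \<Union> ?S"
      unfolding fell_topology_def topology_generated_by_topspace .
  qed (use 1 2 in blast)
  then show ?thesis by (simp only: fell_topology_def)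
qed

text \<open>The continuous map \<open>act g\<close> preserves the orbit of \<open>P\<close>, hence
  its closure, and it keeps non-empty sets non-empty.\<close>

lemma act_pattern_hull:
  fixes P :: "'g::topological_group_add set"
  assumes "Q \<in> pattern_hull P"
  shows "act g Q \<in> pattern_hull P"
proof -
  have "act g Q \<in> fell_topology closure_of act g ` range (\<lambda>h. act h P)"
    using continuous_map_image_closure_subset[OF continuous_map_act[of g], of "range (\<lambda>h. act h P)"] assms
    by (auto simp: pattern_hull_def)
  moreover have "act g ` range (\<lambda>h. act h P) \<subseteq> range (\<lambda>h. act h P)"
    by (auto simp: act_act)
  ultimately have "act g Q \<in> fell_topology closure_of range (\<lambda>h. act h P)"
    by (meson closure_of_mono subsetD)
  moreover have "Q \<noteq> {}" using assms by (simp add: pattern_hull_def)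
  ultimately show ?thesis by (simp add: pattern_hull_def act_def)
qed

lemma transversal_act_iff:
  fixes P :: "'g::topological_group_add set"
  assumes "Q \<in> pattern_hull P"
  shows "act g Q \<in> transversal P \<longleftrightarrow> g \<in> Q"
  using assms by (simp add: transversal_def act_pattern_hull mem_act)

lemma return_times_eq:
  fixes P :: "'g::topological_group_add set"
  shows "Q \<in> pattern_hull P \<Longrightarrow> return_times P Q = Q"
  by (auto simp: return_times_def transversal_act_iff)

lemma closed_pattern_hull: "Q \<in> pattern_hull P \<Longrightarrow> closed Q"
  using closure_of_subset_topspace[of fell_topology] by (auto simp: pattern_hull_def topspace_fell)

lemma pattern_hull_nonempty: "Q \<in> pattern_hull P \<Longrightarrow> Q \<noteq> {}"
  by (simp add: pattern_hull_def)

lemma space_hull_borel [simp]: "space (hull_borel P) = pattern_hull P"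
  unfolding hull_borel_def by (rule space_measure_of) (auto simp: openin_subtopology)

lemma sets_hull_borel: "sets (hull_borel P)
    = sigma_sets (pattern_hull P) {U. openin (subtopology fell_topology (pattern_hull P)) U}"
  unfolding hull_borel_def by (rule sets_measure_of) (auto simp: openin_subtopology)

lemma sets_hull_hit:
  assumes "open U" shows "{Q \<in> pattern_hull P. Q \<inter> U \<noteq> {}} \<in> sets (hull_borel P)"
proof -
  have "{Q \<in> pattern_hull P. Q \<inter> U \<noteq> {}} = {F. closed F \<and> F \<inter> U \<noteq> {}} \<inter> pattern_hull P"
    using closed_pattern_hull by auto
  then have "openin (subtopology fell_topology (pattern_hull P)) {Q \<in> pattern_hull P. Q \<inter> U \<noteq> {}}"
    unfolding openin_subtopology using openin_fell_hit[OF assms] by blast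
  then show ?thesis unfolding sets_hull_borel by (intro sigma_sets.Basic) simp
qed

text \<open>A countable substitute for the subbasis. Missing a basic open set is in general not an
  open condition on \<open>F'\<close>, but it is the complement of one, which is enough for Borel
  measurability.\<close>

lemma fell_open_basic:
  fixes \<B> :: "'g::topological_space set set" and T :: "'g set set"
  assumes \<B>: "topological_basis \<B>" and T: "openin fell_topology T" "F \<in> T"
  shows "\<exists>S S'. finite S \<and> S \<subseteq> \<B> \<and> finite S' \<and> S' \<subseteq> \<B> \<and>
    (\<forall>B\<in>S. F \<inter> B = {}) \<and> (\<forall>B\<in>S'. F \<inter> B \<noteq> {}) \<and>
    (\<forall>F'. closed F' \<longrightarrow> (\<forall>B\<in>S. F' \<inter> B = {}) \<longrightarrow> (\<forall>B\<in>S'. F' \<inter> B \<noteq> {}) \<longrightarrow> F' \<in> T)"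
    (is "\<exists>S S'. ?P F T S S'")
  using T(1)[unfolded fell_topology_def openin_topology_generated_by_iff] T(2)
proof (induction arbitrary: F)
  case Empty
  then show ?case by simp
next
  case (Int a b)
  obtain S1 S1' where 1: "?P F a S1 S1'"
    using Int.IH(1)[OF IntD1[OF Int.prems]] by (elim exE) (rule that)
  obtain S2 S2' where 2: "?P F b S2 S2'"
    using Int.IH(2)[OF IntD2[OF Int.prems]] by (elim exE) (rule that)
  have "?P F (a \<inter> b) (S1 \<union> S2) (S1' \<union> S2')" using 1 2 by (simp add: ball_Un)
  then show ?case by (intro exI)
next
  case (UN K)
  then obtain a where a: "a \<in> K" "F \<in> a" by blast
  obtain S S' where S: "?P F a S S'" using UN.IH[OF a] by (elim exE) (rule that)
  have "?P F (\<Union>K) S S'"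
    using S Union_upper[OF a(1)]
    by (elim conjE, intro conjI allI impI) (assumption | (erule subsetD, iprover))+
  then show ?case by (intro exI)
next
  case (Basis s)
  from Basis(1) show ?case
  proof (elim UnE CollectE exE conjE)
    fix K assume 1: "s = {F. closed F \<and> F \<inter> K = {}}" "compact K"
    then have F: "closed F" "F \<inter> K = {}" using Basis by auto
    \<comment> \<open>Finitely many basic sets inside the open complement of \<open>F\<close> cover
      the compact \<open>K\<close>; whatever misses all of them misses \<open>K\<close>.\<close>
    have "\<exists>B\<in>\<B>. x \<in> B \<and> B \<subseteq> - F" if "x \<in> K" for x
      using topological_basisE[OF \<B>, of "- F" x] F that by (metis ComplI IntI empty_iff open_Compl)
    then obtain b where b: "\<And>x. x \<in> K \<Longrightarrow> b x \<in> \<B> \<and> x \<in> b x \<and> b x \<subseteq> - F" by metis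
    have "\<exists>D\<subseteq>b ` K. finite D \<and> K \<subseteq> \<Union>D"
      by (rule compactE[OF 1(2), of "b ` K"])
        (use b topological_basis_open[OF \<B>] in \<open>auto\<close>)
    then obtain D where D: "D \<subseteq> b ` K" "finite D" "K \<subseteq> \<Union>D" by blast
    have "B \<in> \<B> \<and> F \<inter> B = {}" if "B \<in> D" for B using D(1) b that by blast
    moreover have "F' \<in> s" if "closed F'" "\<forall>B\<in>D. F' \<inter> B = {}" for F'
      using that D(3) unfolding 1(1) by blast
    ultimately have "?P F s D {}" using D(2) by auto
    then show ?case by (intro exI)
  next
    fix U assume 2: "s = {F. closed F \<and> F \<inter> U \<noteq> {}}" "open U"
    then have F: "F \<inter> U \<noteq> {}" using Basis by auto
    then obtain x where x: "x \<in> F" "x \<in> U" by blast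
    obtain B where "B \<in> \<B>" "x \<in> B" "B \<subseteq> U" using topological_basisE[OF \<B> 2(2) x(2)] by blast
    then have "?P F s {} {B}" using x 2 by auto
    then show ?case by (intro exI)
  qed
qed

text \<open>By \<open>fell_open_basic\<close> every Fell open set is a union of sets prescribing
  finitely many hits and misses of basic sets, and there are only countably many such
  prescriptions.\<close>

lemma measurable_hull_borelI:
  fixes f :: "'a \<Rightarrow> 'g::{topological_group_add, second_countable_topology} set"
  assumes space: "\<And>\<omega>. \<omega> \<in> space M \<Longrightarrow> f \<omega> \<in> pattern_hull P"
    and hit: "\<And>U. open U \<Longrightarrow> {\<omega> \<in> space M. f \<omega> \<inter> U \<noteq> {}} \<in> sets M"
  shows "f \<in> M \<rightarrow>\<^sub>M hull_borel P"
  unfolding hull_borel_def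
proof (rule measurable_measure_of)
  show "{U. openin (subtopology fell_topology (pattern_hull P)) U} \<subseteq> Pow (pattern_hull P)"
    by (auto simp: openin_subtopology)
  show "f \<in> space M \<rightarrow> pattern_hull P" using space by auto
  fix O' assume "O' \<in> {U. openin (subtopology fell_topology (pattern_hull P)) U}"
  then obtain T where T: "openin fell_topology T" "O' = T \<inter> pattern_hull P"
    by (auto simp: openin_subtopology)
  obtain \<B> :: "'g set set" where \<B>: "countable \<B>" "topological_basis \<B>"
    using ex_countable_basis by blast
  define c where "c = (\<lambda>(S, S'). {F. closed F \<and> (\<forall>B\<in>S. F \<inter> B = {}) \<and> (\<forall>B\<in>S'. F \<inter> (B :: 'g set) \<noteq> {})})"
  define J where "J = {p \<in> {A. finite A \<and> A \<subseteq> \<B>} \<times> {A. finite A \<and> A \<subseteq> \<B>}. c p \<subseteq> T}"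
  have "countable J"
    unfolding J_def using \<B>(1) by (intro countable_subset[OF Collect_subset] countable_SIGMA countable_Collect_finite_subset)
  have T_eq: "T = (\<Union>p\<in>J. c p)"
  proof (intro equalityI subsetI)
    fix F assume F: "F \<in> T"
    then have "closed F" using openin_subset[OF T(1)] by (auto simp: topspace_fell)
    obtain S S' where S: "finite S \<and> S \<subseteq> \<B> \<and> finite S' \<and> S' \<subseteq> \<B> \<and>
      (\<forall>B\<in>S. F \<inter> B = {}) \<and> (\<forall>B\<in>S'. F \<inter> B \<noteq> {}) \<and>
      (\<forall>F'. closed F' \<longrightarrow> (\<forall>B\<in>S. F' \<inter> B = {}) \<longrightarrow> (\<forall>B\<in>S'. F' \<inter> B \<noteq> {}) \<longrightarrow> F' \<in> T)"
      using fell_open_basic[OF \<B>(2) T(1) F] by (elim exE) (rule that)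
    with \<open>closed F\<close> have "F \<in> c (S, S')" "c (S, S') \<subseteq> T"
      unfolding c_def by auto
    with S have "(S, S') \<in> J" "F \<in> c (S, S')" by (auto simp: J_def)
    then show "F \<in> (\<Union>p\<in>J. c p)" by blast
  qed (auto simp: J_def)
  have "f -` O' \<inter> space M = (\<Union>p\<in>J. {\<omega> \<in> space M. f \<omega> \<in> c p})"
    using space by (auto simp: T(2) T_eq)
  also have "\<dots> \<in> sets M"
  proof (rule sets.countable_UN''[OF \<open>countable J\<close>])
    fix p assume "p \<in> J"
    then obtain S S' where p: "p = (S, S')" "finite S" "finite S'" "S \<subseteq> \<B>" "S' \<subseteq> \<B>" by (auto simp: J_def)
    have hit': "{\<omega> \<in> space M. f \<omega> \<inter> B \<noteq> {}} \<in> sets M" if "B \<in> \<B>" for B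
      using topological_basis_open[OF \<B>(2) that] by (rule hit)
    have miss': "{\<omega> \<in> space M. f \<omega> \<inter> B = {}} \<in> sets M" if "B \<in> \<B>" for B
      using sets.sets_Collect_neg[OF hit'[OF that]] by simp
    have "{\<omega> \<in> space M. (\<forall>B\<in>S. f \<omega> \<inter> B = {}) \<and> (\<forall>B\<in>S'. f \<omega> \<inter> B \<noteq> {})} \<in> sets M"
      using p hit' miss' by (intro sets.sets_Collect_conj sets.sets_Collect_finite_All) auto
    moreover have "{\<omega> \<in> space M. f \<omega> \<in> c p}
      = {\<omega> \<in> space M. (\<forall>B\<in>S. f \<omega> \<inter> B = {}) \<and> (\<forall>B\<in>S'. f \<omega> \<inter> B \<noteq> {})}"
      using space closed_pattern_hull unfolding c_def p(1) by auto
    ultimately show "{\<omega> \<in> space M. f \<omega> \<in> c p} \<in> sets M" by simp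
  qed
  finally show "f -` O' \<inter> space M \<in> sets M" .
qed

text \<open>
  Finite local complexity makes \<open>P - P\<close> locally finite; the resulting uniform discreteness of
  \<open>P\<close> passes to the whole hull.
\<close>

lemma FLC_uniformly_discrete:
  fixes P :: "'g::{topological_group_add, t2_space} set"
  assumes lc: "locally_compact_space (euclidean :: 'g topology)"
    and lf: "locally_finite_set P" and flc: "FLC P"
  shows "\<exists>U. open U \<and> 0 \<in> U \<and> (\<forall>p\<in>P. \<forall>q\<in>P. p - q \<in> U \<longrightarrow> p = q)"
proof -
  obtain U K :: "'g set" where UK: "open U" "compact K" "0 \<in> U" "U \<subseteq> K"
  proof -
    have "\<exists>U. open U \<and> (\<exists>K. compact K \<and> (0::'g) \<in> U \<and> U \<subseteq> K)"
      using lc by (simp add: locally_compact_space_def)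
    then show thesis by (elim exE conjE) (rule that)
  qed
  have cK: "compact (closure K)" using UK(2) by (simp add: compact_imp_closed)
  \<comment> \<open>For \<open>q \<in> P\<close> the set \<open>act q P\<close> consists of the
    differences \<open>p - q\<close>. By FLC only finitely many traces on \<open>K\<close> occur,
    and each is finite because \<open>P\<close> is locally finite.\<close>
  define D where "D = \<Union> {K \<inter> act g P | g. g \<in> P}"
  have "finite (K \<inter> act g P)" for g
  proof -
    have "compact (closure ((\<lambda>p. p + g) ` K))"
      using compact_continuous_image[OF _ UK(2), of "\<lambda>p. p + g"]
      by (simp add: compact_imp_closed continuous_on_add)
    then have "finite ((\<lambda>p. p - g) ` ((\<lambda>p. p + g) ` K \<inter> P))"
      using lf unfolding locally_finite_set_def by (intro finite_imageI) simp
    moreover have "K \<inter> act g P \<subseteq> (\<lambda>p. p - g) ` ((\<lambda>p. p + g) ` K \<inter> P)"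
      by (force simp: act_def)
    ultimately show ?thesis by (rule finite_subset[rotated])
  qed
  then have "finite D"
    using flc[unfolded FLC_def, rule_format, OF cK] unfolding D_def by (intro finite_Union) auto
  have D: "p - q \<in> D" if "p \<in> P" "q \<in> P" "p - q \<in> K" for p q
  proof -
    have "p - q \<in> K \<inter> act q P" using that by (simp add: mem_act)
    then show ?thesis unfolding D_def using that(2) by blast
  qed
  show ?thesis
  \<comment> \<open>Finite sets are closed, so discarding the finitely many non-zero differences
    leaves an open neighbourhood of 0.\<close>
  proof (intro exI[of _ "U - (D - {0})"] conjI ballI impI)
    show "open (U - (D - {0}))" using UK(1) \<open>finite D\<close> by (intro open_Diff finite_imp_closed) auto
    fix p q assume pq: "p \<in> P" "q \<in> P" "p - q \<in> U - (D - {0})"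
    then have "p - q = 0" using D[of p q] UK(4) by blast
    then show "p = q" by simp
  qed (use UK in auto)
qed

lemma open_diff_vimage:
  fixes U :: "'g::topological_group_add set"
  assumes "open U" shows "open {(x, y). x - y \<in> U}"
proof -
  have "continuous_on UNIV (\<lambda>p::'g \<times> 'g. fst p + - snd p)"
    by (intro continuous_intros)
  then have "open ((\<lambda>p::'g \<times> 'g. fst p - snd p) -` U)"
    using assms by (intro open_vimage) auto
  then show ?thesis by (simp add: vimage_def case_prod_unfold)
qed

text \<open>Two close points of a limit pattern can be approximated by two points of one translate
  of \<open>P\<close>, and right translation does not change \<open>p - q\<close>. Disjoint
  neighbourhoods then contradict the separation of \<open>P\<close>.\<close>

lemma pattern_hull_uniformly_discrete:
  fixes P :: "'g::{topological_group_add, t2_space} set"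
  assumes U: "open U" "\<And>p q. \<lbrakk>p \<in> P; q \<in> P; p - q \<in> U\<rbrakk> \<Longrightarrow> p = q"
    and Q: "Q \<in> pattern_hull P" "g \<in> Q" "h \<in> Q" "g - h \<in> U"
  shows "g = h"
proof (rule ccontr)
  assume "g \<noteq> h"
  then obtain A B where AB: "open A" "open B" "g \<in> A" "h \<in> B" "A \<inter> B = {}" using hausdorff by metis
  obtain A' B' where AB': "open A'" "open B'" "(g, h) \<in> A' \<times> B'" "A' \<times> B' \<subseteq> {(x, y). x - y \<in> U}"
    by (rule open_prod_elim[OF open_diff_vimage[OF U(1)], of "(g, h)"]) (use Q(4) in auto)
  let ?T = "{F. closed F \<and> F \<inter> (A \<inter> A') \<noteq> {}} \<inter> {F. closed F \<and> F \<inter> (B \<inter> B') \<noteq> {}}"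
  have "openin fell_topology ?T" using AB AB' by (intro openin_Int openin_fell_hit) auto
  moreover have "g \<in> Q \<inter> (A \<inter> A')" "h \<in> Q \<inter> (B \<inter> B')" using Q(2,3) AB(3,4) AB'(3) by simp_all
  then have "Q \<in> ?T" by (intro IntI CollectI conjI closed_pattern_hull[OF Q(1)]) (rule ex_in_conv[THEN iffD1, OF exI], assumption)+
  moreover have "Q \<in> fell_topology closure_of range (\<lambda>g. act g P)"
    using Q(1) by (simp add: pattern_hull_def)
  ultimately have "\<exists>y\<in>range (\<lambda>g. act g P). y \<in> ?T"
    unfolding in_closure_of by (elim conjE allE[of _ ?T] impE) simp_all
  then obtain k where "act k P \<in> ?T" by (elim bexE rangeE) (rule that, simp)
  then have "act k P \<inter> (A \<inter> A') \<noteq> {}" "act k P \<inter> (B \<inter> B') \<noteq> {}" by simp_all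
  then obtain p q where pq: "p \<in> act k P" "p \<in> A \<inter> A'" "q \<in> act k P" "q \<in> B \<inter> B'"
    unfolding ex_in_conv[symmetric] by (elim exE IntE) (rule that, auto)
  have "(p + k) - (q + k) = p - q" by (simp add: diff_add_eq_diff_diff_swap)
  moreover have "p - q \<in> U" using pq AB' by auto
  ultimately have "p + k = q + k" using U(2)[of "p + k" "q + k"] pq by (simp add: mem_act)
  with pq AB show False by auto
qed

text \<open>An enumeration of each pattern without repetitions, Borel in the pattern: it turns sums
  over a varying countable set into series over a fixed index set. The value \<open>e i Q\<close> is
  meaningful only for \<open>Q \<in> E i\<close>.\<close>

locale enumerated_hull =
  fixes P :: "'g::{topological_group_add, t2_space, second_countable_topology} set"
    and e :: "nat \<Rightarrow> 'g set \<Rightarrow> 'g" and E :: "nat \<Rightarrow> 'g set set"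
  assumes E_sets [measurable]: "\<And>i. E i \<in> sets (hull_borel P)"
    and e_measurable [measurable]: "\<And>i. e i \<in> borel_measurable (hull_borel P)"
    and e_bij: "\<And>Q. Q \<in> pattern_hull P \<Longrightarrow> bij_betw (\<lambda>i. e i Q) {i. Q \<in> E i} Q"

text \<open>The group is covered by countably many open sets \<open>V i\<close>, each meeting every
  pattern in at most one point, which becomes \<open>e i Q\<close>. Making the cover disjoint
  decides which index lists a point lying in several \<open>V i\<close>.\<close>

lemma enumerated_hull_exists:
  fixes P :: "'g::{topological_group_add, t2_space, second_countable_topology} set"
  assumes "locally_compact_space (euclidean :: 'g topology)" "locally_finite_set P" "FLC P"
  shows "\<exists>e E. enumerated_hull P e E"
proof -
  obtain U where U: "open U" "0 \<in> U" "\<And>p q. \<lbrakk>p \<in> P; q \<in> P; p - q \<in> U\<rbrakk> \<Longrightarrow> p = q"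
    using FLC_uniformly_discrete[OF assms] by blast
  have "\<exists>N. open N \<and> x \<in> N \<and> (\<forall>g\<in>N. \<forall>h\<in>N. g - h \<in> U)" for x
  proof -
    obtain A B where "open A" "open B" "(x, x) \<in> A \<times> B" "A \<times> B \<subseteq> {(x, y). x - y \<in> U}"
      by (rule open_prod_elim[OF open_diff_vimage[OF U(1)], of "(x, x)"]) (use U(2) in auto)
    then show ?thesis by (intro exI[of _ "A \<inter> B"]) auto
  qed
  then obtain N where N: "\<And>x. open (N x)" "\<And>x. x \<in> N x" "\<And>x g h. \<lbrakk>g \<in> N x; h \<in> N x\<rbrakk> \<Longrightarrow> g - h \<in> U" by metis
  obtain \<N> where \<N>: "\<N> \<subseteq> range N" "countable \<N>" "\<Union>\<N> = \<Union>(range N)"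
    using Lindelof[of "range N"] N(1) by blast
  have UN: "\<Union>\<N> = UNIV" using \<N>(3) N(2) by auto
  then have "\<N> \<noteq> {}" by auto
  define V where "V = from_nat_into \<N>"
  have V: "range V = \<N>" unfolding V_def using \<open>\<N> \<noteq> {}\<close> \<N>(2) by (rule range_from_nat_into)
  have Vx: "\<exists>x. V i = N x" for i using V \<N>(1) by blast
  have V_open: "open (V i)" for i using Vx[of i] N(1) by metis
  have V_inj: "g = h" if "Q \<in> pattern_hull P" "g \<in> Q \<inter> V i" "h \<in> Q \<inter> V i" for Q g h i
  proof -
    obtain x where "V i = N x" using Vx by blast
    then have "g - h \<in> U" using N(3)[of g x h] that by simp
    then show ?thesis using pattern_hull_uniformly_discrete[OF U(1,3) that(1), of g h] that by simp
  qed
  \<comment> \<open>The value 0 is a placeholder for patterns that miss \<open>V i\<close>; these do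
    not belong to \<open>E i\<close>.\<close>
  define e where "e i Q = (if Q \<inter> V i = {} then 0 else SOME g. g \<in> Q \<inter> V i)" for i Q
  have e_mem: "e i Q \<in> Q \<inter> V i" if "Q \<inter> V i \<noteq> {}" for i Q
    using that some_in_eq[of "Q \<inter> V i"] by (simp add: e_def)
  have e_eq: "e i Q = g" if "Q \<in> pattern_hull P" "g \<in> Q \<inter> V i" for i Q g
    using V_inj[OF that(1) e_mem that(2)] that(2) by (metis empty_iff)
  have hit: "{Q \<in> pattern_hull P. Q \<inter> A \<noteq> {}} \<in> sets (hull_borel P)" if "open A" for A
    using that by (rule sets_hull_hit)
  have e_borel: "e i \<in> borel_measurable (hull_borel P)" for i
  proof (rule borel_measurableI)
    fix B :: "'g set" assume "open B"
    \<comment> \<open>Uniqueness of the point in \<open>V i\<close> makes the preimage of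
      \<open>B\<close> a hitting event for \<open>V i \<inter> B\<close>; the second set accounts
      for the placeholder 0.\<close>
    have "e i -` B \<inter> space (hull_borel P) = {Q \<in> pattern_hull P. Q \<inter> (V i \<inter> B) \<noteq> {}}
      \<union> (if 0 \<in> B then pattern_hull P - {Q \<in> pattern_hull P. Q \<inter> V i \<noteq> {}} else {})"
    proof (intro equalityI subsetI)
      fix Q assume "Q \<in> e i -` B \<inter> space (hull_borel P)"
      then show "Q \<in> {Q \<in> pattern_hull P. Q \<inter> (V i \<inter> B) \<noteq> {}}
      \<union> (if 0 \<in> B then pattern_hull P - {Q \<in> pattern_hull P. Q \<inter> V i \<noteq> {}} else {})"
        using e_mem[of Q i] by (cases "Q \<inter> V i = {}") (auto simp: e_def[of i Q])
    next
      fix Q assume "Q \<in> {Q \<in> pattern_hull P. Q \<inter> (V i \<inter> B) \<noteq> {}}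
      \<union> (if 0 \<in> B then pattern_hull P - {Q \<in> pattern_hull P. Q \<inter> V i \<noteq> {}} else {})"
      then consider g where "Q \<in> pattern_hull P" "g \<in> Q \<inter> V i" "g \<in> B"
        | "Q \<in> pattern_hull P" "0 \<in> B" "Q \<inter> V i = {}" by (auto split: if_splits)
      then show "Q \<in> e i -` B \<inter> space (hull_borel P)"
      proof cases
        case 1
        then show ?thesis using e_eq[OF 1(1,2)] by simp
      next
        case 2
        then show ?thesis by (simp add: e_def)
      qed
    qed
    also have "\<dots> \<in> sets (hull_borel P)"
      using hit[OF V_open[of i]] hit[OF open_Int[OF V_open[of i] \<open>open B\<close>]]
        sets.top[of "hull_borel P"] by auto
    finally show "e i -` B \<inter> space (hull_borel P) \<in> sets (hull_borel P)" .
  qed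
  define W where "W = disjointed V"
  have W_borel: "W i \<in> sets borel" for i
    unfolding W_def disjointed_def using V_open by (intro sets.Diff sets.finite_UN) auto
  define E where "E i = {Q \<in> pattern_hull P. Q \<inter> V i \<noteq> {}} \<inter> (e i -` W i \<inter> space (hull_borel P))" for i
  have "enumerated_hull P e E"
  proof
    show "E i \<in> sets (hull_borel P)" for i
      unfolding E_def using hit[OF V_open] measurable_sets[OF e_borel W_borel] by auto
    show "e i \<in> borel_measurable (hull_borel P)" for i by (rule e_borel)
    fix Q assume Q: "Q \<in> pattern_hull P"
    show "bij_betw (\<lambda>i. e i Q) {i. Q \<in> E i} Q"
    proof (rule bij_betw_imageI)
      show "inj_on (\<lambda>i. e i Q) {i. Q \<in> E i}"
      proof (rule inj_onI, clarsimp)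
        fix i j assume "Q \<in> E i" "Q \<in> E j" "e i Q = e j Q"
        then have "e i Q \<in> W i \<inter> W j" by (auto simp: E_def)
        then show "i = j" using disjoint_family_disjointed[of V] unfolding W_def disjoint_family_on_def by blast
      qed
      have "g \<in> (\<lambda>i. e i Q) ` {i. Q \<in> E i}" if "g \<in> Q" for g
      proof -
        have "g \<in> (\<Union>i. W i)" unfolding W_def UN_disjointed_eq using UN V by blast
        then obtain i where i: "g \<in> W i" by blast
        then have "g \<in> V i" using disjointed_subset[of V i] by (auto simp: W_def)
        then have "e i Q = g" using e_eq Q that by blast
        then show ?thesis using i \<open>g \<in> V i\<close> that Q by (auto simp: E_def intro!: image_eqI[of _ _ i])
      qed
      moreover have "e i Q \<in> Q" if "Q \<in> E i" for i using e_mem[of Q i] that by (auto simp: E_def)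
      ultimately show "(\<lambda>i. e i Q) ` {i. Q \<in> E i} = Q" by blast
    qed
  qed
  then show ?thesis by blast
qed

section \<open>Borel maps and series obtained from the enumeration\<close>

context enumerated_hull
begin

lemma e_mem: "\<lbrakk>Q \<in> pattern_hull P; Q \<in> E i\<rbrakk> \<Longrightarrow> e i Q \<in> Q"
  using bij_betwE[OF e_bij, of Q] by simp

lemma ex_e: "\<lbrakk>Q \<in> pattern_hull P; g \<in> Q\<rbrakk> \<Longrightarrow> \<exists>i. Q \<in> E i \<and> e i Q = g"
proof -
  assume Q: "Q \<in> pattern_hull P" and g: "g \<in> Q"
  have "g \<in> (\<lambda>i. e i Q) ` {i. Q \<in> E i}"
    using bij_betw_imp_surj_on[OF e_bij[OF Q]] g by simp
  then show ?thesis by (elim imageE) (intro exI conjI, auto)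
qed

text \<open>Joint measurability in the group element and the pattern: \<open>act g Q\<close> hits
  \<open>U\<close> if and only if some enumerated point of \<open>Q\<close> is translated into
  \<open>U\<close>.\<close>

lemma measurable_act [measurable (raw)]:
  assumes [measurable]: "f \<in> borel_measurable M" "h \<in> M \<rightarrow>\<^sub>M hull_borel P"
  shows "(\<lambda>\<omega>. act (f \<omega>) (h \<omega>)) \<in> M \<rightarrow>\<^sub>M hull_borel P"
proof (rule measurable_hull_borelI)
  have h: "h \<omega> \<in> pattern_hull P" if "\<omega> \<in> space M" for \<omega>
    using measurable_space[OF assms(2) that] by simp
  then show "act (f \<omega>) (h \<omega>) \<in> pattern_hull P" if "\<omega> \<in> space M" for \<omega>
    using that by (simp add: act_pattern_hull)
  fix U :: "'g set" assume "open U"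
  then have [measurable]: "U \<in> sets borel" by simp
  have "{\<omega> \<in> space M. act (f \<omega>) (h \<omega>) \<inter> U \<noteq> {}}
    = (\<Union>i. {\<omega> \<in> space M. h \<omega> \<in> E i \<and> e i (h \<omega>) - f \<omega> \<in> U})" (is "?L = ?R")
  proof (intro equalityI subsetI)
    fix \<omega> assume "\<omega> \<in> ?L"
    then obtain p where p: "\<omega> \<in> space M" "p + f \<omega> \<in> h \<omega>" "p \<in> U" by (auto simp: mem_act)
    obtain i where "h \<omega> \<in> E i" "e i (h \<omega>) = p + f \<omega>" using ex_e[OF h[OF p(1)] p(2)] by blast
    then show "\<omega> \<in> ?R" using p by auto
  next
    fix \<omega> assume "\<omega> \<in> ?R"
    then obtain i where i: "\<omega> \<in> space M" "h \<omega> \<in> E i" "e i (h \<omega>) - f \<omega> \<in> U" by blast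
    then have "e i (h \<omega>) - f \<omega> \<in> act (f \<omega>) (h \<omega>)" using e_mem[OF h] by (simp add: mem_act)
    then show "\<omega> \<in> ?L" using i by blast
  qed
  also have "\<dots> \<in> sets M" by measurable
  finally show "{\<omega> \<in> space M. act (f \<omega>) (h \<omega>) \<inter> U \<noteq> {}} \<in> sets M" .
qed

lemma measurable_mem [measurable (raw)]:
  assumes [measurable]: "f \<in> borel_measurable M" "h \<in> M \<rightarrow>\<^sub>M hull_borel P"
  shows "Measurable.pred M (\<lambda>\<omega>. f \<omega> \<in> h \<omega>)"
proof -
  have h: "h \<omega> \<in> pattern_hull P" if "\<omega> \<in> space M" for \<omega>
    using measurable_space[OF assms(2) that] by simp
  have [measurable]: "{\<omega> \<in> space M. e i (h \<omega>) = f \<omega>} \<in> sets M" for i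
    by (rule sets_Collect_eq_borel[OF measurable_compose[OF assms(2) e_measurable] assms(1)])
  have "{\<omega> \<in> space M. f \<omega> \<in> h \<omega>} = (\<Union>i. {\<omega> \<in> space M. h \<omega> \<in> E i} \<inter> {\<omega> \<in> space M. e i (h \<omega>) = f \<omega>})"
  proof (intro equalityI subsetI)
    fix \<omega> assume \<omega>: "\<omega> \<in> {\<omega> \<in> space M. f \<omega> \<in> h \<omega>}"
    then obtain i where "h \<omega> \<in> E i" "e i (h \<omega>) = f \<omega>" using ex_e[OF h] by blast
    with \<omega> show "\<omega> \<in> (\<Union>i. {\<omega> \<in> space M. h \<omega> \<in> E i} \<inter> {\<omega> \<in> space M. e i (h \<omega>) = f \<omega>})"
      by (intro UN_I[of i]) auto
  next
    fix \<omega> assume "\<omega> \<in> (\<Union>i. {\<omega> \<in> space M. h \<omega> \<in> E i} \<inter> {\<omega> \<in> space M. e i (h \<omega>) = f \<omega>})"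
    then obtain i where "\<omega> \<in> space M" "h \<omega> \<in> E i" "e i (h \<omega>) = f \<omega>" by auto
    then show "\<omega> \<in> {\<omega> \<in> space M. f \<omega> \<in> h \<omega>}" using e_mem[OF h, of \<omega> i] by simp
  qed
  also have "\<dots> \<in> sets M" by measurable
  finally show ?thesis unfolding pred_def .
qed

text \<open>A Borel choice of one point from each pattern. It is not meant to be equivariant;
  equivariance is arranged later, in \<open>near\<close>.\<close>

definition selection :: "'g set \<Rightarrow> 'g" where
  "selection Q = e (LEAST i. Q \<in> E i) Q"

lemma selection_measurable [measurable]: "selection \<in> borel_measurable (hull_borel P)"
  unfolding selection_def
proof (rule measurable_compose_countable)
  have "Measurable.pred (hull_borel P) (\<lambda>Q. Q \<in> E i)" for i
    using sets.Int_space_eq1[OF E_sets[of i]] E_sets[of i] by (simp add: pred_def Int_def conj_commute)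
  then show "(\<lambda>Q. LEAST i. Q \<in> E i) \<in> hull_borel P \<rightarrow>\<^sub>M count_space UNIV"
    by (rule measurable_Least)
qed (rule e_measurable)

lemma selection_mem: "Q \<in> pattern_hull P \<Longrightarrow> selection Q \<in> Q"
proof -
  assume Q: "Q \<in> pattern_hull P"
  then obtain g where "g \<in> Q" using pattern_hull_nonempty by blast
  then obtain i where "Q \<in> E i" using ex_e[OF Q] by blast
  then have "Q \<in> E (LEAST i. Q \<in> E i)" by (rule LeastI)
  then show ?thesis unfolding selection_def by (rule e_mem[OF Q])
qed

lemma nn_integral_pattern:
  assumes "Q \<in> pattern_hull P"
  shows "(\<integral>\<^sup>+ g. f g \<partial>count_space Q) = (\<Sum>i. indicator (E i) Q * f (e i Q))"
proof -
  have "(\<integral>\<^sup>+ g. f g \<partial>count_space Q) = (\<integral>\<^sup>+ i. f (e i Q) \<partial>count_space {i. Q \<in> E i})"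
    using nn_integral_bij_count_space[OF e_bij[OF assms]] by simp
  also have "\<dots> = (\<integral>\<^sup>+ i. f (e i Q) * indicator {i. Q \<in> E i} i \<partial>count_space UNIV)"
    by (simp add: nn_integral_count_space_indicator)
  also have "\<dots> = (\<Sum>i. indicator (E i) Q * f (e i Q))"
    unfolding nn_integral_count_space_nat by (intro suminf_cong) (simp add: indicator_def)
  finally show ?thesis .
qed

end

section \<open>The transverse measure\<close>

text \<open>Every point has an open neighbourhood inside a compact set, hence of finite measure; by
  the Lindelof property countably many of these cover the group.\<close>

lemma haar_sigma_finite:
  fixes m :: "'g::{topological_group_add, t2_space, second_countable_topology} measure"
  assumes lc: "locally_compact_space (euclidean :: 'g topology)" and m: "haar_measure m"
  shows "sigma_finite_measure m"
proof
  have sets_m: "sets m = sets borel" using m by (simp add: haar_measure_def)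
  have "\<forall>x. \<exists>U. open U \<and> (\<exists>K. compact K \<and> (x::'g) \<in> U \<and> U \<subseteq> K)"
    using lc by (simp add: locally_compact_space_def)
  then obtain U K where UK: "\<And>x::'g. open (U x)" "\<And>x. compact (K x)" "\<And>x. x \<in> U x" "\<And>x. U x \<subseteq> K x"
    by metis
  obtain F where F: "F \<subseteq> range U" "countable F" "\<Union>F = \<Union>(range U)"
    using Lindelof[of "range U"] UK(1) by blast
  have fin: "emeasure m (U x) \<noteq> \<infinity>" for x
  proof -
    have "K x \<in> sets m" using UK(2) by (simp add: sets_m compact_imp_closed borel_closed)
    then have "emeasure m (U x) \<le> emeasure m (K x)" by (intro emeasure_mono UK(4))
    also have "\<dots> < \<infinity>" using m UK(2) by (simp add: haar_measure_def)
    finally show ?thesis by simp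
  qed
  show "\<exists>A. countable A \<and> A \<subseteq> sets m \<and> \<Union>A = space m \<and> (\<forall>a\<in>A. emeasure m a \<noteq> \<infinity>)"
  proof (intro exI[of _ F] conjI ballI)
    show "F \<subseteq> sets m" using F(1) UK(1) by (auto simp: sets_m)
    show "\<Union>F = space m" using F(3) UK(3) sets_eq_imp_space_eq[OF sets_m] by auto
    show "emeasure m a \<noteq> \<infinity>" if "a \<in> F" for a using F(1) that fin by auto
  qed (rule F(2))
qed

lemma haar_UNIV_pos: "haar_measure m \<Longrightarrow> 0 < emeasure m UNIV"
  by (simp add: haar_measure_def)

text \<open>A strictly positive integrable function exists by \<sigma>-finiteness; its integral is
  non-zero because the whole group has positive Haar measure, so it can be normalised.\<close>

lemma haar_density_exists:
  fixes m :: "'g::{topological_group_add, t2_space, second_countable_topology} measure"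
  assumes lc: "locally_compact_space (euclidean :: 'g topology)" and m: "haar_measure m"
  shows "\<exists>w \<in> borel_measurable borel. (\<forall>g. 0 < w g) \<and> (\<integral>\<^sup>+ g. ennreal (w g) \<partial>m) = 1"
proof -
  interpret sigma_finite_measure m by (rule haar_sigma_finite[OF assms])
  have sets_m [measurable_cong]: "sets m = sets borel" using m by (simp add: haar_measure_def)
  have sp: "space m = UNIV" using sets_eq_imp_space_eq[OF sets_m] by simp
  obtain h where h: "h \<in> borel_measurable m" "integral\<^sup>N m h \<noteq> \<infinity>" "\<And>x. 0 < h x \<and> h x < \<infinity>"
    using Ex_finite_integrable_function sp by auto
  define c where "c = integral\<^sup>N m h"
  have "c \<noteq> 0"
  proof
    assume "c = 0"
    then have "AE x in m. h x = 0" using h(1) by (simp add: c_def nn_integral_0_iff_AE)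
    then have "AE x in m. False" using h(3) by (auto elim!: eventually_mono simp: less_le)
    then have "space m \<in> null_sets m" by (simp add: AE_iff_null)
    then have "emeasure m (space m) = 0" by (rule null_setsD1)
    then show False using haar_UNIV_pos[OF m] by (simp add: sp)
  qed
  then have c: "0 < c" "c < \<infinity>" using h(2) by (auto simp: c_def less_top zero_less_iff_neq_zero)
  have fin: "h g / c < \<infinity>" "0 < h g / c" for g
    using h(3)[of g] c
    by (auto simp: ennreal_divide_eq_top_iff ennreal_zero_less_divide less_top[symmetric])
  have "(\<integral>\<^sup>+ g. ennreal (enn2real (h g / c)) \<partial>m) = (\<integral>\<^sup>+ g. h g / c \<partial>m)"
    using fin by (intro nn_integral_cong) (simp add: less_top)
  also have "\<dots> = 1"
    using h(1) c by (simp add: nn_integral_divide c_def[symmetric] less_top)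
  finally have int: "(\<integral>\<^sup>+ g. ennreal (enn2real (h g / c)) \<partial>m) = 1" .
  have "(\<lambda>g. enn2real (h g / c)) \<in> borel_measurable m" using h(1) by measurable
  then have meas: "(\<lambda>g. enn2real (h g / c)) \<in> borel_measurable borel"
    by (simp add: measurable_cong_sets[OF sets_m refl])
  show ?thesis
    using int meas fin by (intro bexI[of _ "\<lambda>g. enn2real (h g / c)"] conjI allI)
      (auto simp: enn2real_positive_iff)
qed

text \<open>Fixes one invariant measure on the hull and one positive probability density
  \<open>w\<close>, which is the weight in the transverse measure as well as the law of the random
  translations. \<open>right_invariant\<close> is the form in which unimodularity is used.\<close>

locale hull_system = enumerated_hull P e E
  for P :: "'g::{topological_group_add, t2_space, second_countable_topology} set" and e E +
  fixes m :: "'g measure" and w :: "'g \<Rightarrow> real" and \<mu> :: "'g set measure"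
  assumes haar: "haar_measure m"
    and sigma_finite: "sigma_finite_measure m"
    and right_invariant: "\<And>g. distr m borel (\<lambda>x. x + g) = m"
    and w_measurable [measurable]: "w \<in> borel_measurable borel"
    and w_pos: "\<And>g. 0 < w g"
    and w_integral: "(\<integral>\<^sup>+ g. ennreal (w g) \<partial>m) = 1"
    and sets_mu [measurable_cong]: "sets \<mu> = sets (hull_borel P)"
    and prob_mu: "prob_space \<mu>"
    and mu_invariant: "\<And>g. distr \<mu> \<mu> (act g) = \<mu>"
begin

sublocale m: sigma_finite_measure m by (rule sigma_finite)
sublocale \<mu>: prob_space \<mu> by (rule prob_mu)
sublocale pair_sigma_finite m \<mu> ..

lemma sets_m [measurable_cong]: "sets m = sets borel"
  using haar by (simp add: haar_measure_def)

lemma space_m [simp]: "space m = UNIV"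
  using sets_eq_imp_space_eq[OF sets_m] by simp

lemma space_mu [simp]: "space \<mu> = pattern_hull P"
  using sets_eq_imp_space_eq[OF sets_mu] by simp

lemma nn_integral_left:
  assumes [measurable]: "f \<in> borel_measurable borel"
  shows "(\<integral>\<^sup>+ x. f (g + x) \<partial>m) = (\<integral>\<^sup>+ x. f x \<partial>m)"
proof -
  have "(\<integral>\<^sup>+ x. f x \<partial>m) = (\<integral>\<^sup>+ x. f x \<partial>distr m borel (\<lambda>x. g + x))"
    using haar by (simp add: haar_measure_def)
  also have "\<dots> = (\<integral>\<^sup>+ x. f (g + x) \<partial>m)" by (rule nn_integral_distr) measurable
  finally show ?thesis ..
qed

lemma nn_integral_right:
  assumes [measurable]: "f \<in> borel_measurable borel"
  shows "(\<integral>\<^sup>+ x. f (x + g) \<partial>m) = (\<integral>\<^sup>+ x. f x \<partial>m)"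
proof -
  have "(\<integral>\<^sup>+ x. f x \<partial>m) = (\<integral>\<^sup>+ x. f x \<partial>distr m borel (\<lambda>x. x + g))"
    by (simp add: right_invariant)
  also have "\<dots> = (\<integral>\<^sup>+ x. f (x + g) \<partial>m)" by (rule nn_integral_distr) measurable
  finally show ?thesis ..
qed

lemma nn_integral_act:
  assumes [measurable]: "f \<in> borel_measurable (hull_borel P)"
  shows "(\<integral>\<^sup>+ x. f (act g x) \<partial>\<mu>) = (\<integral>\<^sup>+ x. f x \<partial>\<mu>)"
proof -
  have "(\<integral>\<^sup>+ x. f x \<partial>\<mu>) = (\<integral>\<^sup>+ x. f x \<partial>distr \<mu> \<mu> (act g))"
    by (simp add: mu_invariant)
  also have "\<dots> = (\<integral>\<^sup>+ x. f (act g x) \<partial>\<mu>)"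
    by (rule nn_integral_distr) measurable
  finally show ?thesis ..
qed

text \<open>A bi-invariant measure is invariant under inversion: insert the factor 1, the integral
  of \<open>w (g + h)\<close> over \<open>h\<close>, exchange the integrals, substitute
  \<open>g - h\<close> for \<open>g\<close>, and exchange back.\<close>

lemma nn_integral_uminus:
  assumes u [measurable]: "u \<in> borel_measurable borel"
  shows "(\<integral>\<^sup>+ h. u (- h) \<partial>m) = (\<integral>\<^sup>+ h. u h \<partial>m)"
proof -
  interpret mm: pair_sigma_finite m m ..
  have right: "(\<integral>\<^sup>+ h. u (g - h) \<partial>m) = (\<integral>\<^sup>+ h. u (- h) \<partial>m)" for g
    using nn_integral_right[of "\<lambda>h. u (- h)" "- g"] by (simp add: minus_add)
  have "(\<integral>\<^sup>+ h. u h \<partial>m) = (\<integral>\<^sup>+ g. u g * (\<integral>\<^sup>+ h. ennreal (w (g + h)) \<partial>m) \<partial>m)"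
    using nn_integral_left[of "\<lambda>h. ennreal (w h)"] by (simp add: w_integral)
  also have "\<dots> = (\<integral>\<^sup>+ g. \<integral>\<^sup>+ h. u g * ennreal (w (g + h)) \<partial>m \<partial>m)"
    by (simp add: nn_integral_cmult)
  also have "\<dots> = (\<integral>\<^sup>+ h. \<integral>\<^sup>+ g. u g * ennreal (w (g + h)) \<partial>m \<partial>m)"
    by (rule mm.Fubini'[symmetric]) measurable
  also have "\<dots> = (\<integral>\<^sup>+ h. \<integral>\<^sup>+ g. u (g - h) * ennreal (w g) \<partial>m \<partial>m)"
    by (rule nn_integral_cong)
      (use nn_integral_right[of "\<lambda>g. u (g - h) * ennreal (w g)" h for h] in simp)
  also have "\<dots> = (\<integral>\<^sup>+ g. \<integral>\<^sup>+ h. u (g - h) * ennreal (w g) \<partial>m \<partial>m)"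
    by (rule mm.Fubini') measurable
  also have "\<dots> = (\<integral>\<^sup>+ g. (\<integral>\<^sup>+ h. u (- h) \<partial>m) * ennreal (w g) \<partial>m)"
    by (intro nn_integral_cong) (simp add: nn_integral_multc right)
  also have "\<dots> = (\<integral>\<^sup>+ h. u (- h) \<partial>m)"
    by (simp add: nn_integral_cmult w_integral)
  finally show ?thesis ..
qed

lemma borel_measurable_pattern_integral [measurable (raw)]:
  fixes G :: "'g \<Rightarrow> 'b \<Rightarrow> ennreal"
  assumes h [measurable]: "h \<in> N \<rightarrow>\<^sub>M hull_borel P"
    and [measurable]: "(\<lambda>(g, \<omega>). G g \<omega>) \<in> borel_measurable (borel \<Otimes>\<^sub>M N)"
  shows "(\<lambda>\<omega>. \<integral>\<^sup>+ g. G g \<omega> \<partial>count_space (h \<omega>)) \<in> borel_measurable N"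
proof -
  have "(\<lambda>\<omega>. \<Sum>i. indicator (E i) (h \<omega>) * G (e i (h \<omega>)) \<omega>) \<in> borel_measurable N"
    by measurable
  then show ?thesis
    using measurable_space[OF h]
    by (subst measurable_cong[where g = "\<lambda>\<omega>. \<Sum>i. indicator (E i) (h \<omega>) * G (e i (h \<omega>)) \<omega>"])
      (auto simp: nn_integral_pattern)
qed

text \<open>The counting integral is a series along the enumeration, so the exchange is monotone
  convergence.\<close>

lemma nn_integral_pattern_swap:
  fixes G :: "'g \<Rightarrow> 'g \<Rightarrow> ennreal"
  assumes Q: "Q \<in> pattern_hull P"
    and [measurable]: "\<And>g. G g \<in> borel_measurable borel"
  shows "(\<integral>\<^sup>+ g. \<integral>\<^sup>+ h. G g h \<partial>m \<partial>count_space Q) = (\<integral>\<^sup>+ h. \<integral>\<^sup>+ g. G g h \<partial>count_space Q \<partial>m)"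
  using Q by (simp add: nn_integral_pattern nn_integral_suminf nn_integral_cmult)

lemma nn_integral_pattern_act:
  "(\<integral>\<^sup>+ g. f g \<partial>count_space (act h Q)) = (\<integral>\<^sup>+ g. f (g - h) \<partial>count_space Q)"
proof -
  have "bij_betw (\<lambda>g. g - h) Q (act h Q)"
    unfolding act_def by (intro bij_betw_imageI inj_onI) (metis diff_add_cancel, simp)
  then show ?thesis by (rule nn_integral_bij_count_space[symmetric])
qed

definition transverse_integral :: "('g set \<Rightarrow> ennreal) \<Rightarrow> ('g \<Rightarrow> ennreal) \<Rightarrow> ennreal" where
  "transverse_integral f u = (\<integral>\<^sup>+ x. \<integral>\<^sup>+ g. f (act g x) * u g \<partial>count_space x \<partial>\<mu>)"

text \<open>
  Both sides are \<open>\<integral>\<integral> \<Sum> f (g x) u (g) v (g h)\<close>: for fixed \<open>h\<close> the invariance of \<open>\<mu>\<close> under \<open>x \<mapsto> h x\<close> moves \<open>h\<close>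
  from the argument of \<open>v\<close> to that of \<open>u\<close>.
\<close>

lemma transverse_integral_exchange:
  assumes [measurable]: "f \<in> borel_measurable (hull_borel P)"
    "u \<in> borel_measurable borel" "v \<in> borel_measurable borel"
  shows "transverse_integral f u * (\<integral>\<^sup>+ h. v h \<partial>m) = transverse_integral f v * (\<integral>\<^sup>+ h. u h \<partial>m)"
proof -
  \<comment> \<open>Right invariance removes \<open>g\<close>, and inversion invariance then removes
    the sign.\<close>
  have right: "(\<integral>\<^sup>+ h. u (g - h) \<partial>m) = (\<integral>\<^sup>+ h. u h \<partial>m)" for g
    using nn_integral_right[of "\<lambda>h. u (- h)" "- g"] nn_integral_uminus[of u] by (simp add: minus_add)
  have f_act [measurable]: "(\<lambda>(g, x). f (act g x)) \<in> borel_measurable (borel \<Otimes>\<^sub>M hull_borel P)"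
    by measurable
  have "transverse_integral f u * (\<integral>\<^sup>+ h. v h \<partial>m)
    = (\<integral>\<^sup>+ x. \<integral>\<^sup>+ g. f (act g x) * u g * (\<integral>\<^sup>+ h. v (g + h) \<partial>m) \<partial>count_space x \<partial>\<mu>)"
    unfolding transverse_integral_def
    by (subst nn_integral_multc[symmetric], measurable)
      (simp add: nn_integral_multc nn_integral_left)
  also have "\<dots> = (\<integral>\<^sup>+ x. \<integral>\<^sup>+ g. \<integral>\<^sup>+ h. f (act g x) * u g * v (g + h) \<partial>m \<partial>count_space x \<partial>\<mu>)"
    by (simp add: nn_integral_cmult)
  also have "\<dots> = (\<integral>\<^sup>+ x. \<integral>\<^sup>+ h. \<integral>\<^sup>+ g. f (act g x) * u g * v (g + h) \<partial>count_space x \<partial>m \<partial>\<mu>)"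
    by (intro nn_integral_cong nn_integral_pattern_swap) auto
  also have "\<dots> = (\<integral>\<^sup>+ h. \<integral>\<^sup>+ x. \<integral>\<^sup>+ g. f (act g x) * u g * v (g + h) \<partial>count_space x \<partial>\<mu> \<partial>m)"
    by (rule Fubini') measurable
  also have "\<dots> = (\<integral>\<^sup>+ h. \<integral>\<^sup>+ x. \<integral>\<^sup>+ g. f (act g (act h x)) * u g * v (g + h) \<partial>count_space (act h x) \<partial>\<mu> \<partial>m)"
    by (intro nn_integral_cong nn_integral_act[symmetric]) measurable
  also have "\<dots> = (\<integral>\<^sup>+ h. \<integral>\<^sup>+ x. \<integral>\<^sup>+ g. f (act g x) * u (g - h) * v g \<partial>count_space x \<partial>\<mu> \<partial>m)"
    by (simp add: nn_integral_pattern_act act_act)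
  also have "\<dots> = (\<integral>\<^sup>+ x. \<integral>\<^sup>+ h. \<integral>\<^sup>+ g. f (act g x) * u (g - h) * v g \<partial>count_space x \<partial>m \<partial>\<mu>)"
    by (rule Fubini'[symmetric]) measurable
  also have "\<dots> = (\<integral>\<^sup>+ x. \<integral>\<^sup>+ g. \<integral>\<^sup>+ h. f (act g x) * u (g - h) * v g \<partial>m \<partial>count_space x \<partial>\<mu>)"
    by (intro nn_integral_cong nn_integral_pattern_swap[symmetric]) auto
  also have "\<dots> = (\<integral>\<^sup>+ x. \<integral>\<^sup>+ g. f (act g x) * v g * (\<integral>\<^sup>+ h. u h \<partial>m) \<partial>count_space x \<partial>\<mu>)"
    by (intro nn_integral_cong) (simp add: nn_integral_cmult nn_integral_multc right ac_simps)
  also have "\<dots> = transverse_integral f v * (\<integral>\<^sup>+ h. u h \<partial>m)"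
    unfolding transverse_integral_def
    by (subst nn_integral_multc[symmetric], measurable) (simp add: nn_integral_multc)
  finally show ?thesis .
qed

section \<open>Existence and uniqueness of the transverse measure\<close>

lemma transversal_sets: "transversal P \<in> sets (hull_borel P)"
proof -
  have "{Q \<in> space (hull_borel P). (\<lambda>_. 0) Q \<in> (\<lambda>Q. Q) Q} \<in> sets (hull_borel P)"
    using measurable_mem[of "\<lambda>_. 0" "hull_borel P" "\<lambda>Q. Q"] by (simp add: pred_def)
  then show ?thesis by (simp add: transversal_def)
qed

lemma transversal_subset: "transversal P \<subseteq> pattern_hull P"
  by (auto simp: transversal_def)

lemma space_transversal_borel [simp]: "space (transversal_borel P) = transversal P"
  using transversal_subset by (auto simp: transversal_borel_def space_restrict_space)

lemma measurable_transversal_borel: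
  fixes f :: "'g set \<Rightarrow> ennreal"
  shows "f \<in> borel_measurable (transversal_borel P) \<longleftrightarrow>
    (\<lambda>x. f x * indicator (transversal P) x) \<in> borel_measurable (hull_borel P)"
  unfolding transversal_borel_def
  using transversal_sets
  by (intro borel_measurable_restrict_space_iff_ennreal) (simp add: Int_absorb2[OF transversal_subset])

lemma measurable_into_transversal_borel:
  assumes "f \<in> N \<rightarrow>\<^sub>M hull_borel P" "\<And>x. x \<in> space N \<Longrightarrow> f x \<in> transversal P"
  shows "f \<in> N \<rightarrow>\<^sub>M transversal_borel P"
  unfolding transversal_borel_def using assms by (intro measurable_restrict_space2) auto

text \<open>The defining formula with weight \<open>w\<close>, realised as a push-forward:
  \<open>(i, x)\<close> stands for the point \<open>e i x\<close> of \<open>x\<close>. For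
  \<open>x \<notin> E i\<close> the density vanishes, and \<open>selection\<close> only keeps the
  map inside the transversal.\<close>

definition \<nu> :: "'g set measure" where
  "\<nu> = distr (density (count_space UNIV \<Otimes>\<^sub>M \<mu>) (\<lambda>(i, x). indicator (E i) x * ennreal (w (e i x))))
    (transversal_borel P) (\<lambda>(i, x). act (if x \<in> E i then e i x else selection x) x)"

lemma sets_nu [measurable_cong]: "sets \<nu> = sets (transversal_borel P)"
  by (simp add: \<nu>_def)

lemma space_nu [simp]: "space \<nu> = transversal P"
  using sets_eq_imp_space_eq[OF sets_nu] by simp

lemma nn_integral_nu:
  assumes f: "f \<in> borel_measurable (transversal_borel P)"
  shows "(\<integral>\<^sup>+ y. f y \<partial>\<nu>) = (\<integral>\<^sup>+ x. \<integral>\<^sup>+ g. f (act g x) * ennreal (w g) \<partial>count_space x \<partial>\<mu>)"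
proof -
  let ?N = "count_space (UNIV :: nat set) \<Otimes>\<^sub>M \<mu>"
  have meas1: "(\<lambda>(i, x). indicator (E i) x * ennreal (w (e i x))) \<in> borel_measurable ?N"
    by (rule measurable_pair_measure_countable1) auto
  have "(\<lambda>(i, x). act (if x \<in> E i then e i x else selection x) x) \<in> ?N \<rightarrow>\<^sub>M hull_borel P"
    by (rule measurable_pair_measure_countable1) auto
  then have meas2: "(\<lambda>(i, x). act (if x \<in> E i then e i x else selection x) x) \<in> ?N \<rightarrow>\<^sub>M transversal_borel P"
    by (rule measurable_into_transversal_borel)
      (auto simp: space_pair_measure transversal_act_iff e_mem selection_mem)
  note meas3 = measurable_compose[OF meas2 f]
  have "(\<integral>\<^sup>+ y. f y \<partial>\<nu>) = (\<integral>\<^sup>+ (i, x). indicator (E i) x * ennreal (w (e i x)) *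
      f (act (if x \<in> E i then e i x else selection x) x) \<partial>?N)"
    unfolding \<nu>_def using f meas1 meas2 meas3
    by (subst nn_integral_distr, simp, simp, subst nn_integral_density)
      (simp_all add: case_prod_unfold)
  also have "\<dots> = (\<integral>\<^sup>+ x. \<integral>\<^sup>+ i. indicator (E i) x * ennreal (w (e i x)) *
      f (act (if x \<in> E i then e i x else selection x) x) \<partial>count_space UNIV \<partial>\<mu>)"
  proof -
    interpret c: sigma_finite_measure "count_space (UNIV :: nat set)"
      by (rule sigma_finite_measure_count_space)
    interpret c: pair_sigma_finite "count_space (UNIV :: nat set)" \<mu> ..
    show ?thesis
      using borel_measurable_times_ennreal[OF meas1 meas3]
      by (subst c.nn_integral_snd[symmetric]) (simp_all add: case_prod_unfold cong: if_cong)
  qed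
  also have "\<dots> = (\<integral>\<^sup>+ x. \<integral>\<^sup>+ g. f (act g x) * ennreal (w g) \<partial>count_space x \<partial>\<mu>)"
    by (intro nn_integral_cong)
      (auto simp: nn_integral_count_space_nat nn_integral_pattern indicator_def ac_simps intro!: suminf_cong)
  finally show ?thesis .
qed

text \<open>Extending \<open>f\<close> by 0 off the transversal is harmless, because only
  \<open>g \<in> x\<close> are counted and these bring \<open>x\<close> into the
  transversal.\<close>

lemma transverse_integral_restrict:
  "(\<integral>\<^sup>+ x. \<integral>\<^sup>+ g. f (act g x) * u g \<partial>count_space x \<partial>\<mu>)
    = transverse_integral (\<lambda>x. f x * indicator (transversal P) x) u"
  unfolding transverse_integral_def
  by (intro nn_integral_cong) (simp add: transversal_act_iff indicator_def)

lemma is_transverse_measure_nu: "is_transverse_measure m P \<mu> \<nu>"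
  unfolding is_transverse_measure_def
proof (intro conjI ballI impI sets_nu)
  fix f :: "'g set \<Rightarrow> ennreal" and u :: "'g \<Rightarrow> ennreal"
  assume f: "f \<in> borel_measurable (transversal_borel P)" and u: "u \<in> borel_measurable borel"
    and u1: "(\<integral>\<^sup>+ g. u g \<partial>m) = 1"
  have "(\<integral>\<^sup>+ y. f y \<partial>\<nu>) = transverse_integral (\<lambda>x. f x * indicator (transversal P) x) (\<lambda>g. ennreal (w g))"
    unfolding nn_integral_nu[OF f] by (rule transverse_integral_restrict)
  also have "\<dots> = transverse_integral (\<lambda>x. f x * indicator (transversal P) x) u"
    using transverse_integral_exchange[OF f[unfolded measurable_transversal_borel] _ u, of "\<lambda>g. ennreal (w g)"]
    by (simp add: u1 w_integral)
  also have "\<dots> = (\<integral>\<^sup>+ x. \<integral>\<^sup>+ g. f (act g x) * u g \<partial>count_space x \<partial>\<mu>)"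
    by (rule transverse_integral_restrict[symmetric])
  also have "\<dots> = (\<integral>\<^sup>+ x. \<integral>\<^sup>+ g. f (act g x) * u g \<partial>count_space (return_times P x) \<partial>\<mu>)"
    by (intro nn_integral_cong) (simp add: return_times_eq)
  finally show "(\<integral>\<^sup>+ y. f y \<partial>\<nu>) = (\<integral>\<^sup>+ x. \<integral>\<^sup>+ g. f (act g x) * u g \<partial>count_space (return_times P x) \<partial>\<mu>)" .
qed

text \<open>The defining property for indicator functions and the single weight \<open>w\<close>
  already determines every value of the measure, so \<open>THE\<close> picks out the constructed
  one.\<close>

lemma transverse_measure_eq: "transverse_measure m P \<mu> = \<nu>"
  unfolding transverse_measure_def
proof (rule the_equality[where P = "is_transverse_measure m P \<mu>", OF is_transverse_measure_nu])
  fix \<nu>' assume \<nu>': "is_transverse_measure m P \<mu> \<nu>'"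
  then have sets: "sets \<nu>' = sets (transversal_borel P)" by (simp add: is_transverse_measure_def)
  show "\<nu>' = \<nu>"
  proof (rule measure_eqI)
    fix A assume "A \<in> sets \<nu>'"
    then have A: "A \<in> sets (transversal_borel P)" by (simp add: sets)
    then have iA: "indicator A \<in> transversal_borel P \<rightarrow>\<^sub>M (borel :: ennreal measure)" by simp
    have "(\<integral>\<^sup>+ y. indicator A y \<partial>\<nu>') = (\<integral>\<^sup>+ y. indicator A y \<partial>\<nu>)"
      using \<nu>' is_transverse_measure_nu iA w_integral unfolding is_transverse_measure_def
      by (metis (no_types, lifting) measurable_compose[OF w_measurable measurable_ennreal])
    then show "emeasure \<nu>' A = emeasure \<nu> A" using A by (simp add: sets sets_nu)
  qed (simp add: sets sets_nu)
qed

text \<open>Since \<open>w\<close> is positive, a weighted sum over \<open>x\<close> that vanishes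
  forces every return of \<open>x\<close> to avoid the null set.\<close>

lemma AE_nu_D:
  assumes "AE y in \<nu>. \<Phi> y"
  shows "AE x in \<mu>. \<forall>g\<in>x. \<Phi> (act g x)"
proof -
  obtain N where N: "N \<in> null_sets \<nu>" "{y \<in> space \<nu>. \<not> \<Phi> y} \<subseteq> N"
    using assms by (auto simp: eventually_ae_filter)
  then have NS: "N \<in> sets (transversal_borel P)" by (auto simp: sets_nu)
  then have iN: "indicator N \<in> borel_measurable (transversal_borel P)" by simp
  from NS have NX: "N \<in> sets (hull_borel P)"
    unfolding transversal_borel_def using transversal_sets by (simp add: sets_restrict_space_iff Int_absorb2[OF transversal_subset])
  have "(\<integral>\<^sup>+ x. \<integral>\<^sup>+ g. indicator N (act g x) * ennreal (w g) \<partial>count_space x \<partial>\<mu>) = (\<integral>\<^sup>+ y. indicator N y \<partial>\<nu>)"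
    by (rule nn_integral_nu[OF iN, symmetric])
  also have "\<dots> = 0" using N(1) by (simp add: null_sets_def)
  finally have "AE x in \<mu>. (\<integral>\<^sup>+ g. indicator N (act g x) * ennreal (w g) \<partial>count_space x) = 0"
    using NX by (subst (asm) nn_integral_0_iff_AE) auto
  then show ?thesis
  proof (rule AE_mp, intro AE_I2 impI ballI)
    fix x g assume x: "x \<in> space \<mu>" "(\<integral>\<^sup>+ g. indicator N (act g x) * ennreal (w g) \<partial>count_space x) = 0"
      and g: "g \<in> x"
    have "indicator N (act g x) * ennreal (w g) = 0"
      using x(2) g by (subst (asm) nn_integral_0_iff_AE) (auto simp: AE_count_space)
    then have "act g x \<notin> N" using w_pos[of g] by (auto simp: indicator_def)
    moreover have "act g x \<in> transversal P" using x g by (simp add: transversal_act_iff)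
    ultimately show "\<Phi> (act g x)" using N(2) by auto
  qed
qed

text \<open>The transversal may itself be null for \<open>\<mu>\<close>, so the exceptional set must
  be invariant before it says anything about \<open>\<nu>\<close>. Here \<open>a x\<close> is the
  Haar measure of the times at which the orbit of \<open>x\<close> visits \<open>N\<close>; it
  vanishes almost everywhere by Fubini.\<close>

lemma AE_nu_I:
  assumes inv: "\<And>g x. x \<in> pattern_hull P \<Longrightarrow> \<Phi> (act g x) \<longleftrightarrow> \<Phi> x"
    and AE: "AE x in \<mu>. \<Phi> x"
  shows "AE y in \<nu>. \<Phi> y"
proof -
  obtain N where N: "N \<in> null_sets \<mu>" "{x \<in> space \<mu>. \<not> \<Phi> x} \<subseteq> N"
    using AE by (auto simp: eventually_ae_filter)
  then have NS [measurable]: "N \<in> sets (hull_borel P)" by (auto simp: sets_mu)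
  text \<open>Averaging over the group turns \<open>N\<close> into an invariant null set.\<close>
  define a where "a x = (\<integral>\<^sup>+ g. indicator N (act g x) \<partial>m)" for x
  have a_meas [measurable]: "a \<in> borel_measurable (hull_borel P)"
    unfolding a_def by measurable
  have "(\<integral>\<^sup>+ x. a x \<partial>\<mu>) = (\<integral>\<^sup>+ g. \<integral>\<^sup>+ x. indicator N (act g x) \<partial>\<mu> \<partial>m)"
    unfolding a_def by (rule Fubini') measurable
  also have "\<dots> = (\<integral>\<^sup>+ g. emeasure \<mu> N \<partial>m)"
    using nn_integral_act[of "indicator N"] NS by (simp add: sets_mu)
  also have "\<dots> = 0" using N(1) by (simp add: null_sets_def)
  finally have a0: "AE x in \<mu>. a x = 0" by (subst (asm) nn_integral_0_iff_AE) auto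
  have a_act: "a (act g x) = a x" if "x \<in> pattern_hull P" for g x
  proof -
    have [measurable]: "(\<lambda>h. indicator N (act h x) :: ennreal) \<in> borel_measurable borel"
    proof -
      have [measurable]: "(\<lambda>h::'g. x) \<in> borel \<rightarrow>\<^sub>M hull_borel P" using that by (intro measurable_const) simp
      show ?thesis by measurable
    qed
    show ?thesis
      unfolding a_def using nn_integral_right[of "\<lambda>h. indicator N (act h x)" g] by (simp add: act_act)
  qed
  \<comment> \<open>By invariance of \<open>\<Phi>\<close> the whole orbit of a bad point lies in
    \<open>N\<close>, so the visiting times fill the group.\<close>
  have bad: "a x \<noteq> 0" if x: "x \<in> pattern_hull P" "\<not> \<Phi> x" for x
  proof -
    have "act g x \<in> N" for g using N(2) inv[OF x(1), of g] x by (auto simp: act_pattern_hull)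
    then have "a x = emeasure m UNIV" using nn_integral_indicator[of UNIV m] sets.top[of m] by (simp add: a_def)
    then show ?thesis using haar_UNIV_pos[OF haar] by simp
  qed
  define N' where "N' = {y \<in> transversal P. a y \<noteq> 0}"
  have N'X: "N' \<in> sets (hull_borel P)"
  proof -
    have "N' = transversal P \<inter> (a -` (- {0}) \<inter> space (hull_borel P))"
      using transversal_subset by (auto simp: N'_def)
    also have "\<dots> \<in> sets (hull_borel P)"
      by (intro sets.Int transversal_sets measurable_sets[OF a_meas]) simp
    finally show ?thesis .
  qed
  then have N'Y: "N' \<in> sets (transversal_borel P)"
    unfolding transversal_borel_def using transversal_sets
    by (auto simp: sets_restrict_space_iff Int_absorb2[OF transversal_subset] N'_def)
  have "emeasure \<nu> N' = (\<integral>\<^sup>+ y. indicator N' y \<partial>\<nu>)" using N'Y by (simp add: sets_nu)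
  also have "\<dots> = (\<integral>\<^sup>+ x. \<integral>\<^sup>+ g. indicator N' (act g x) * ennreal (w g) \<partial>count_space x \<partial>\<mu>)"
    using N'Y by (intro nn_integral_nu) simp
  also have "\<dots> = (\<integral>\<^sup>+ x. 0 \<partial>\<mu>)"
  proof (rule nn_integral_cong_AE)
    show "AE x in \<mu>. (\<integral>\<^sup>+ g. indicator N' (act g x) * ennreal (w g) \<partial>count_space x) = 0"
      using a0 by (rule AE_mp) (auto intro!: AE_I2 simp: N'_def a_act indicator_def)
  qed
  finally have "N' \<in> null_sets \<nu>" using N'Y by (simp add: null_sets_def sets_nu)
  moreover have "{y \<in> space \<nu>. \<not> \<Phi> y} \<subseteq> N'"
    using bad transversal_subset by (auto simp: N'_def)
  ultimately show ?thesis by (auto simp: eventually_ae_filter)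
qed

lemma AE_nu_iff:
  assumes inv: "\<And>g x. x \<in> pattern_hull P \<Longrightarrow> \<Phi> (act g x) \<longleftrightarrow> \<Phi> x"
  shows "(AE y in \<nu>. \<Phi> y) \<longleftrightarrow> (AE x in \<mu>. \<Phi> x)"
proof
  assume "AE y in \<nu>. \<Phi> y"
  \<comment> \<open>Patterns are non-empty, so there is some \<open>g \<in> x\<close> at which the
    conclusion of \<open>AE_nu_D\<close> can be read and moved back to \<open>x\<close>.\<close>
  have empty_notin_hull: "{} \<notin> pattern_hull P" using pattern_hull_nonempty by blast
  from AE_nu_D[OF \<open>AE y in \<nu>. \<Phi> y\<close>] show "AE x in \<mu>. \<Phi> x"
    by (rule AE_mp) (auto intro!: AE_I2 simp: inv empty_notin_hull)
qed (rule AE_nu_I[OF inv])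

end

section \<open>The tuple measures of the pattern groupoid\<close>

lemma bij_betw_PiE_comp:
  assumes "bij_betw b I F"
  shows "bij_betw (\<lambda>\<iota>. \<lambda>i\<in>S. b (\<iota> i)) (S \<rightarrow>\<^sub>E I) (S \<rightarrow>\<^sub>E F)"
proof (rule bij_betwI)
  have b: "b i \<in> F" if "i \<in> I" for i using assms that by (rule bij_betw_apply)
  have b': "inv_into I b y \<in> I" "b (inv_into I b y) = y" if "y \<in> F" for y
    using assms that bij_betw_inv_into_right inv_into_into[of y b I]
    by (auto simp: bij_betw_imp_surj_on)
  show "(\<lambda>\<iota>. \<lambda>i\<in>S. b (\<iota> i)) \<in> (S \<rightarrow>\<^sub>E I) \<rightarrow> (S \<rightarrow>\<^sub>E F)" using b by (auto simp: PiE_iff)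
  show "(\<lambda>\<gamma>. \<lambda>i\<in>S. inv_into I b (\<gamma> i)) \<in> (S \<rightarrow>\<^sub>E F) \<rightarrow> (S \<rightarrow>\<^sub>E I)" using b' by (auto simp: PiE_iff)
  show "(\<lambda>i\<in>S. inv_into I b ((\<lambda>i\<in>S. b (\<iota> i)) i)) = \<iota>" if "\<iota> \<in> S \<rightarrow>\<^sub>E I" for \<iota>
    using that bij_betw_inv_into_left[OF assms] by (auto simp: fun_eq_iff PiE_iff extensional_def)
  show "(\<lambda>i\<in>S. b ((\<lambda>i\<in>S. inv_into I b (\<gamma> i)) i)) = \<gamma>" if "\<gamma> \<in> S \<rightarrow>\<^sub>E F" for \<gamma>
    using that b' by (auto simp: fun_eq_iff PiE_iff extensional_def)
qed

context hull_system
begin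

abbreviation tuples :: "nat \<Rightarrow> (nat \<Rightarrow> 'g) set" where
  "tuples n \<equiv> {..<n} \<rightarrow>\<^sub>E UNIV"

abbreviation pattern_tuples :: "nat \<Rightarrow> 'g set \<Rightarrow> (nat \<Rightarrow> 'g) set" where
  "pattern_tuples n x \<equiv> {..<n} \<rightarrow>\<^sub>E uminus ` x"

abbreviation \<G> :: "('g \<times> 'g set, 'g set) mgroupoid" where
  "\<G> \<equiv> pattern_groupoid m P \<mu>"

text \<open>The morphism with target \<open>y\<close> and group component \<open>g\<close>; it exists if and only if \<open>- g \<in> y\<close>.\<close>

definition arrow :: "'g set \<Rightarrow> 'g \<Rightarrow> 'g \<times> 'g set" where
  "arrow y g = (g, act (- g) y)"

definition arrow_tuple :: "nat \<Rightarrow> 'g set \<Rightarrow> (nat \<Rightarrow> 'g) \<Rightarrow> nat \<Rightarrow> 'g \<times> 'g set" where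
  "arrow_tuple n y t = (\<lambda>i\<in>{..<n}. arrow y (t i))"

text \<open>The common target is read off the entry with index 0, hence the assumptions
  \<open>0 < n\<close> from here on.\<close>

definition base :: "(nat \<Rightarrow> 'g \<times> 'g set) \<Rightarrow> 'g set" where
  "base \<gamma> = target \<G> (\<gamma> 0)"

lemma pattern_groupoid_simps [simp]:
  "objects \<G> = \<nu>" "target \<G> (g, y) = act g y" "compose \<G> (g, z) (h, y) = (g + h, y)"
  "inverse_arrow \<G> (g, y) = (- g, act g y)"
  by (simp_all add: pattern_groupoid_def transverse_measure_eq)

lemma space_arrows: "space (arrows \<G>) = {(g, y). y \<in> transversal P \<and> act g y \<in> transversal P}"
  by (auto simp: pattern_groupoid_def space_restrict_space space_pair_measure)

lemma measurable_arrows_fst [measurable]: "fst \<in> borel_measurable (arrows \<G>)"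
  unfolding pattern_groupoid_def by (simp add: measurable_restrict_space1)

lemma measurable_arrows_snd [measurable]: "snd \<in> arrows \<G> \<rightarrow>\<^sub>M hull_borel P"
proof -
  have "(\<lambda>y. y) \<in> transversal_borel P \<rightarrow>\<^sub>M hull_borel P"
    unfolding transversal_borel_def by (rule measurable_restrict_space1) simp
  from measurable_compose[OF measurable_snd this] show ?thesis
    unfolding pattern_groupoid_def mgroupoid.simps by (intro measurable_restrict_space1)
qed

lemma target_fiber_eq:
  assumes y: "y \<in> transversal P"
  shows "target_fiber \<G> y = arrow y ` uminus ` y"
proof (intro equalityI subsetI)
  fix \<gamma> assume "\<gamma> \<in> target_fiber \<G> y"
  then obtain g z where \<gamma>: "\<gamma> = (g, z)" "z \<in> transversal P" "act g z = y"
    by (cases \<gamma>) (auto simp: target_fiber_def space_arrows)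
  then have z: "z = act (- g) y" by (auto simp: act_act)
  then have "- g \<in> y" using \<gamma>(2) transversal_act_iff[of y P "- g"] y transversal_subset by auto
  then show "\<gamma> \<in> arrow y ` uminus ` y"
    using \<gamma>(1) z by (auto simp: arrow_def intro!: image_eqI[of _ _ g] image_eqI[of g _ "- g"])
next
  fix \<gamma> assume "\<gamma> \<in> arrow y ` uminus ` y"
  then obtain h where h: "h \<in> y" "\<gamma> = (- h, act h y)" by (auto simp: arrow_def)
  then have "act h y \<in> transversal P" using y transversal_subset by (auto simp: transversal_act_iff)
  then show "\<gamma> \<in> target_fiber \<G> y" using h y by (auto simp: target_fiber_def space_arrows act_act)
qed

lemma fiber_PiE_eq:
  assumes y: "y \<in> transversal P"
  shows "({..<n} \<rightarrow>\<^sub>E target_fiber \<G> y) = arrow_tuple n y ` (pattern_tuples n y)"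
proof -
  have "bij_betw (arrow y) (uminus ` y) (target_fiber \<G> y)"
    unfolding target_fiber_eq[OF y] by (intro bij_betw_imageI inj_onI) (simp_all add: arrow_def)
  from bij_betw_imp_surj_on[OF bij_betw_PiE_comp[OF this, of "{..<n}"], symmetric] show ?thesis
    by (simp add: arrow_tuple_def[abs_def])
qed

lemma base_arrow_tuple: "0 < n \<Longrightarrow> base (arrow_tuple n y t) = y"
  by (simp add: base_def arrow_tuple_def arrow_def act_act)

lemma fst_arrow_tuple: "t \<in> {..<n} \<rightarrow>\<^sub>E UNIV \<Longrightarrow> (\<lambda>i\<in>{..<n}. fst (arrow_tuple n y t i)) = t"
  by (auto simp: fun_eq_iff arrow_tuple_def arrow_def PiE_iff extensional_def)

lemma space_arrows_nonempty_fiber: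
  assumes "\<gamma> \<in> space (arrows \<G>)"
  shows "target \<G> \<gamma> \<in> transversal P" "\<gamma> \<in> target_fiber \<G> (target \<G> \<gamma>)"
  using assms by (auto simp: space_arrows target_fiber_def)

lemma fiber_tuples_iff:
  assumes "0 < n"
  shows "\<gamma> \<in> fiber_tuples \<G> n \<longleftrightarrow>
    base \<gamma> \<in> transversal P \<and> \<gamma> \<in> {..<n} \<rightarrow>\<^sub>E target_fiber \<G> (base \<gamma>)"
proof
  assume \<gamma>: "\<gamma> \<in> fiber_tuples \<G> n"
  then have "\<gamma> 0 \<in> space (arrows \<G>)" using assms by (auto simp: fiber_tuples_def)
  then have "base \<gamma> \<in> transversal P" unfolding base_def by (rule space_arrows_nonempty_fiber)
  moreover have "target \<G> (\<gamma> i) = target \<G> (\<gamma> 0)" if "i < n" for i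
    using \<gamma> assms that unfolding fiber_tuples_def by blast
  moreover have "\<gamma> \<in> {..<n} \<rightarrow>\<^sub>E space (arrows \<G>)" using \<gamma> by (simp add: fiber_tuples_def)
  ultimately have "\<gamma> i \<in> target_fiber \<G> (base \<gamma>)" if "i < n" for i
    using that unfolding target_fiber_def base_def by blast
  then show "base \<gamma> \<in> transversal P \<and> \<gamma> \<in> {..<n} \<rightarrow>\<^sub>E target_fiber \<G> (base \<gamma>)"
    using \<open>base \<gamma> \<in> transversal P\<close> \<gamma> by (auto simp: PiE_iff fiber_tuples_def)
next
  assume "base \<gamma> \<in> transversal P \<and> \<gamma> \<in> {..<n} \<rightarrow>\<^sub>E target_fiber \<G> (base \<gamma>)"
  then show "\<gamma> \<in> fiber_tuples \<G> n" by (auto simp: fiber_tuples_def target_fiber_def PiE_iff)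
qed

lemma fiber_tuples_arrow_tuple:
  assumes "0 < n" "\<gamma> \<in> fiber_tuples \<G> n"
  shows "\<exists>t \<in> pattern_tuples n (base \<gamma>). \<gamma> = arrow_tuple n (base \<gamma>) t"
  using assms fiber_PiE_eq[of "base \<gamma>" n] by (auto simp: fiber_tuples_iff)

lemma arrow_tuple_mem:
  assumes "0 < n" "y \<in> transversal P" "t \<in> pattern_tuples n y"
  shows "arrow_tuple n y t \<in> fiber_tuples \<G> n" "arrow_tuple n y t \<in> {..<n} \<rightarrow>\<^sub>E target_fiber \<G> y"
  using assms fiber_PiE_eq[of y n] by (auto simp: fiber_tuples_iff base_arrow_tuple)

section \<open>The measure on tuples of morphisms with common target\<close>

abbreviation T :: "nat \<Rightarrow> (nat \<Rightarrow> 'g \<times> 'g set) measure" where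
  "T n \<equiv> tuple_measure \<G> n"

lemma fiber_tuples_subset: "fiber_tuples \<G> n \<subseteq> space (PiM {..<n} (\<lambda>_. arrows \<G>))"
  by (auto simp: fiber_tuples_def space_PiM)

lemma sets_T: "sets (T n) = sets (restrict_space (PiM {..<n} (\<lambda>_. arrows \<G>)) (fiber_tuples \<G> n))"
proof -
  let ?R = "restrict_space (PiM {..<n} (\<lambda>_. arrows \<G>)) (fiber_tuples \<G> n)"
  have sp: "space ?R = fiber_tuples \<G> n"
    using fiber_tuples_subset by (auto simp: space_restrict_space)
  show ?thesis
    unfolding tuple_measure_def
    using sets.space_closed[of ?R] sets.sigma_sets_eq[of ?R] by (simp add: sp sets_measure_of)
qed

lemma space_T [simp]: "space (T n) = fiber_tuples \<G> n"
  using sets_eq_imp_space_eq[OF sets_T[of n]] fiber_tuples_subset by (auto simp: space_restrict_space)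

lemma measurable_T_component: "i < n \<Longrightarrow> (\<lambda>\<gamma>. \<gamma> i) \<in> T n \<rightarrow>\<^sub>M arrows \<G>"
  by (subst measurable_cong_sets[OF sets_T refl]) (auto intro!: measurable_restrict_space1)

lemma measurable_base: "0 < n \<Longrightarrow> base \<in> T n \<rightarrow>\<^sub>M hull_borel P"
proof -
  assume n: "0 < n"
  have "base = (\<lambda>\<gamma>. act (fst (\<gamma> 0)) (snd (\<gamma> 0)))"
    by (simp add: base_def pattern_groupoid_def case_prod_unfold fun_eq_iff)
  moreover have "(\<lambda>\<gamma>. act (fst (\<gamma> 0)) (snd (\<gamma> 0))) \<in> T n \<rightarrow>\<^sub>M hull_borel P"
    by (intro measurable_act measurable_compose[OF measurable_T_component[OF n]] measurable_arrows_fst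
        measurable_arrows_snd)
  ultimately show ?thesis by simp
qed

lemma measurable_into_arrows:
  assumes f: "f \<in> borel_measurable N" and h: "h \<in> N \<rightarrow>\<^sub>M hull_borel P"
    and "\<And>x. x \<in> space N \<Longrightarrow> h x \<in> transversal P \<and> act (f x) (h x) \<in> transversal P"
  shows "(\<lambda>x. (f x, h x)) \<in> N \<rightarrow>\<^sub>M arrows \<G>"
  unfolding pattern_groupoid_def mgroupoid.simps
  using assms(3) by (intro measurable_restrict_space2 measurable_Pair f measurable_into_transversal_borel[OF h]) auto

lemma measurable_into_T:
  assumes "\<And>i. i < n \<Longrightarrow> (\<lambda>x. f x i) \<in> N \<rightarrow>\<^sub>M arrows \<G>"
    and "\<And>x. x \<in> space N \<Longrightarrow> f x \<in> fiber_tuples \<G> n"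
  shows "f \<in> N \<rightarrow>\<^sub>M T n"
proof -
  have "f \<in> N \<rightarrow>\<^sub>M PiM {..<n} (\<lambda>_. arrows \<G>)"
    using assms by (intro measurable_PiM_single') (auto simp: fiber_tuples_def PiE_iff)
  then show ?thesis
    using assms(2) by (subst measurable_cong_sets[OF refl sets_T]) (auto intro: measurable_restrict_space2)
qed

text \<open>Outside \<open>E i\<close> the value falls back on \<open>selection\<close>, so that
  every index yields a point of the pattern and the tuples built from it stay in the tuple
  space.\<close>

definition choice :: "nat \<Rightarrow> 'g set \<Rightarrow> 'g" where
  "choice i y = (if y \<in> E i then e i y else selection y)"

lemma choice_measurable [measurable]: "choice i \<in> borel_measurable (hull_borel P)"
  unfolding choice_def by measurable

lemma choice_mem: "y \<in> pattern_hull P \<Longrightarrow> choice i y \<in> y"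
  by (simp add: choice_def e_mem selection_mem)

lemma measurable_nu_hull: "f \<in> hull_borel P \<rightarrow>\<^sub>M N \<Longrightarrow> f \<in> \<nu> \<rightarrow>\<^sub>M N"
  by (subst measurable_cong_sets[OF sets_nu refl])
    (simp add: transversal_borel_def measurable_restrict_space1)

lemma choice_tuple_measurable:
  assumes "0 < n"
  shows "(\<lambda>y. arrow_tuple n y (\<lambda>i\<in>{..<n}. - choice (\<iota> i) y)) \<in> \<nu> \<rightarrow>\<^sub>M T n"
proof (rule measurable_into_T)
  have hull: "y \<in> pattern_hull P" if "y \<in> space \<nu>" for y using that transversal_subset by auto
  show "arrow_tuple n y (\<lambda>i\<in>{..<n}. - choice (\<iota> i) y) \<in> fiber_tuples \<G> n" if "y \<in> space \<nu>" for y
    using that hull[OF that] by (intro arrow_tuple_mem assms) (auto simp: choice_mem)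
  fix i assume "i < n"
  have "(\<lambda>y. (- choice (\<iota> i) y, act (choice (\<iota> i) y) y)) \<in> \<nu> \<rightarrow>\<^sub>M arrows \<G>"
    using hull by (intro measurable_into_arrows measurable_nu_hull)
      (auto simp: act_act transversal_act_iff choice_mem)
  then show "(\<lambda>y. arrow_tuple n y (\<lambda>i\<in>{..<n}. - choice (\<iota> i) y) i) \<in> \<nu> \<rightarrow>\<^sub>M arrows \<G>"
    using \<open>i < n\<close> by (simp add: arrow_tuple_def arrow_def)
qed

text \<open>The fiber varies with \<open>y\<close>, whereas the set of index tuples is fixed and
  countable; the first indicator records which index tuples are present in \<open>y\<close>.\<close>

lemma card_fiber_eq:
  assumes n: "0 < n" and y: "y \<in> transversal P" and A: "A \<subseteq> fiber_tuples \<G> n"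
  shows "emeasure (count_space UNIV) (A \<inter> ({..<n} \<rightarrow>\<^sub>E target_fiber \<G> y))
    = (\<integral>\<^sup>+ \<iota>. indicator {y. \<forall>i<n. y \<in> E (\<iota> i)} y *
        indicator A (arrow_tuple n y (\<lambda>i\<in>{..<n}. - choice (\<iota> i) y)) \<partial>count_space ({..<n} \<rightarrow>\<^sub>E UNIV))"
proof -
  let ?I = "{i. y \<in> E i}" and ?F = "target_fiber \<G> y"
  have yX: "y \<in> pattern_hull P" using y transversal_subset by blast
  have "bij_betw (arrow y \<circ> (uminus \<circ> (\<lambda>i. e i y))) ?I ?F"
    unfolding target_fiber_eq[OF y]
    by (intro bij_betw_trans[OF bij_betw_trans[OF e_bij[OF yX]]] bij_betw_imageI refl inj_onI)
      (simp_all add: arrow_def)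
  then have bij: "bij_betw (\<lambda>\<iota>. \<lambda>i\<in>{..<n}. arrow y (- e (\<iota> i) y)) ({..<n} \<rightarrow>\<^sub>E ?I) ({..<n} \<rightarrow>\<^sub>E ?F)"
    using bij_betw_PiE_comp by fastforce
  have "emeasure (count_space UNIV) (A \<inter> ({..<n} \<rightarrow>\<^sub>E ?F))
    = (\<integral>\<^sup>+ \<gamma>. indicator (A \<inter> ({..<n} \<rightarrow>\<^sub>E ?F)) \<gamma> \<partial>count_space UNIV)" by simp
  also have "\<dots> = (\<integral>\<^sup>+ \<gamma>. indicator A \<gamma> * indicator ({..<n} \<rightarrow>\<^sub>E ?F) \<gamma> \<partial>count_space UNIV)"
    by (intro nn_integral_cong) (simp add: indicator_def)
  also have "\<dots> = (\<integral>\<^sup>+ \<gamma>. indicator A \<gamma> \<partial>count_space ({..<n} \<rightarrow>\<^sub>E ?F))"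
    by (rule nn_integral_count_space_indicator[symmetric]) simp
  also have "\<dots> = (\<integral>\<^sup>+ \<iota>. indicator A (\<lambda>i\<in>{..<n}. arrow y (- e (\<iota> i) y)) \<partial>count_space ({..<n} \<rightarrow>\<^sub>E ?I))"
    by (rule nn_integral_bij_count_space[OF bij, symmetric])
  also have "\<dots> = (\<integral>\<^sup>+ \<iota>. indicator A (\<lambda>i\<in>{..<n}. arrow y (- e (\<iota> i) y)) *
      indicator ({..<n} \<rightarrow>\<^sub>E ?I) \<iota> \<partial>count_space UNIV)"
    by (rule nn_integral_count_space_indicator) simp
  also have "\<dots> = (\<integral>\<^sup>+ \<iota>. indicator {y. \<forall>i<n. y \<in> E (\<iota> i)} y *
      indicator A (arrow_tuple n y (\<lambda>i\<in>{..<n}. - choice (\<iota> i) y)) *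
      indicator ({..<n} \<rightarrow>\<^sub>E UNIV) \<iota> \<partial>count_space UNIV)"
  proof (rule nn_integral_cong)
    fix \<iota> :: "nat \<Rightarrow> nat"
    show "indicator A (\<lambda>i\<in>{..<n}. arrow y (- e (\<iota> i) y)) * indicator ({..<n} \<rightarrow>\<^sub>E ?I) \<iota> =
      (indicator {y. \<forall>i<n. y \<in> E (\<iota> i)} y *
      indicator A (arrow_tuple n y (\<lambda>i\<in>{..<n}. - choice (\<iota> i) y)) *
      indicator ({..<n} \<rightarrow>\<^sub>E UNIV) \<iota> :: ennreal)"
    proof (cases "\<forall>i<n. y \<in> E (\<iota> i)")
      case True
      then have "(\<lambda>i\<in>{..<n}. arrow y (- e (\<iota> i) y)) = arrow_tuple n y (\<lambda>i\<in>{..<n}. - choice (\<iota> i) y)"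
        by (auto simp: arrow_tuple_def choice_def fun_eq_iff)
      with True show ?thesis by (simp add: indicator_def PiE_iff)
    next
      case False
      then show ?thesis by (auto simp: indicator_def PiE_iff)
    qed
  qed
  also have "\<dots> = (\<integral>\<^sup>+ \<iota>. indicator {y. \<forall>i<n. y \<in> E (\<iota> i)} y *
      indicator A (arrow_tuple n y (\<lambda>i\<in>{..<n}. - choice (\<iota> i) y)) \<partial>count_space ({..<n} \<rightarrow>\<^sub>E UNIV))"
    by (rule nn_integral_count_space_indicator[symmetric]) simp
  finally show ?thesis .
qed

lemma card_fiber_measurable:
  assumes n: "0 < n" and A: "A \<in> sets (T n)"
  shows "(\<lambda>y. emeasure (count_space UNIV) (A \<inter> ({..<n} \<rightarrow>\<^sub>E target_fiber \<G> y))) \<in> borel_measurable \<nu>"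
proof -
  let ?J = "{..<n} \<rightarrow>\<^sub>E (UNIV :: nat set)"
  let ?f = "\<lambda>y \<iota>. indicator {y. \<forall>i<n. y \<in> E (\<iota> i)} y *
      indicator A (arrow_tuple n y (\<lambda>i\<in>{..<n}. - choice (\<iota> i) y)) :: ennreal"
  \<comment> \<open>Finite products of the index set are countable, which is why measurability can
    be checked for each index tuple separately.\<close>
  have J: "countable ?J" by (intro countable_PiE) auto
  interpret J: sigma_finite_measure "count_space ?J"
    by (rule sigma_finite_measure_count_space_countable[OF J])
  have f: "(\<lambda>y. ?f y \<iota>) \<in> borel_measurable \<nu>" for \<iota>
  proof (intro borel_measurable_times_ennreal)
    have "{y \<in> pattern_hull P. \<forall>i<n. y \<in> E (\<iota> i)} \<in> sets (hull_borel P)"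
    proof -
      have "{y \<in> pattern_hull P. \<forall>i<n. y \<in> E (\<iota> i)} = (\<Inter>i\<in>{..<n}. E (\<iota> i))"
        using sets.sets_into_space[OF E_sets] n by fastforce
      also have "\<dots> \<in> sets (hull_borel P)" by (intro sets.finite_INT) (use n in auto)
      finally show ?thesis .
    qed
    then have "indicator {y \<in> pattern_hull P. \<forall>i<n. y \<in> E (\<iota> i)} \<in> borel_measurable (hull_borel P)"
      by (rule borel_measurable_indicator)
    then have 1: "indicator {y \<in> pattern_hull P. \<forall>i<n. y \<in> E (\<iota> i)} \<in> borel_measurable \<nu>"
      by (rule measurable_nu_hull)
    show "(\<lambda>y. indicator {y. \<forall>i<n. y \<in> E (\<iota> i)} y :: ennreal) \<in> borel_measurable \<nu>"
      by (subst measurable_cong[where g = "indicator {y \<in> pattern_hull P. \<forall>i<n. y \<in> E (\<iota> i)}"])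
        (use 1 transversal_subset in \<open>auto simp: indicator_def subset_iff\<close>)
    show "(\<lambda>y. indicator A (arrow_tuple n y (\<lambda>i\<in>{..<n}. - choice (\<iota> i) y)) :: ennreal) \<in> borel_measurable \<nu>"
      using measurable_compose[OF choice_tuple_measurable[OF n] borel_measurable_indicator[OF A]] .
  qed
  have "(\<lambda>p. ?f (fst p) (snd p)) \<in> borel_measurable (\<nu> \<Otimes>\<^sub>M count_space ?J)"
    by (rule measurable_compose_countable'[where g = snd and I = ?J and f = "\<lambda>\<iota> p. ?f (fst p) \<iota>"])
      (rule measurable_compose[OF measurable_fst f], rule measurable_snd, rule J)
  from J.borel_measurable_nn_integral_fst[OF this]
  have "(\<lambda>y. \<integral>\<^sup>+ \<iota>. ?f y \<iota> \<partial>count_space ?J) \<in> borel_measurable \<nu>"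
    by (simp only: fst_conv snd_conv)
  then show ?thesis
    using sets.sets_into_space[OF A]
    by (subst measurable_cong[where g = "\<lambda>y. \<integral>\<^sup>+ \<iota>. ?f y \<iota> \<partial>count_space ?J"])
      (simp_all only: space_nu space_T card_fiber_eq[OF n])
qed

text \<open>\<open>measure_of\<close> returns the prescribed values only for a countably additive
  function; additivity here is monotone convergence and relies on the measurability of the counts in
  \<open>y\<close>.\<close>

lemma emeasure_T:
  assumes n: "0 < n" and A: "A \<in> sets (T n)"
  shows "emeasure (T n) A
    = (\<integral>\<^sup>+ y. emeasure (count_space UNIV) (A \<inter> ({..<n} \<rightarrow>\<^sub>E target_fiber \<G> y)) \<partial>\<nu>)"
proof -
  let ?c = "\<lambda>A y. emeasure (count_space UNIV) (A \<inter> ({..<n} \<rightarrow>\<^sub>E target_fiber \<G> y))"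
  have ca: "countably_additive (sets (T n)) (\<lambda>A. \<integral>\<^sup>+ y. ?c A y \<partial>\<nu>)"
    unfolding countably_additive_def
  proof (intro allI impI)
    fix B :: "nat \<Rightarrow> (nat \<Rightarrow> 'g \<times> 'g set) set"
    assume B: "range B \<subseteq> sets (T n)" "disjoint_family B"
    have "(\<Sum>i. \<integral>\<^sup>+ y. ?c (B i) y \<partial>\<nu>) = (\<integral>\<^sup>+ y. (\<Sum>i. ?c (B i) y) \<partial>\<nu>)"
      using B(1) by (intro nn_integral_suminf[symmetric] card_fiber_measurable n) auto
    also have "\<dots> = (\<integral>\<^sup>+ y. ?c (\<Union>i. B i) y \<partial>\<nu>)"
    proof (intro nn_integral_cong)
      fix y
      have "disjoint_family (\<lambda>i. B i \<inter> ({..<n} \<rightarrow>\<^sub>E target_fiber \<G> y))"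
        using B(2) by (auto simp: disjoint_family_on_def)
      then show "(\<Sum>i. ?c (B i) y) = ?c (\<Union>i. B i) y"
        by (subst suminf_emeasure) (auto intro!: arg_cong[where f = "emeasure (count_space UNIV)"])
    qed
    finally show "(\<Sum>i. \<integral>\<^sup>+ y. ?c (B i) y \<partial>\<nu>) = (\<integral>\<^sup>+ y. ?c (\<Union>i. B i) y \<partial>\<nu>)" .
  qed
  have pos: "positive (sets (T n)) (\<lambda>A. \<integral>\<^sup>+ y. ?c A y \<partial>\<nu>)"
    by (simp add: positive_def)
  let ?S = "sets (restrict_space (PiM {..<n} (\<lambda>_. arrows \<G>)) (fiber_tuples \<G> n))"
  have "?S \<subseteq> Pow (fiber_tuples \<G> n)"
    using sets.space_closed[of "T n"] by (simp add: sets_T)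
  then show ?thesis
    using emeasure_measure_of[of "T n" "fiber_tuples \<G> n" ?S "\<lambda>A. \<integral>\<^sup>+ y. ?c A y \<partial>\<nu>" A] A pos ca
    by (simp add: tuple_measure_def)
qed

text \<open>A set that is null for counting measure is empty, so an exceptional set has no tuple at
  all over almost every \<open>y\<close>.\<close>

lemma AE_T_iff:
  assumes n: "0 < n"
  shows "(AE \<gamma> in T n. \<Phi> \<gamma>) \<longleftrightarrow> (AE y in \<nu>. \<forall>t \<in> pattern_tuples n y. \<Phi> (arrow_tuple n y t))"
proof
  assume "AE \<gamma> in T n. \<Phi> \<gamma>"
  then obtain N where N: "N \<in> null_sets (T n)" "{\<gamma> \<in> space (T n). \<not> \<Phi> \<gamma>} \<subseteq> N"
    by (auto simp: eventually_ae_filter)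
  then have "(\<integral>\<^sup>+ y. emeasure (count_space UNIV) (N \<inter> ({..<n} \<rightarrow>\<^sub>E target_fiber \<G> y)) \<partial>\<nu>) = 0"
    by (subst emeasure_T[OF n, symmetric]) auto
  then have "AE y in \<nu>. emeasure (count_space UNIV) (N \<inter> ({..<n} \<rightarrow>\<^sub>E target_fiber \<G> y)) = 0"
    using N(1) by (subst (asm) nn_integral_0_iff_AE) (auto intro: card_fiber_measurable[OF n])
  then show "AE y in \<nu>. \<forall>t \<in> pattern_tuples n y. \<Phi> (arrow_tuple n y t)"
  proof (rule AE_mp, intro AE_I2 impI ballI)
    fix y t assume y: "y \<in> space \<nu>" and t: "t \<in> pattern_tuples n y"
      and "emeasure (count_space UNIV) (N \<inter> ({..<n} \<rightarrow>\<^sub>E target_fiber \<G> y)) = 0"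
    then have "N \<inter> ({..<n} \<rightarrow>\<^sub>E target_fiber \<G> y) = {}"
      by (simp add: emeasure_count_space_eq_0)
    with arrow_tuple_mem[OF n _ t] y N(2) show "\<Phi> (arrow_tuple n y t)" by auto
  qed
next
  assume "AE y in \<nu>. \<forall>t \<in> pattern_tuples n y. \<Phi> (arrow_tuple n y t)"
  then obtain N where N: "N \<in> null_sets \<nu>"
    "{y \<in> space \<nu>. \<not> (\<forall>t \<in> pattern_tuples n y. \<Phi> (arrow_tuple n y t))} \<subseteq> N"
    by (auto simp: eventually_ae_filter)
  \<comment> \<open>Exceptional tuples lie over \<open>N\<close>, and the preimage of
    \<open>N\<close> under \<open>base\<close> has empty fibers over almost every
    \<open>y\<close>.\<close>
  have "base \<in> T n \<rightarrow>\<^sub>M \<nu>"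
    by (subst measurable_cong_sets[OF refl sets_nu])
      (auto intro!: measurable_into_transversal_borel measurable_base n simp: fiber_tuples_iff[OF n])
  then have N': "base -` N \<inter> space (T n) \<in> sets (T n)"
    using N(1) by (intro measurable_sets[of _ _ \<nu>]) auto
  have "emeasure (T n) (base -` N \<inter> space (T n)) = (\<integral>\<^sup>+ y. 0 \<partial>\<nu>)"
    unfolding emeasure_T[OF n N']
  proof (rule nn_integral_cong_AE)
    have "AE y in \<nu>. y \<notin> N" using N(1) by (rule AE_not_in)
    then show "AE y in \<nu>. emeasure (count_space UNIV)
        (base -` N \<inter> space (T n) \<inter> ({..<n} \<rightarrow>\<^sub>E target_fiber \<G> y)) = 0"
    proof (rule AE_mp, intro AE_I2 impI)
      fix y assume "y \<in> space \<nu>" "y \<notin> N"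
      then have "base -` N \<inter> space (T n) \<inter> ({..<n} \<rightarrow>\<^sub>E target_fiber \<G> y) = {}"
        using fiber_PiE_eq[of y n] base_arrow_tuple[OF n] by auto
      then show "emeasure (count_space UNIV)
        (base -` N \<inter> space (T n) \<inter> ({..<n} \<rightarrow>\<^sub>E target_fiber \<G> y)) = 0" by simp
    qed
  qed
  then have "base -` N \<inter> space (T n) \<in> null_sets (T n)" using N' by (simp add: null_sets_def)
  moreover have "{\<gamma> \<in> space (T n). \<not> \<Phi> \<gamma>} \<subseteq> base -` N \<inter> space (T n)"
  proof
    fix \<gamma> assume "\<gamma> \<in> {\<gamma> \<in> space (T n). \<not> \<Phi> \<gamma>}"
    then have \<gamma>: "\<gamma> \<in> fiber_tuples \<G> n" "\<not> \<Phi> \<gamma>" by auto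
    obtain t where "t \<in> pattern_tuples n (base \<gamma>)" "\<gamma> = arrow_tuple n (base \<gamma>) t"
      using fiber_tuples_arrow_tuple[OF n \<gamma>(1)] by blast
    then have "\<not> (\<forall>t \<in> pattern_tuples n (base \<gamma>). \<Phi> (arrow_tuple n (base \<gamma>) t))" using \<gamma>(2) by metis
    moreover have "base \<gamma> \<in> space \<nu>" using \<gamma>(1) by (simp add: fiber_tuples_iff[OF n])
    ultimately show "\<gamma> \<in> base -` N \<inter> space (T n)" using N(2) \<gamma>(1) by auto
  qed
  ultimately show "AE \<gamma> in T n. \<Phi> \<gamma>" unfolding eventually_ae_filter by blast
qed

definition shift :: "nat \<Rightarrow> 'g \<Rightarrow> (nat \<Rightarrow> 'g) \<Rightarrow> nat \<Rightarrow> 'g" where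
  "shift n g t = (\<lambda>i\<in>{..<n}. g + t i)"

lemma shift_shift: "shift n g (shift n h t) = shift n (g + h) t"
  by (auto simp: shift_def fun_eq_iff add.assoc)

lemma mem_uminus_image: "g \<in> uminus ` Q \<longleftrightarrow> - g \<in> (Q :: 'g set)"
  by (metis image_iff minus_minus)

lemma shift_mem_iff:
  assumes "t \<in> tuples n"
  shows "shift n g t \<in> pattern_tuples n (act g x) \<longleftrightarrow> t \<in> pattern_tuples n x"
proof -
  have "- (g + t i) + g = - t i" for i by (simp add: minus_add)
  then show ?thesis
    using assms by (simp add: shift_def PiE_iff mem_uminus_image mem_act)
qed

text \<open>The diagonal shift by \<open>g\<close> matches the pattern tuples of \<open>x\<close>
  with those of \<open>act g x\<close>. Quantifying over them thus gives an invariant predicate of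
  \<open>x\<close>, to which \<open>AE_nu_iff\<close> applies.\<close>

lemma AE_T_invariant:
  assumes n: "0 < n"
    and inv: "\<And>g t x. \<lbrakk>t \<in> tuples n; x \<in> pattern_hull P\<rbrakk>
      \<Longrightarrow> \<Psi> (shift n g t) (act g x) \<longleftrightarrow> \<Psi> t x"
  shows "(AE \<gamma> in T n. \<Psi> (\<lambda>i\<in>{..<n}. fst (\<gamma> i)) (base \<gamma>))
    \<longleftrightarrow> (AE x in \<mu>. \<forall>t \<in> pattern_tuples n x. \<Psi> t x)"
proof -
  have UNIV: "t \<in> tuples n" if "t \<in> pattern_tuples n x" for t :: "nat \<Rightarrow> 'g" and x
    using that by (auto simp: PiE_iff)
  have "(AE \<gamma> in T n. \<Psi> (\<lambda>i\<in>{..<n}. fst (\<gamma> i)) (base \<gamma>))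
    \<longleftrightarrow> (AE y in \<nu>. \<forall>t \<in> pattern_tuples n y. \<Psi> t y)"
    unfolding AE_T_iff[OF n] using UNIV
    by (intro AE_cong ball_cong refl) (simp add: base_arrow_tuple[OF n] fst_arrow_tuple cong: restrict_cong)
  also have "\<dots> \<longleftrightarrow> (AE x in \<mu>. \<forall>t \<in> pattern_tuples n x. \<Psi> t x)"
  proof (rule AE_nu_iff)
    have half: "\<forall>t \<in> pattern_tuples n x. \<Psi> t x"
      if x: "x \<in> pattern_hull P" and all: "\<forall>t \<in> pattern_tuples n (act g x). \<Psi> t (act g x)" for g x
    proof
      fix t assume t: "t \<in> pattern_tuples n x"
      then have "shift n g t \<in> pattern_tuples n (act g x)" by (simp add: shift_mem_iff UNIV)
      with all have "\<Psi> (shift n g t) (act g x)" by blast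
      then show "\<Psi> t x" using inv[OF UNIV[OF t] x] by simp
    qed
    fix g x assume x: "x \<in> pattern_hull P"
    show "(\<forall>t \<in> pattern_tuples n (act g x). \<Psi> t (act g x)) \<longleftrightarrow> (\<forall>t \<in> pattern_tuples n x. \<Psi> t x)"
      using half[OF x, of g] half[of "act g x" "- g"] x by (auto simp: act_act act_pattern_hull)
  qed
  finally show ?thesis .
qed

end

section \<open>The prism identity\<close>

text \<open>The simplex \<open>(a_0, ..., a_j, b_j, ..., b_(n-1))\<close> of the standard
  triangulation of a prism; position \<open>j\<close> is used twice.\<close>

definition prism :: "nat \<Rightarrow> nat \<Rightarrow> (nat \<Rightarrow> 'a) \<Rightarrow> (nat \<Rightarrow> 'a) \<Rightarrow> nat \<Rightarrow> 'a" where
  "prism n j a b = (\<lambda>i\<in>{..<Suc n}. if i \<le> j then a i else b (i - 1))"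

text \<open>Omitting an entry before the jump removes an \<open>a\<close>, and removing position
  \<open>i\<close> from both tuples moves the jump one place to the left.\<close>

lemma face_prism_less:
  assumes "i < j" "j < Suc k"
  shows "face (Suc k) i (prism (Suc k) j a b) = prism k (j - 1) (face k i a) (face k i b)"
proof
  fix l show "face (Suc k) i (prism (Suc k) j a b) l = prism k (j - 1) (face k i a) (face k i b) l"
    using assms by (cases l) (auto simp: face_def prism_def)
qed

lemma face_prism_greater:
  assumes "j < i" "i \<le> k"
  shows "face (Suc k) (Suc i) (prism (Suc k) j a b) = prism k j (face k i a) (face k i b)"
proof
  fix l show "face (Suc k) (Suc i) (prism (Suc k) j a b) l = prism k j (face k i a) (face k i b) l"
    using assms by (cases l) (auto simp: face_def prism_def)
qed

text \<open>The two faces at the jump are mixed tuples without repetition; consecutive prisms share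
  one, so they telescope.\<close>

lemma face_prism_diagonal:
  assumes "j \<le> k"
  shows "face (Suc k) j (prism (Suc k) j a b) = (\<lambda>l\<in>{..<Suc k}. if l < j then a l else b l)"
    and "face (Suc k) (Suc j) (prism (Suc k) j a b) = (\<lambda>l\<in>{..<Suc k}. if l < Suc j then a l else b l)"
  using assms by (auto simp: face_def prism_def fun_eq_iff)

definition prism_sum :: "nat \<Rightarrow> ((nat \<Rightarrow> 'a) \<Rightarrow> real) \<Rightarrow> (nat \<Rightarrow> 'a) \<Rightarrow> (nat \<Rightarrow> 'a) \<Rightarrow> real" where
  "prism_sum n f a b = (\<Sum>j<n. (- 1) ^ j * f (prism n j a b))"

text \<open>Faces away from the jump cancel against the first sum; faces at the jump telescope from
  \<open>b\<close>, where no entry comes from \<open>a\<close>, to \<open>a\<close>.\<close>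

lemma prism_identity:
  assumes a: "a \<in> {..<Suc k} \<rightarrow>\<^sub>E UNIV" and b: "b \<in> {..<Suc k} \<rightarrow>\<^sub>E UNIV"
  shows "(\<Sum>i\<le>k. (- 1) ^ i * prism_sum k f (face k i a) (face k i b))
    + prism_sum (Suc k) (differential (Suc k) f) a b = f b - f a"
proof -
  define g where "g i j = f (prism k j (face k i a) (face k i b))" for i j
  define c where "c j = f (\<lambda>l\<in>{..<Suc k}. if l < j then a l else b l)" for j
  have diff: "(- 1) ^ j * differential (Suc k) f (prism (Suc k) j a b) =
      (c j - c (Suc j)) + (\<Sum>i<j. (- 1) ^ (i + j) * g i (j - 1)) - (\<Sum>i\<in>{j<..k}. (- 1) ^ (i + j) * g i j)"
    if j: "j < Suc k" for j
  proof -
    let ?h = "\<lambda>i. (- 1) ^ (i + j) * f (face (Suc k) i (prism (Suc k) j a b))"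
    have "(- 1) ^ j * differential (Suc k) f (prism (Suc k) j a b) = (\<Sum>i\<le>Suc k. ?h i)"
      by (simp add: differential_def sum_distrib_left power_add ac_simps del: sum.atMost_Suc)
    also have "{..Suc k} = {..<j} \<union> ({j, Suc j} \<union> Suc ` {j<..k})"
    proof (intro equalityI subsetI)
      fix i assume i: "i \<in> {..Suc k}"
      show "i \<in> {..<j} \<union> ({j, Suc j} \<union> Suc ` {j<..k})"
      proof (cases "i \<le> Suc j")
        case False
        then have "i = Suc (i - 1)" "i - 1 \<in> {j<..k}" using i by auto
        then show ?thesis by blast
      qed auto
    qed (use j in auto)
    also have "(\<Sum>i\<in>\<dots>. ?h i) = (\<Sum>i<j. ?h i) + ((?h j + ?h (Suc j)) + (\<Sum>i\<in>Suc ` {j<..k}. ?h i))"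
    proof -
      have "(\<Sum>i\<in>{..<j} \<union> ({j, Suc j} \<union> Suc ` {j<..k}). ?h i)
        = (\<Sum>i<j. ?h i) + (\<Sum>i\<in>{j, Suc j} \<union> Suc ` {j<..k}. ?h i)"
        by (rule sum.union_disjoint) auto
      also have "(\<Sum>i\<in>{j, Suc j} \<union> Suc ` {j<..k}. ?h i)
        = (\<Sum>i\<in>{j, Suc j}. ?h i) + (\<Sum>i\<in>Suc ` {j<..k}. ?h i)"
        by (rule sum.union_disjoint) auto
      finally show ?thesis by simp
    qed
    also have "?h j + ?h (Suc j) = c j - c (Suc j)"
      using face_prism_diagonal[of j k a b] j by (simp add: c_def power_add[symmetric] flip: mult_2)
    also have "(\<Sum>i<j. ?h i) = (\<Sum>i<j. (- 1) ^ (i + j) * g i (j - 1))"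
      using j by (intro sum.cong refl) (simp add: face_prism_less g_def)
    also have "(\<Sum>i\<in>Suc ` {j<..k}. ?h i) = (\<Sum>i\<in>{j<..k}. - ((- 1) ^ (i + j) * g i j))"
      by (subst sum.reindex) (auto simp: face_prism_greater g_def intro!: sum.cong)
    finally show ?thesis by (simp add: sum_negf)
  qed
  have "prism_sum (Suc k) (differential (Suc k) f) a b = (\<Sum>j<Suc k. c j - c (Suc j))
      + (\<Sum>j<Suc k. \<Sum>i<j. (- 1) ^ (i + j) * g i (j - 1))
      - (\<Sum>j<Suc k. \<Sum>i\<in>{j<..k}. (- 1) ^ (i + j) * g i j)"
    unfolding prism_sum_def using diff by (simp add: sum.distrib sum_subtractf del: sum.lessThan_Suc)
  also have "(\<Sum>j<Suc k. c j - c (Suc j)) = c 0 - c (Suc k)"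
    by (rule sum_lessThan_telescope')
  \<comment> \<open>The term \<open>j = 0\<close> is empty. Shifting \<open>j\<close> by one turns
    \<open>g i (j - 1)\<close> into \<open>g i j\<close> and reverses the sign, so that it joins the
    other half.\<close>
  also have "(\<Sum>j<Suc k. \<Sum>i<j. (- 1) ^ (i + j) * g i (j - 1)) = (\<Sum>j<k. \<Sum>i\<le>j. - ((- 1) ^ (i + j) * g i j))"
    by (subst sum.lessThan_Suc_shift) (simp add: lessThan_Suc_atMost)
  \<comment> \<open>The term \<open>j = k\<close> is an empty sum.\<close>
  also have "(\<Sum>j<Suc k. \<Sum>i\<in>{j<..k}. (- 1) ^ (i + j) * g i j) = (\<Sum>j<k. \<Sum>i\<in>{j<..k}. (- 1) ^ (i + j) * g i j)"
    by simp
  also have "c 0 - c (Suc k) + (\<Sum>j<k. \<Sum>i\<le>j. - ((- 1) ^ (i + j) * g i j))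
      - (\<Sum>j<k. \<Sum>i\<in>{j<..k}. (- 1) ^ (i + j) * g i j)
    = c 0 - c (Suc k) - (\<Sum>j<k. (\<Sum>i\<le>j. (- 1) ^ (i + j) * g i j) + (\<Sum>i\<in>{j<..k}. (- 1) ^ (i + j) * g i j))"
    by (simp add: sum_negf sum.distrib)
  also have "(\<Sum>j<k. (\<Sum>i\<le>j. (- 1) ^ (i + j) * g i j) + (\<Sum>i\<in>{j<..k}. (- 1) ^ (i + j) * g i j))
    = (\<Sum>j<k. \<Sum>i\<le>k. (- 1) ^ (i + j) * g i j)"
  proof (intro sum.cong refl)
    fix j assume "j \<in> {..<k}"
    then have "{..k} = {..j} \<union> {j<..k}" by auto
    then show "(\<Sum>i\<le>j. (- 1) ^ (i + j) * g i j) + (\<Sum>i\<in>{j<..k}. (- 1) ^ (i + j) * g i j)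
      = (\<Sum>i\<le>k. (- 1) ^ (i + j) * g i j)"
      by (simp add: sum.union_disjoint[symmetric] Int_def)
  qed
  also have "\<dots> = (\<Sum>i\<le>k. (- 1) ^ i * prism_sum k f (face k i a) (face k i b))"
    unfolding prism_sum_def
    by (subst sum.swap) (simp add: g_def sum_distrib_left power_add ac_simps)
  finally have "prism_sum (Suc k) (differential (Suc k) f) a b
    = c 0 - c (Suc k) - (\<Sum>i\<le>k. (- 1) ^ i * prism_sum k f (face k i a) (face k i b))" .
  moreover have "c 0 = f b" "c (Suc k) = f a"
    using a b by (auto simp: c_def PiE_iff extensional_def intro!: arg_cong[where f = f])
  ultimately show ?thesis by simp
qed

section \<open>Powers of the Haar measure\<close>

lemma face_mem_PiE:
  assumes "i \<le> n" "t \<in> {..<Suc n} \<rightarrow>\<^sub>E A" shows "face n i t \<in> {..<n} \<rightarrow>\<^sub>E A"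
  using assms by (auto simp: face_def PiE_iff)

lemma prism_mem_PiE:
  assumes "j < n" "a \<in> {..<n} \<rightarrow>\<^sub>E A" "b \<in> {..<n} \<rightarrow>\<^sub>E A" shows "prism n j a b \<in> {..<Suc n} \<rightarrow>\<^sub>E A"
  using assms by (auto simp: prism_def PiE_iff)

lemma measurable_face [measurable]:
  assumes "i \<le> n" shows "face n i \<in> PiM {..<Suc n} (\<lambda>_. M) \<rightarrow>\<^sub>M PiM {..<n} (\<lambda>_. M)"
proof -
  have "(\<lambda>t. \<lambda>j\<in>{..<n}. if j < i then t j else t (Suc j)) \<in> PiM {..<Suc n} (\<lambda>_. M) \<rightarrow>\<^sub>M PiM {..<n} (\<lambda>_. M)"
    by (rule measurable_restrict) (auto intro: measurable_component_singleton)
  then show ?thesis unfolding face_def[abs_def] .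
qed

context hull_system
begin

abbreviation m_pow :: "nat \<Rightarrow> (nat \<Rightarrow> 'g) measure" where
  "m_pow n \<equiv> PiM {..<n} (\<lambda>_. m)"

text \<open>A probability measure with the null sets of Haar measure, since \<open>w\<close> is
  positive.\<close>

definition W :: "'g measure" where
  "W = density m (\<lambda>g. ennreal (w g))"

abbreviation W_pow :: "nat \<Rightarrow> (nat \<Rightarrow> 'g) measure" where
  "W_pow n \<equiv> PiM {..<n} (\<lambda>_. W)"

lemma sets_W [measurable_cong]: "sets W = sets borel"
  by (simp add: W_def sets_m)

lemma space_W [simp]: "space W = UNIV"
  by (simp add: W_def)

lemma prob_W: "prob_space W"
proof
  have "emeasure W UNIV = (\<integral>\<^sup>+ g. ennreal (w g) * indicator UNIV g \<partial>m)"
    unfolding W_def using sets.top[of m] by (intro emeasure_density) auto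
  then show "emeasure W (space W) = 1" by (simp add: w_integral)
qed

sublocale W: prob_space W by (rule prob_W)
sublocale mp: product_sigma_finite "\<lambda>_::nat. m" ..
sublocale Wp: product_prob_space "\<lambda>_::nat. W" ..

lemma prob_W_pow: "prob_space (W_pow n)"
  by (intro prob_space_PiM prob_W)

lemma sets_m_pow: "sets (m_pow n) = sets (PiM {..<n} (\<lambda>_. borel))"
  by (intro sets_PiM_cong refl sets_m)

lemma sets_W_pow: "sets (W_pow n) = sets (PiM {..<n} (\<lambda>_. borel))"
  by (intro sets_PiM_cong refl sets_W)

lemma space_m_pow [simp]: "space (m_pow n) = tuples n"
  by (simp add: space_PiM)

lemma space_W_pow [simp]: "space (W_pow n) = tuples n"
  by (simp add: space_PiM)

text \<open>Both measures agree on boxes, over which the integral of the product density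
  factorises.\<close>

lemma W_pow_density: "W_pow n = density (m_pow n) (\<lambda>s. \<Prod>i<n. ennreal (w (s i)))"
proof (rule Wp.PiM_eqI[symmetric])
  show "sets (density (m_pow n) (\<lambda>s. \<Prod>i<n. ennreal (w (s i)))) = sets (W_pow n)"
    by (simp add: sets_m_pow sets_W_pow)
  fix A :: "nat \<Rightarrow> 'g set" assume A: "\<And>i. i \<in> {..<n} \<Longrightarrow> A i \<in> sets W"
  then have A': "\<And>i. i < n \<Longrightarrow> A i \<in> sets m" by (simp add: sets_W sets_m)
  have PA: "Pi\<^sub>E {..<n} A \<in> sets (m_pow n)" using A' by (intro sets_PiM_I_finite) auto
  have meas: "(\<lambda>s. \<Prod>i<n. ennreal (w (s i))) \<in> borel_measurable (m_pow n)"
    by measurable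
  have "emeasure (density (m_pow n) (\<lambda>s. \<Prod>i<n. ennreal (w (s i)))) (Pi\<^sub>E {..<n} A)
    = (\<integral>\<^sup>+ s. (\<Prod>i<n. ennreal (w (s i))) * indicator (Pi\<^sub>E {..<n} A) s \<partial>m_pow n)"
    by (rule emeasure_density[OF meas PA])
  also have "\<dots> = (\<integral>\<^sup>+ s. (\<Prod>i<n. ennreal (w (s i)) * indicator (A i) (s i)) \<partial>m_pow n)"
  proof (rule nn_integral_cong)
    fix s assume s: "s \<in> space (m_pow n)"
    have "indicator (Pi\<^sub>E {..<n} A) s = (\<Prod>i<n. indicator (A i) (s i) :: ennreal)"
    proof (cases "s \<in> Pi\<^sub>E {..<n} A")
      case True
      then show ?thesis by (auto simp: PiE_iff)
    next
      case False
      then obtain i where "i < n" "s i \<notin> A i" using s by (auto simp: PiE_iff)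
      then have "(\<Prod>i<n. indicator (A i) (s i) :: ennreal) = 0" by (intro prod_zero) (auto intro!: bexI[of _ i])
      then show ?thesis using False by simp
    qed
    then show "(\<Prod>i<n. ennreal (w (s i))) * indicator (Pi\<^sub>E {..<n} A) s
      = (\<Prod>i<n. ennreal (w (s i)) * indicator (A i) (s i))" by (simp add: prod.distrib)
  qed
  also have "\<dots> = (\<Prod>i<n. \<integral>\<^sup>+ g. ennreal (w g) * indicator (A i) g \<partial>m)"
    using A' by (intro mp.product_nn_integral_prod) auto
  also have "\<dots> = (\<Prod>i<n. emeasure W (A i))"
    unfolding W_def using A' by (intro prod.cong refl) (simp add: emeasure_density)
  finally show "emeasure (density (m_pow n) (\<lambda>s. \<Prod>i<n. ennreal (w (s i)))) (Pi\<^sub>E {..<n} A)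
    = (\<Prod>i<n. emeasure W (A i))" .
qed simp

text \<open>A finite product of positive densities is positive, so the powers are equivalent as
  well.\<close>

lemma AE_W_pow: "(AE s in W_pow n. \<Phi> s) \<longleftrightarrow> (AE s in m_pow n. \<Phi> s)"
proof -
  have "(\<lambda>s. \<Prod>i<n. ennreal (w (s i))) \<in> borel_measurable (m_pow n)" by measurable
  moreover have "0 < (\<Prod>i<n. ennreal (w (s i)))" for s
    by (simp add: zero_less_iff_neq_zero prod_zero_iff ennreal_eq_0_iff w_pos not_le)
  ultimately show ?thesis unfolding W_pow_density by (simp add: AE_density)
qed

lemma translate_measurable:
  "(\<lambda>s. \<lambda>i\<in>{..<n}. t i + s i) \<in> m_pow n \<rightarrow>\<^sub>M m_pow n"
  by (rule measurable_restrict) measurable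

lemma distr_translate: "distr (m_pow n) (m_pow n) (\<lambda>s. \<lambda>i\<in>{..<n}. t i + s i) = m_pow n"
proof (rule mp.PiM_eqI)
  fix A :: "nat \<Rightarrow> 'g set" assume A: "\<And>i. i \<in> {..<n} \<Longrightarrow> A i \<in> sets m"
  have tA: "(\<lambda>g. t i + g) -` A i \<in> sets m" if "i < n" for i
    using A[of i] that measurable_sets[of "\<lambda>g. t i + g" borel borel "A i"] by (simp add: sets_m)
  have em: "emeasure m ((\<lambda>g. t i + g) -` A i) = emeasure m (A i)" if "i < n" for i
  proof -
    have "emeasure m (A i) = emeasure (distr m borel (\<lambda>x. t i + x)) (A i)"
      using haar by (simp add: haar_measure_def)
    also have "\<dots> = emeasure m ((\<lambda>g. t i + g) -` A i)"
      using A[of i] that by (subst emeasure_distr) (auto simp: sets_m)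
    finally show ?thesis ..
  qed
  have "(\<lambda>s. \<lambda>i\<in>{..<n}. t i + s i) -` Pi\<^sub>E {..<n} A \<inter> space (m_pow n)
    = Pi\<^sub>E {..<n} (\<lambda>i. (\<lambda>g. t i + g) -` A i)"
    by (auto simp: PiE_iff)
  then have "emeasure (distr (m_pow n) (m_pow n) (\<lambda>s. \<lambda>i\<in>{..<n}. t i + s i)) (Pi\<^sub>E {..<n} A)
    = emeasure (m_pow n) (Pi\<^sub>E {..<n} (\<lambda>i. (\<lambda>g. t i + g) -` A i))"
    using A by (subst emeasure_distr[OF translate_measurable]) (auto intro!: sets_PiM_I_finite)
  also have "\<dots> = (\<Prod>i<n. emeasure m ((\<lambda>g. t i + g) -` A i))"
    using tA by (intro mp.emeasure_PiM) auto
  also have "\<dots> = (\<Prod>i<n. emeasure m (A i))" using em by (intro prod.cong refl) simp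
  finally show "emeasure (distr (m_pow n) (m_pow n) (\<lambda>s. \<lambda>i\<in>{..<n}. t i + s i)) (Pi\<^sub>E {..<n} A)
    = (\<Prod>i\<in>{..<n}. emeasure m (A i))" .
qed simp_all

text \<open>Valid for each individual \<open>t\<close>: the entries \<open>t i + s i\<close> are
  left translates of \<open>s i\<close>, so their joint law is absolutely continuous with respect to
  the Haar power. This is the source of values at every tuple.\<close>

lemma AE_translate:
  assumes "AE s in m_pow n. \<Phi> s" shows "AE s in W_pow n. \<Phi> (\<lambda>i\<in>{..<n}. t i + s i)"
proof -
  have "AE s in distr (m_pow n) (m_pow n) (\<lambda>s. \<lambda>i\<in>{..<n}. t i + s i). \<Phi> s"
    unfolding distr_translate by (rule assms)
  then show ?thesis unfolding AE_W_pow by (rule AE_distrD[OF translate_measurable])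
qed

lemma distr_W_pow_reindex:
  assumes "inj_on f I" "f \<in> I \<rightarrow> K"
  shows "distr (PiM K (\<lambda>_. W)) (PiM I (\<lambda>_. W)) (\<lambda>\<omega>. \<lambda>l\<in>I. \<omega> (f l)) = PiM I (\<lambda>_. W)"
  using distr_PiM_reindex[of K "\<lambda>_. W" f I] assms prob_W by simp

lemma reindex_measurable:
  "f \<in> I \<rightarrow> K \<Longrightarrow> (\<lambda>\<omega>. \<lambda>l\<in>I. \<omega> (f l)) \<in> PiM K (\<lambda>_. W) \<rightarrow>\<^sub>M PiM I (\<lambda>_. W)"
  by (rule measurable_restrict) (auto intro: measurable_component_singleton)

text \<open>Forgetting a coordinate preserves the law because each factor has total mass 1, which a
  Haar measure need not have.\<close>

lemma distr_face:
  assumes "i \<le> n" shows "distr (W_pow (Suc n)) (W_pow n) (face n i) = W_pow n"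
proof -
  have "distr (W_pow (Suc n)) (W_pow n) (\<lambda>\<omega>. \<lambda>l\<in>{..<n}. \<omega> (if l < i then l else Suc l)) = W_pow n"
    by (rule distr_W_pow_reindex) (auto simp: inj_on_def split: if_splits)
  moreover have "(\<lambda>\<omega>. \<lambda>l\<in>{..<n}. \<omega> (if l < i then l else Suc l)) = (face n i :: (nat \<Rightarrow> 'g) \<Rightarrow> _)"
    by (auto simp: face_def fun_eq_iff)
  ultimately show ?thesis by simp
qed

lemma AE_face:
  assumes "i \<le> n" "AE s in m_pow n. \<Phi> s" shows "AE s in m_pow (Suc n). \<Phi> (face n i s)"
proof -
  have "AE s in distr (W_pow (Suc n)) (W_pow n) (face n i). \<Phi> s"
    unfolding distr_face[OF assms(1)] AE_W_pow by (rule assms(2))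
  then show ?thesis
    unfolding AE_W_pow[symmetric] by (rule AE_distrD[OF measurable_face[OF assms(1)]])
qed

lemma integral_face:
  fixes G :: "(nat \<Rightarrow> 'g) \<Rightarrow> real"
  assumes "i \<le> n" "G \<in> borel_measurable (W_pow n)"
  shows "(\<integral>s. G (face n i s) \<partial>W_pow (Suc n)) = (\<integral>s. G s \<partial>W_pow n)"
  using integral_distr[OF measurable_face[OF assms(1)] assms(2), unfolded distr_face[OF assms(1)]] by simp

text \<open>A prism selects \<open>n + 1\<close> distinct coordinates among the \<open>2n\<close>
  independent coordinates of the pair \<open>(a, b)\<close>, so its law is again a power of
  \<open>W\<close>.\<close>

lemma AE_prism:
  assumes j: "j < n" and AE: "AE u in m_pow (Suc n). \<Phi> u"
  shows "AE a in m_pow n. AE b in m_pow n. \<Phi> (prism n j a b)"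
proof -
  \<comment> \<open>The second tuple is stored at indices \<open>n, ..., 2n - 1\<close>. Positions
    after \<open>j\<close> read its entry \<open>l - 1\<close>, as in \<open>prism\<close>.\<close>
  let ?f = "\<lambda>l. if l \<le> j then l else n + (l - 1)"
  let ?J = "{n..<n + n}"
  have un: "{..<n} \<union> ?J = {..<n + n}" by auto
  interpret pair_sigma_finite "W_pow n" "PiM ?J (\<lambda>_. W)"
    by (intro pair_sigma_finite.intro prob_space_imp_sigma_finite prob_space_PiM prob_W)
  have "AE u in distr (W_pow (n + n)) (W_pow (Suc n)) (\<lambda>\<omega>. \<lambda>l\<in>{..<Suc n}. \<omega> (?f l)). \<Phi> u"
    using AE by (subst distr_W_pow_reindex) (use j in \<open>auto simp: inj_on_def AE_W_pow split: if_splits\<close>)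
  then have "AE \<omega> in PiM ({..<n} \<union> ?J) (\<lambda>_. W). \<Phi> (\<lambda>l\<in>{..<Suc n}. \<omega> (?f l))"
    unfolding un by (rule AE_distrD[rotated]) (rule reindex_measurable, use j in auto)
  then have "AE p in W_pow n \<Otimes>\<^sub>M PiM ?J (\<lambda>_. W). \<Phi> (\<lambda>l\<in>{..<Suc n}. merge {..<n} ?J p (?f l))"
    by (subst (asm) Wp.distr_merge[symmetric]) (auto elim!: AE_distrD[rotated] intro: measurable_merge)
  from AE_pair[OF this]
  have J: "AE a in W_pow n. AE b in PiM ?J (\<lambda>_. W). \<Phi> (\<lambda>l\<in>{..<Suc n}. merge {..<n} ?J (a, b) (?f l))" .
  have "AE a in W_pow n. AE b in W_pow n. \<Phi> (prism n j a b)"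
  proof (rule AE_mp[OF J AE_I2[OF impI]])
    fix a
    \<comment> \<open>Relabels the second block by \<open>{..<n}\<close> again.\<close>
    let ?r = "\<lambda>s. \<lambda>l\<in>?J. s (l - n)"
    assume "AE b in PiM ?J (\<lambda>_. W). \<Phi> (\<lambda>l\<in>{..<Suc n}. merge {..<n} ?J (a, b) (?f l))"
    then have "AE b in distr (W_pow n) (PiM ?J (\<lambda>_. W)) ?r.
        \<Phi> (\<lambda>l\<in>{..<Suc n}. merge {..<n} ?J (a, b) (?f l))"
      by (subst distr_W_pow_reindex) (auto simp: inj_on_def)
    then have *: "AE b in W_pow n. \<Phi> (\<lambda>l\<in>{..<Suc n}. merge {..<n} ?J (a, ?r b) (?f l))"
      by (rule AE_distrD[rotated]) (rule reindex_measurable, auto)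
    have "(\<lambda>l\<in>{..<Suc n}. merge {..<n} ?J (a, ?r b) (?f l)) = prism n j a b" for b
      using j by (auto simp: prism_def merge_def fun_eq_iff)
    with * show "AE b in W_pow n. \<Phi> (prism n j a b)" by simp
  qed
  then show ?thesis unfolding AE_W_pow .
qed

section \<open>Fubini for the cochain measures\<close>

lemma sets_cochain_measure: "sets (cochain_measure m \<mu> n) = sets (PiM {..<n} (\<lambda>_. borel) \<Otimes>\<^sub>M hull_borel P)"
  unfolding cochain_measure_def by (intro sets_pair_measure_cong sets_m_pow sets_mu)

lemma space_cochain_measure [simp]:
  "space (cochain_measure m \<mu> n) = tuples n \<times> pattern_hull P"
  by (simp add: cochain_measure_def space_pair_measure)

lemma pair_sigma_finite_cochain: "pair_sigma_finite (m_pow n) \<mu>"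
  by (intro pair_sigma_finite.intro mp.sigma_finite prob_space_imp_sigma_finite prob_mu) simp

lemma AE_cochain_D:
  assumes "AE p in cochain_measure m \<mu> n. \<Psi> p"
  shows "AE x in \<mu>. AE t in m_pow n. \<Psi> (t, x)"
proof -
  interpret mn: pair_sigma_finite "m_pow n" \<mu> by (rule pair_sigma_finite_cochain)
  interpret nm: pair_sigma_finite \<mu> "m_pow n" ..
  have "AE p in distr (\<mu> \<Otimes>\<^sub>M m_pow n) (m_pow n \<Otimes>\<^sub>M \<mu>) (\<lambda>(x, y). (y, x)). \<Psi> p"
    using assms unfolding cochain_measure_def by (subst mn.distr_pair_swap[symmetric])
  from nm.AE_pair[OF AE_distrD[OF measurable_pair_swap' this]] show ?thesis by simp
qed

text \<open>This direction of Fubini needs a measurable set. It is applied to complements of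
  measurable null sets or to equality of two Borel functions.\<close>

lemma AE_cochain_I:
  assumes AE: "AE x in \<mu>. AE t in m_pow n. \<Psi> (t, x)"
    and meas: "{p \<in> space (cochain_measure m \<mu> n). \<Psi> p} \<in> sets (cochain_measure m \<mu> n)"
  shows "AE p in cochain_measure m \<mu> n. \<Psi> p"
proof -
  interpret mn: pair_sigma_finite "m_pow n" \<mu> by (rule pair_sigma_finite_cochain)
  have "(AE t in m_pow n. AE x in \<mu>. \<Psi> (t, x)) \<longleftrightarrow> (AE x in \<mu>. AE t in m_pow n. \<Psi> (t, x))"
    using meas unfolding cochain_measure_def by (intro mn.AE_commute) simp
  with AE have "AE t in m_pow n. AE x in \<mu>. \<Psi> (t, x)" by simp
  with meas show ?thesis unfolding cochain_measure_def by (rule mn.AE_pair_measure)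
qed

end

section \<open>Invariant functions on \<open>G\<^sup>n \<times> X\<close>\<close>

context hull_system
begin

abbreviation BX :: "nat \<Rightarrow> ((nat \<Rightarrow> 'g) \<times> 'g set) measure" where
  "BX n \<equiv> PiM {..<n} (\<lambda>_. borel) \<Otimes>\<^sub>M hull_borel P"

lemma space_BX [simp]: "space (BX n) = tuples n \<times> pattern_hull P"
  by (simp add: space_pair_measure space_PiM)

lemma shift_mem_PiE [simp]: "shift n g t \<in> tuples n"
  by (simp add: shift_def)

text \<open>Borel and invariant at every point, in contrast to \<open>invariant_cochain\<close>,
  where the exceptional null set may depend on the group element.\<close>

definition invariant :: "nat \<Rightarrow> ((nat \<Rightarrow> 'g) \<times> 'g set \<Rightarrow> real) \<Rightarrow> bool" where
  "invariant n F \<longleftrightarrow> F \<in> borel_measurable (BX n) \<and>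
    (\<forall>g. \<forall>t \<in> tuples n. \<forall>x \<in> pattern_hull P. F (shift n g t, act g x) = F (t, x))"

text \<open>The bound holds at every point, so that smearing integrals exist for each individual
  \<open>t\<close> and \<open>x\<close>.\<close>

definition admissible :: "nat \<Rightarrow> ((nat \<Rightarrow> 'g) \<times> 'g set \<Rightarrow> real) \<Rightarrow> bool" where
  "admissible n F \<longleftrightarrow> invariant n F \<and> (\<exists>C. \<forall>t \<in> tuples n. \<forall>x \<in> pattern_hull P. \<bar>F (t, x)\<bar> \<le> C)"

definition dG :: "nat \<Rightarrow> ((nat \<Rightarrow> 'g) \<times> 'g set \<Rightarrow> real) \<Rightarrow> (nat \<Rightarrow> 'g) \<times> 'g set \<Rightarrow> real" where
  "dG n F = (\<lambda>(t, x). differential n (\<lambda>s. F (s, x)) t)"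

definition clamp :: "real \<Rightarrow> ('b \<Rightarrow> real) \<Rightarrow> 'b \<Rightarrow> real" where
  "clamp c F p = max (- c) (min c (F p))"

lemma invariantD:
  "\<lbrakk>invariant n F; t \<in> tuples n; x \<in> pattern_hull P\<rbrakk> \<Longrightarrow> F (shift n g t, act g x) = F (t, x)"
  by (simp add: invariant_def)

lemma invariant_measurable: "invariant n F \<Longrightarrow> F \<in> borel_measurable (BX n)"
  by (simp add: invariant_def)

lemma admissible_invariant: "admissible n F \<Longrightarrow> invariant n F"
  by (simp add: admissible_def)

lemma admissible_measurable: "admissible n F \<Longrightarrow> F \<in> borel_measurable (BX n)"
  by (simp add: admissible_def invariant_def)

lemma admissible_clamp: "invariant n F \<Longrightarrow> 0 \<le> c \<Longrightarrow> admissible n (clamp c F)"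
  unfolding admissible_def invariant_def clamp_def
  by (auto intro!: exI[of _ c])

lemma admissible_add:
  assumes "admissible n F" "admissible n F'" shows "admissible n (\<lambda>p. F p + F' p)"
proof -
  obtain C C' where "\<forall>t \<in> tuples n. \<forall>x \<in> pattern_hull P. \<bar>F (t, x)\<bar> \<le> C"
    "\<forall>t \<in> tuples n. \<forall>x \<in> pattern_hull P. \<bar>F' (t, x)\<bar> \<le> C'"
    using assms by (auto simp: admissible_def)
  then have "\<forall>t \<in> tuples n. \<forall>x \<in> pattern_hull P. \<bar>F (t, x) + F' (t, x)\<bar> \<le> C + C'"
    by (meson abs_triangle_ineq add_mono order_trans)
  then show ?thesis using assms unfolding admissible_def invariant_def by auto
qed

lemma admissible_scale:
  assumes "admissible n F" shows "admissible n (\<lambda>p. c * F p)"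
proof -
  obtain C where "\<forall>t \<in> tuples n. \<forall>x \<in> pattern_hull P. \<bar>F (t, x)\<bar> \<le> C"
    using assms by (auto simp: admissible_def)
  then have "\<forall>t \<in> tuples n. \<forall>x \<in> pattern_hull P. \<bar>c * F (t, x)\<bar> \<le> \<bar>c\<bar> * C"
    by (simp add: abs_mult mult_left_mono)
  then show ?thesis using assms unfolding admissible_def invariant_def by auto
qed

lemma face_shift: "i \<le> n \<Longrightarrow> face n i (shift (Suc n) g t) = shift n g (face n i t)"
  by (auto simp: face_def shift_def fun_eq_iff)

lemma measurable_face_pair:
  assumes "i \<le> n" shows "(\<lambda>(t, x). (face n i t, x)) \<in> BX (Suc n) \<rightarrow>\<^sub>M BX n"
  unfolding case_prod_unfold
  by (intro measurable_Pair measurable_snd measurable_compose[OF measurable_fst measurable_face[OF assms]])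

lemma measurable_dG:
  assumes "F \<in> borel_measurable (BX n)" shows "dG n F \<in> borel_measurable (BX (Suc n))"
proof -
  have "(\<lambda>p. F (face n i (fst p), snd p)) \<in> borel_measurable (BX (Suc n))" if "i \<le> n" for i
    using measurable_compose[OF measurable_face_pair[OF that] assms] by (simp add: case_prod_unfold)
  then show ?thesis
    unfolding dG_def differential_def case_prod_unfold
    by (intro borel_measurable_sum borel_measurable_times borel_measurable_const) auto
qed

lemma admissible_dG:
  assumes F: "admissible n F" shows "admissible (Suc n) (dG n F)"
proof -
  obtain C where C: "\<And>t x. t \<in> tuples n \<Longrightarrow> x \<in> pattern_hull P \<Longrightarrow> \<bar>F (t, x)\<bar> \<le> C"
    using F by (auto simp: admissible_def)
  have "\<bar>dG n F (t, x)\<bar> \<le> (\<Sum>i\<le>n. C)" if "t \<in> tuples (Suc n)" "x \<in> pattern_hull P" for t x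
    unfolding dG_def differential_def prod.case
    using that by (intro order_trans[OF sum_abs] sum_mono) (auto simp: abs_mult intro!: C face_mem_PiE)
  moreover have "dG n F (shift (Suc n) g t, act g x) = dG n F (t, x)"
    if "t \<in> tuples (Suc n)" "x \<in> pattern_hull P" for g t x
    unfolding dG_def differential_def prod.case
    using that F by (intro sum.cong refl arg_cong2[where f = "(*)"])
      (auto simp: face_shift intro!: invariantD admissible_invariant face_mem_PiE)
  ultimately show ?thesis
    using F by (auto simp: admissible_def invariant_def intro!: measurable_dG)
qed

subsection \<open>Invariant representatives\<close>

text \<open>Average of \<open>f\<close> along the diagonal orbit. The weight is anchored at the
  entry \<open>t 0\<close>: moving \<open>(t, x)\<close> by \<open>h\<close> replaces
  \<open>g\<close> by \<open>g + h\<close> throughout, which right invariance undoes.\<close>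

definition strictify :: "nat \<Rightarrow> ((nat \<Rightarrow> 'g) \<times> 'g set \<Rightarrow> real) \<Rightarrow> (nat \<Rightarrow> 'g) \<times> 'g set \<Rightarrow> real" where
  "strictify n f = (\<lambda>(t, x). \<integral>g. f (shift n g t, act g x) * w (g + t 0) \<partial>m)"

lemma measurable_shift_act: "(\<lambda>(g, t, x). (shift n g t, act g x)) \<in> borel \<Otimes>\<^sub>M BX n \<rightarrow>\<^sub>M BX n"
proof -
  have "(\<lambda>p. shift n (fst p) (fst (snd p))) \<in> borel \<Otimes>\<^sub>M BX n \<rightarrow>\<^sub>M PiM {..<n} (\<lambda>_. borel)"
    unfolding shift_def
    by (rule measurable_restrict)
      (intro borel_measurable_add measurable_compose[OF measurable_snd]
        measurable_compose[OF measurable_fst] measurable_component_singleton measurable_fst, simp)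
  moreover have "(\<lambda>p. act (fst p) (snd (snd p))) \<in> borel \<Otimes>\<^sub>M BX n \<rightarrow>\<^sub>M hull_borel P"
    by measurable
  ultimately show ?thesis by (simp add: case_prod_unfold)
qed

lemma integral_right:
  fixes f :: "'g \<Rightarrow> real"
  assumes [measurable]: "f \<in> borel_measurable borel"
  shows "(\<integral>g. f (g + h) \<partial>m) = (\<integral>g. f g \<partial>m)"
proof -
  have "(\<integral>g. f g \<partial>m) = (\<integral>g. f g \<partial>distr m borel (\<lambda>g. g + h))" by (simp add: right_invariant)
  also have "\<dots> = (\<integral>g. f (g + h) \<partial>m)" by (rule integral_distr) measurable
  finally show ?thesis ..
qed

lemma integral_w: "(\<integral>g. w (g + h) \<partial>m) = 1"
proof -
  have "(\<integral>g. w g \<partial>m) = 1"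
    using w_integral w_pos by (subst integral_eq_nn_integral) (auto simp: less_imp_le)
  then show ?thesis by (simp add: integral_right)
qed

lemma invariant_strictify:
  assumes n: "0 < n" and f: "f \<in> borel_measurable (BX n)"
  shows "invariant n (strictify n f)"
  unfolding invariant_def
proof (intro conjI allI ballI)
  have 1: "(\<lambda>q. f (shift n (fst q) (fst (snd q)), act (fst q) (snd (snd q)))) \<in> borel_measurable (borel \<Otimes>\<^sub>M BX n)"
    using measurable_compose[OF measurable_shift_act f] by (simp add: case_prod_unfold)
  have 0: "(\<lambda>q::'g \<times> (nat \<Rightarrow> 'g) \<times> 'g set. fst (snd q) 0) \<in> borel_measurable (borel \<Otimes>\<^sub>M BX n)"
    using n by (intro measurable_compose[OF measurable_snd] measurable_compose[OF measurable_fst]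
        measurable_component_singleton) simp
  have 2: "(\<lambda>q. f (shift n (fst q) (fst (snd q)), act (fst q) (snd (snd q))) * w (fst q + fst (snd q) 0))
      \<in> borel_measurable (m \<Otimes>\<^sub>M BX n)"
    using 1 0 by measurable
  then have 2: "(\<lambda>(p, g). f (shift n g (fst p), act g (snd p)) * w (g + fst p 0)) \<in> borel_measurable (BX n \<Otimes>\<^sub>M m)"
    by (subst measurable_pair_swap_iff) (simp add: case_prod_unfold)
  from m.borel_measurable_lebesgue_integral[OF this]
  show "strictify n f \<in> borel_measurable (BX n)" by (simp add: strictify_def case_prod_unfold)
  fix h t x assume t: "t \<in> tuples n" and x: "x \<in> pattern_hull P"
  have "(\<lambda>g. (g, t, x)) \<in> borel \<rightarrow>\<^sub>M borel \<Otimes>\<^sub>M BX n"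
    using t x by (intro measurable_Pair measurable_const measurable_ident) (auto simp: space_PiM)
  from measurable_compose[OF this measurable_compose[OF measurable_shift_act f]]
  have [measurable]: "(\<lambda>g. f (shift n g t, act g x)) \<in> borel_measurable borel" by simp
  have "strictify n f (shift n h t, act h x) = (\<integral>g. f (shift n (g + h) t, act (g + h) x) * w (g + h + t 0) \<partial>m)"
    using n by (simp add: strictify_def shift_shift act_act) (simp add: shift_def add.assoc)
  also have "\<dots> = strictify n f (t, x)"
    using integral_right[of "\<lambda>g. f (shift n g t, act g x) * w (g + t 0)" h] by (simp add: strictify_def)
  finally show "strictify n f (shift n h t, act h x) = strictify n f (t, x)" .
qed

lemma measurable_cochain_iff: "f \<in> cochain_measure m \<mu> n \<rightarrow>\<^sub>M N \<longleftrightarrow> f \<in> BX n \<rightarrow>\<^sub>M N"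
  by (rule arg_cong[where f = "\<lambda>S. f \<in> S"]) (rule measurable_cong_sets[OF sets_cochain_measure refl])

lemma sigma_finite_cochain: "sigma_finite_measure (cochain_measure m \<mu> n)"
proof -
  interpret mn: pair_sigma_finite "m_pow n" \<mu> by (rule pair_sigma_finite_cochain)
  show ?thesis unfolding cochain_measure_def ..
qed

text \<open>For each \<open>g\<close> the equation holds at almost every \<open>p\<close>; by Fubini
  it holds at almost every \<open>p\<close> for almost every \<open>g\<close>, and then the
  integrand is \<open>f p\<close> times a density of total mass 1.\<close>

lemma strictify_AE:
  assumes n: "0 < n" and f: "f \<in> borel_measurable (BX n)" and inv: "invariant_cochain m act \<mu> n f"
  shows "AE p in cochain_measure m \<mu> n. strictify n f p = f p"
proof -
  let ?M = "cochain_measure m \<mu> n"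
  interpret mM: pair_sigma_finite m ?M
    by (intro pair_sigma_finite.intro sigma_finite sigma_finite_cochain)
  have meas: "(\<lambda>q. f (shift n (fst q) (fst (snd q)), act (fst q) (snd (snd q)))) \<in> borel_measurable (m \<Otimes>\<^sub>M ?M)"
    using measurable_compose[OF measurable_shift_act f]
    by (subst measurable_cong_sets[OF sets_pair_measure_cong[OF sets_m sets_cochain_measure] refl])
      (simp add: case_prod_unfold)
  have meas2: "(\<lambda>q. f (snd q)) \<in> borel_measurable (m \<Otimes>\<^sub>M ?M)"
    using f by (intro measurable_compose[OF measurable_snd]) (simp add: measurable_cochain_iff)
  have "AE g in m. AE p in ?M. f (shift n g (fst p), act g (snd p)) = f p"
    using inv by (intro AE_I2[where M = m]) (simp add: invariant_cochain_def shift_def case_prod_unfold)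
  then have "AE p in ?M. AE g in m. f (shift n g (fst p), act g (snd p)) = f p"
    using meas meas2 by (subst mM.AE_commute[symmetric]) auto
  then show ?thesis
  proof (rule AE_mp[OF _ AE_I2[OF impI]])
    fix p assume p: "p \<in> space ?M" and AE: "AE g in m. f (shift n g (fst p), act g (snd p)) = f p"
    obtain t x where tx: "p = (t, x)" "t \<in> tuples n" "x \<in> pattern_hull P"
      using p by auto
    have "(\<lambda>g. (g, t, x)) \<in> borel \<rightarrow>\<^sub>M borel \<Otimes>\<^sub>M BX n"
      using tx by (intro measurable_Pair measurable_const measurable_ident) (auto simp: space_PiM)
    from measurable_compose[OF this measurable_compose[OF measurable_shift_act f]]
    have [measurable]: "(\<lambda>g. f (shift n g t, act g x)) \<in> borel_measurable borel" by simp
    have "strictify n f p = (\<integral>g. f p * w (g + t 0) \<partial>m)"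
      unfolding strictify_def tx(1) prod.case
      using AE by (intro integral_cong_AE) (auto simp: tx elim!: eventually_mono)
    also have "\<dots> = f p" by (simp add: integral_w)
    finally show "strictify n f p = f p" .
  qed
qed

text \<open>For a cochain \<open>f\<close>, truncation at its essential supremum changes the average
  only on a null set and yields a bound at every point.\<close>

definition regularize :: "nat \<Rightarrow> ((nat \<Rightarrow> 'g) \<times> 'g set \<Rightarrow> real) \<Rightarrow> (nat \<Rightarrow> 'g) \<times> 'g set \<Rightarrow> real" where
  "regularize n f = clamp (snorm (ess_bounded (cochain_measure m \<mu> n)) f) (strictify n f)"

lemma clamp_eq: "\<bar>F p\<bar> \<le> c \<Longrightarrow> clamp c F p = F p"
  by (simp add: clamp_def)

lemma carr_cochain_measurable:
  "f \<in> carr (ess_bounded (cochain_measure m \<mu> n)) \<Longrightarrow> f \<in> borel_measurable (BX n)"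
  by (simp add: ess_bounded_def measurable_cochain_iff)

lemma admissible_regularize:
  assumes "0 < n" "f \<in> carr (ess_bounded (cochain_measure m \<mu> n))"
  shows "admissible n (regularize n f)"
  unfolding regularize_def
  by (intro admissible_clamp invariant_strictify assms carr_cochain_measurable snorm_ess_bounded_nonneg)

lemma regularize_AE:
  assumes "0 < n" "f \<in> carr (ess_bounded (cochain_measure m \<mu> n))" "invariant_cochain m act \<mu> n f"
  shows "AE p in cochain_measure m \<mu> n. regularize n f p = f p"
proof -
  have "AE p in cochain_measure m \<mu> n. \<bar>f p\<bar> \<le> snorm (ess_bounded (cochain_measure m \<mu> n)) f"
    using snorm_ess_bounded_le_iff[OF assms(2) snorm_ess_bounded_nonneg] by blast
  with strictify_AE[OF assms(1) carr_cochain_measurable[OF assms(2)] assms(3)] show ?thesis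
    by eventually_elim (simp add: regularize_def clamp_eq)
qed

subsection \<open>Smearing along equivariant kernels\<close>

text \<open>A rule replacing one entry \<open>t\<close> of a tuple by another, using a random
  variable \<open>s\<close> and the pattern. The pattern moves along with \<open>t\<close> while
  \<open>s\<close> stays fixed, so smearing preserves strict invariance.\<close>

definition equivariant_kernel :: "('g \<Rightarrow> 'g \<Rightarrow> 'g set \<Rightarrow> 'g) \<Rightarrow> bool" where
  "equivariant_kernel \<kappa> \<longleftrightarrow> (\<lambda>(t, s, x). \<kappa> t s x) \<in> borel_measurable (borel \<Otimes>\<^sub>M borel \<Otimes>\<^sub>M hull_borel P) \<and>
    (\<forall>g t s. \<forall>x \<in> pattern_hull P. \<kappa> (g + t) s (act g x) = g + \<kappa> t s x)"

definition kernel_tuple ::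
  "nat \<Rightarrow> ('g \<Rightarrow> 'g \<Rightarrow> 'g set \<Rightarrow> 'g) \<Rightarrow> (nat \<Rightarrow> 'g) \<Rightarrow> (nat \<Rightarrow> 'g) \<Rightarrow> 'g set \<Rightarrow> nat \<Rightarrow> 'g" where
  "kernel_tuple n \<kappa> t s x = (\<lambda>i\<in>{..<n}. \<kappa> (t i) (s i) x)"

definition smear ::
  "nat \<Rightarrow> ('g \<Rightarrow> 'g \<Rightarrow> 'g set \<Rightarrow> 'g) \<Rightarrow> ((nat \<Rightarrow> 'g) \<times> 'g set \<Rightarrow> real) \<Rightarrow> (nat \<Rightarrow> 'g) \<times> 'g set \<Rightarrow> real" where
  "smear n \<kappa> F = (\<lambda>(t, x). \<integral>s. F (kernel_tuple n \<kappa> t s x, x) \<partial>W_pow n)"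

text \<open>The expected prism between \<open>t\<close> and its randomised version; it lowers the
  number of entries by one.\<close>

definition smear_homotopy ::
  "nat \<Rightarrow> ('g \<Rightarrow> 'g \<Rightarrow> 'g set \<Rightarrow> 'g) \<Rightarrow> ((nat \<Rightarrow> 'g) \<times> 'g set \<Rightarrow> real) \<Rightarrow> (nat \<Rightarrow> 'g) \<times> 'g set \<Rightarrow> real" where
  "smear_homotopy n \<kappa> F = (\<lambda>(t, x). \<integral>s. prism_sum n (\<lambda>u. F (u, x)) t (kernel_tuple n \<kappa> t s x) \<partial>W_pow n)"

lemma kernel_tuple_mem [simp]: "kernel_tuple n \<kappa> t s x \<in> tuples n"
  by (simp add: kernel_tuple_def)

lemma kernel_tuple_shift:
  "equivariant_kernel \<kappa> \<Longrightarrow> x \<in> pattern_hull P \<Longrightarrow>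
    kernel_tuple n \<kappa> (shift n g t) s (act g x) = shift n g (kernel_tuple n \<kappa> t s x)"
  by (auto simp: equivariant_kernel_def kernel_tuple_def shift_def fun_eq_iff)

text \<open>Each entry is randomised by its own variable, so deleting an entry deletes its
  variable.\<close>

lemma face_kernel_tuple:
  "i \<le> n \<Longrightarrow> kernel_tuple n \<kappa> (face n i t) (face n i s) x = face n i (kernel_tuple (Suc n) \<kappa> t s x)"
  by (auto simp: kernel_tuple_def face_def fun_eq_iff)

lemma prism_shift: "prism n j (shift n g a) (shift n g b) = shift (Suc n) g (prism n j a b)" if "j < n"
  using that by (auto simp: prism_def shift_def fun_eq_iff)

lemma measurable_kernel_tuple:
  assumes "equivariant_kernel \<kappa>"
  shows "(\<lambda>q. kernel_tuple n \<kappa> (fst (fst q)) (snd q) (snd (fst q))) \<in> BX n \<Otimes>\<^sub>M W_pow n \<rightarrow>\<^sub>M PiM {..<n} (\<lambda>_. borel)"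
  unfolding kernel_tuple_def
proof (rule measurable_restrict)
  fix i assume i: "i \<in> {..<n}"
  have \<kappa>: "(\<lambda>(t, s, x). \<kappa> t s x) \<in> borel_measurable (borel \<Otimes>\<^sub>M borel \<Otimes>\<^sub>M hull_borel P)"
    using assms by (simp add: equivariant_kernel_def)
  have "(\<lambda>q. (fst (fst q) i, snd q i, snd (fst q))) \<in> BX n \<Otimes>\<^sub>M W_pow n \<rightarrow>\<^sub>M borel \<Otimes>\<^sub>M borel \<Otimes>\<^sub>M hull_borel P"
  proof (intro measurable_Pair)
    show "(\<lambda>q. fst (fst q) i) \<in> borel_measurable (BX n \<Otimes>\<^sub>M W_pow n)"
      using i by (intro measurable_compose[OF measurable_fst] measurable_component_singleton)
    have "(\<lambda>s. s i) \<in> W_pow n \<rightarrow>\<^sub>M W" using i by (rule measurable_component_singleton)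
    then have "(\<lambda>s. s i) \<in> W_pow n \<rightarrow>\<^sub>M borel" by (simp add: measurable_cong_sets[OF refl sets_W])
    then show "(\<lambda>q. snd q i) \<in> borel_measurable (BX n \<Otimes>\<^sub>M W_pow n)"
      by (rule measurable_compose[OF measurable_snd])
    show "(\<lambda>q. snd (fst q)) \<in> BX n \<Otimes>\<^sub>M W_pow n \<rightarrow>\<^sub>M hull_borel P"
      by (intro measurable_compose[OF measurable_fst] measurable_snd)
  qed
  from measurable_compose[OF this \<kappa>]
  show "(\<lambda>q. \<kappa> (fst (fst q) i) (snd q i) (snd (fst q))) \<in> borel_measurable (BX n \<Otimes>\<^sub>M W_pow n)" by simp
qed

lemma admissible_integral:
  assumes meas: "(\<lambda>((t, x), s). G t s x) \<in> borel_measurable (BX n \<Otimes>\<^sub>M W_pow n)"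
    and inv: "\<And>g t s x. \<lbrakk>t \<in> tuples n; x \<in> pattern_hull P\<rbrakk> \<Longrightarrow> G (shift n g t) s (act g x) = G t s x"
    and bound: "\<And>t s x. \<lbrakk>t \<in> tuples n; x \<in> pattern_hull P\<rbrakk> \<Longrightarrow> \<bar>G t s x\<bar> \<le> C"
  shows "admissible n (\<lambda>(t, x). \<integral>s. G t s x \<partial>W_pow n)"
  unfolding admissible_def invariant_def
proof (intro conjI allI ballI exI)
  interpret Wn: prob_space "W_pow n" by (rule prob_W_pow)
  show "(\<lambda>(t, x). \<integral>s. G t s x \<partial>W_pow n) \<in> borel_measurable (BX n)"
    using Wn.borel_measurable_lebesgue_integral[of "\<lambda>p s. G (fst p) s (snd p)" "BX n"] meas
    by (simp add: case_prod_unfold)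
  fix t x assume tx: "t \<in> tuples n" "x \<in> pattern_hull P"
  show "(case (shift n g t, act g x) of (t, x) \<Rightarrow> \<integral>s. G t s x \<partial>W_pow n)
    = (case (t, x) of (t, x) \<Rightarrow> \<integral>s. G t s x \<partial>W_pow n)" for g
    using inv[OF tx] by simp
  have "0 \<le> C" using bound[OF tx, of t] by linarith
  have "(\<lambda>s. G t s x) \<in> borel_measurable (W_pow n)"
    using measurable_Pair2[OF meas, of "(t, x)"] tx by simp
  then have "integrable (W_pow n) (\<lambda>s. G t s x)"
    using bound[OF tx] by (intro Wn.integrable_const_bound[of _ C]) auto
  then have "(\<integral>s. \<bar>G t s x\<bar> \<partial>W_pow n) \<le> (\<integral>s. C \<partial>W_pow n)"
    using bound[OF tx] by (intro integral_mono) auto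
  then have "\<bar>\<integral>s. G t s x \<partial>W_pow n\<bar> \<le> (\<integral>s. C \<partial>W_pow n)"
    by (rule order_trans[OF integral_abs_bound])
  then show "\<bar>case (t, x) of (t, x) \<Rightarrow> \<integral>s. G t s x \<partial>W_pow n\<bar> \<le> C"
    using Wn.prob_space by simp
qed

lemma admissible_slice:
  assumes "admissible n F" "x \<in> pattern_hull P"
  shows "(\<lambda>u. F (u, x)) \<in> borel_measurable (PiM {..<n} (\<lambda>_. borel))"
  using measurable_compose[OF measurable_Pair2'[of x "hull_borel P" "PiM {..<n} (\<lambda>_. borel)"]
      admissible_measurable[OF assms(1)]] assms(2) by simp

lemma measurable_prism:
  assumes j: "j < n" and a: "a \<in> N \<rightarrow>\<^sub>M PiM {..<n} (\<lambda>_. borel)" and b: "b \<in> N \<rightarrow>\<^sub>M PiM {..<n} (\<lambda>_. borel)"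
  shows "(\<lambda>q. prism n j (a q) (b q)) \<in> N \<rightarrow>\<^sub>M PiM {..<Suc n} (\<lambda>_. borel)"
  unfolding prism_def
proof (rule measurable_restrict)
  fix i assume i: "i \<in> {..<Suc n}"
  show "(\<lambda>q. if i \<le> j then a q i else b q (i - 1)) \<in> N \<rightarrow>\<^sub>M borel"
  proof (cases "i \<le> j")
    case True
    then show ?thesis
      using measurable_compose[OF a measurable_component_singleton[of i]] j by simp
  next
    case False
    then show ?thesis
      using measurable_compose[OF b measurable_component_singleton[of "i - 1"]] i by simp
  qed
qed

lemma admissible_smear:
  assumes F: "admissible n F" and \<kappa>: "equivariant_kernel \<kappa>"
  shows "admissible n (smear n \<kappa> F)"
proof -
  obtain C where C: "\<And>t x. t \<in> tuples n \<Longrightarrow> x \<in> pattern_hull P \<Longrightarrow> \<bar>F (t, x)\<bar> \<le> C"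
    using F by (auto simp: admissible_def)
  show ?thesis unfolding smear_def
  proof (rule admissible_integral[where C = C])
    have "(\<lambda>q. F (kernel_tuple n \<kappa> (fst (fst q)) (snd q) (snd (fst q)), snd (fst q)))
        \<in> borel_measurable (BX n \<Otimes>\<^sub>M W_pow n)"
      by (intro measurable_compose[OF _ admissible_measurable[OF F]] measurable_Pair
          measurable_kernel_tuple \<kappa> measurable_compose[OF measurable_fst] measurable_snd)
    then show "(\<lambda>((t, x), s). F (kernel_tuple n \<kappa> t s x, x)) \<in> borel_measurable (BX n \<Otimes>\<^sub>M W_pow n)"
      by (simp add: case_prod_unfold)
  qed (use C in \<open>auto simp: kernel_tuple_shift[OF \<kappa>] invariantD[OF admissible_invariant[OF F]]\<close>)
qed

lemma admissible_smear_homotopy: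
  assumes F: "admissible (Suc n) F" and \<kappa>: "equivariant_kernel \<kappa>"
  shows "admissible n (smear_homotopy n \<kappa> F)"
proof -
  obtain C where C: "\<And>t x. t \<in> tuples (Suc n) \<Longrightarrow> x \<in> pattern_hull P \<Longrightarrow> \<bar>F (t, x)\<bar> \<le> C"
    using F by (auto simp: admissible_def)
  show ?thesis unfolding smear_homotopy_def
  proof (rule admissible_integral)
    have "(\<lambda>q. F (prism n j (fst (fst q)) (kernel_tuple n \<kappa> (fst (fst q)) (snd q) (snd (fst q))), snd (fst q)))
        \<in> borel_measurable (BX n \<Otimes>\<^sub>M W_pow n)" if "j < n" for j
      by (intro measurable_compose[OF _ admissible_measurable[OF F]] measurable_Pair measurable_prism that
          measurable_kernel_tuple \<kappa> measurable_compose[OF measurable_fst] measurable_snd measurable_fst)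
    then show "(\<lambda>((t, x), s). prism_sum n (\<lambda>u. F (u, x)) t (kernel_tuple n \<kappa> t s x))
        \<in> borel_measurable (BX n \<Otimes>\<^sub>M W_pow n)"
      unfolding prism_sum_def case_prod_unfold
      by (intro borel_measurable_sum borel_measurable_times borel_measurable_const) auto
  next
    fix g t s x assume tx: "t \<in> tuples n" "x \<in> pattern_hull P"
    have "F (prism n j (shift n g t) (kernel_tuple n \<kappa> (shift n g t) s (act g x)), act g x)
        = F (prism n j t (kernel_tuple n \<kappa> t s x), x)" if "j < n" for j
      unfolding kernel_tuple_shift[OF \<kappa> tx(2)] prism_shift[OF that]
      using tx that by (intro invariantD admissible_invariant F prism_mem_PiE) auto
    then show "prism_sum n (\<lambda>u. F (u, act g x)) (shift n g t) (kernel_tuple n \<kappa> (shift n g t) s (act g x))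
        = prism_sum n (\<lambda>u. F (u, x)) t (kernel_tuple n \<kappa> t s x)"
      unfolding prism_sum_def by (intro sum.cong refl) simp
  next
    fix t s x assume tx: "t \<in> tuples n" "x \<in> pattern_hull P"
    show "\<bar>prism_sum n (\<lambda>u. F (u, x)) t (kernel_tuple n \<kappa> t s x)\<bar> \<le> (\<Sum>j<n. C)"
      unfolding prism_sum_def using C[OF prism_mem_PiE[OF _ tx(1) kernel_tuple_mem] tx(2)]
      by (intro order_trans[OF sum_abs] sum_mono) (simp add: abs_mult)
  qed
qed

lemma measurable_kernel_tuple_slice:
  assumes \<kappa>: "equivariant_kernel \<kappa>" and tx: "t \<in> tuples n" "x \<in> pattern_hull P"
  shows "(\<lambda>s. kernel_tuple n \<kappa> t s x) \<in> W_pow n \<rightarrow>\<^sub>M PiM {..<n} (\<lambda>_. borel)"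
  using measurable_Pair2[OF measurable_kernel_tuple[OF \<kappa>, of n], of "(t, x)"] tx by simp

lemma integrable_slice:
  assumes F: "admissible k F" and x: "x \<in> pattern_hull P"
    and b: "b \<in> W_pow n \<rightarrow>\<^sub>M PiM {..<k} (\<lambda>_. borel)"
  shows "integrable (W_pow n) (\<lambda>s. F (b s, x))"
proof -
  interpret Wn: prob_space "W_pow n" by (rule prob_W_pow)
  obtain C where C: "\<And>t x. t \<in> tuples k \<Longrightarrow> x \<in> pattern_hull P \<Longrightarrow> \<bar>F (t, x)\<bar> \<le> C"
    using F by (auto simp: admissible_def)
  have "b s \<in> tuples k" if "s \<in> space (W_pow n)" for s
    using measurable_space[OF b that] by (simp add: space_PiM)
  then show ?thesis
    using C x measurable_compose[OF b admissible_slice[OF F x]]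
    by (intro Wn.integrable_const_bound[of _ C]) auto
qed

lemma integrable_prism_sum:
  assumes F: "admissible (Suc n) F" and x: "x \<in> pattern_hull P"
    and a: "a \<in> W_pow l \<rightarrow>\<^sub>M PiM {..<n} (\<lambda>_. borel)" and b: "b \<in> W_pow l \<rightarrow>\<^sub>M PiM {..<n} (\<lambda>_. borel)"
  shows "integrable (W_pow l) (\<lambda>s. prism_sum n (\<lambda>u. F (u, x)) (a s) (b s))"
  unfolding prism_sum_def
  by (intro Bochner_Integration.integrable_sum integrable_mult_right integrable_slice[OF F x]
      measurable_prism a b) simp

text \<open>
  The faces of a smeared tuple are smeared faces because the auxiliary variables \<open>s\<close> are independent and
  identically distributed; the prism identity then integrates to a chain homotopy.
\<close>

lemma smear_homotopy_identity:
  assumes F: "admissible (Suc k) F" and \<kappa>: "equivariant_kernel \<kappa>"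
    and tx: "t \<in> tuples (Suc k)" "x \<in> pattern_hull P"
    and AE: "AE s in W_pow (Suc k). \<forall>j<Suc k.
      dG (Suc k) F (prism (Suc k) j t (kernel_tuple (Suc k) \<kappa> t s x), x) = 0"
  shows "dG k (smear_homotopy k \<kappa> F) (t, x) = smear (Suc k) \<kappa> F (t, x) - F (t, x)"
proof -
  interpret W1: prob_space "W_pow (Suc k)" by (rule prob_W_pow)
  let ?f = "\<lambda>u. F (u, x)" and ?K = "\<lambda>s. kernel_tuple (Suc k) \<kappa> t s x"
  note K = measurable_kernel_tuple_slice[OF \<kappa> tx]
  have ft: "face k i t \<in> tuples k" if "i \<le> k" for i using that tx(1) by (rule face_mem_PiE)
  have fK: "(\<lambda>s. face k i (?K s)) \<in> W_pow (Suc k) \<rightarrow>\<^sub>M PiM {..<k} (\<lambda>_. borel)" if "i \<le> k" for i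
    using measurable_compose[OF K measurable_face[OF that]] .
  have int: "integrable (W_pow (Suc k)) (\<lambda>s. prism_sum k ?f (face k i t) (face k i (?K s)))" if "i \<le> k" for i
    using that ft by (intro integrable_prism_sum[OF F tx(2)] fK measurable_const) (auto simp: space_PiM)
  \<comment> \<open>The integral over \<open>k\<close> variables is rewritten over
    \<open>Suc k\<close> variables, one of which is ignored, so that all faces live on one
    probability space.\<close>
  have "smear_homotopy k \<kappa> F (face k i t, x)
      = (\<integral>s. prism_sum k ?f (face k i t) (face k i (?K s)) \<partial>W_pow (Suc k))" if i: "i \<le> k" for i
  proof -
    have "integrable (W_pow k) (\<lambda>s. prism_sum k ?f (face k i t) (kernel_tuple k \<kappa> (face k i t) s x))"
      using i ft by (intro integrable_prism_sum[OF F tx(2)] measurable_const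
          measurable_kernel_tuple_slice \<kappa> tx) (auto simp: space_PiM)
    from integral_face[OF i borel_measurable_integrable[OF this]] show ?thesis
      using i by (simp add: smear_homotopy_def face_kernel_tuple)
  qed
  then have "dG k (smear_homotopy k \<kappa> F) (t, x)
      = (\<Sum>i\<le>k. (- 1) ^ i * (\<integral>s. prism_sum k ?f (face k i t) (face k i (?K s)) \<partial>W_pow (Suc k)))"
    unfolding dG_def differential_def by (auto intro!: sum.cong)
  also have "\<dots> = (\<integral>s. (\<Sum>i\<le>k. (- 1) ^ i * prism_sum k ?f (face k i t) (face k i (?K s))) \<partial>W_pow (Suc k))"
    using int by (subst Bochner_Integration.integral_sum) auto
  \<comment> \<open>The prism identity under the integral; its other term vanishes for almost every
    \<open>s\<close> by the assumption on the prisms.\<close>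
  also have "\<dots> = (\<integral>s. F (?K s, x) - F (t, x) \<partial>W_pow (Suc k))"
  proof (rule integral_cong_AE)
    show "AE s in W_pow (Suc k). (\<Sum>i\<le>k. (- 1) ^ i * prism_sum k ?f (face k i t) (face k i (?K s)))
        = F (?K s, x) - F (t, x)"
      using AE
    proof (rule eventually_mono)
      fix s assume "\<forall>j<Suc k. dG (Suc k) F (prism (Suc k) j t (?K s), x) = 0"
      then have "prism_sum (Suc k) (differential (Suc k) ?f) t (?K s) = 0"
        unfolding prism_sum_def dG_def by (intro sum.neutral) auto
      then show "(\<Sum>i\<le>k. (- 1) ^ i * prism_sum k ?f (face k i t) (face k i (?K s))) = F (?K s, x) - F (t, x)"
        using prism_identity[OF tx(1) kernel_tuple_mem[of "Suc k" \<kappa> t s x], of ?f] by simp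
    qed
    show "(\<lambda>s. \<Sum>i\<le>k. (- 1) ^ i * prism_sum k ?f (face k i t) (face k i (?K s))) \<in> borel_measurable (W_pow (Suc k))"
      using int by (intro borel_measurable_sum borel_measurable_times borel_measurable_const
          borel_measurable_integrable) auto
    show "(\<lambda>s. F (?K s, x) - F (t, x)) \<in> borel_measurable (W_pow (Suc k))"
      using integrable_slice[OF F tx(2) K] by (intro borel_measurable_diff borel_measurable_integrable) auto
  qed
  also have "\<dots> = smear (Suc k) \<kappa> F (t, x) - F (t, x)"
    using integrable_slice[OF F tx(2) K] using W1.prob_space by (simp add: smear_def)
  finally show ?thesis .
qed

text \<open>For the same reason as in the homotopy: the law of a face of \<open>s\<close> is that of
  a shorter tuple of independent variables.\<close>

lemma smear_dG:
  assumes F: "admissible n F" and \<kappa>: "equivariant_kernel \<kappa>"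
    and tx: "t \<in> tuples (Suc n)" "x \<in> pattern_hull P"
  shows "smear (Suc n) \<kappa> (dG n F) (t, x) = dG n (smear n \<kappa> F) (t, x)"
proof -
  let ?K = "\<lambda>s. kernel_tuple (Suc n) \<kappa> t s x"
  note K = measurable_kernel_tuple_slice[OF \<kappa> tx]
  have int: "integrable (W_pow (Suc n)) (\<lambda>s. F (face n i (?K s), x))" if "i \<le> n" for i
    by (rule integrable_slice[OF F tx(2) measurable_compose[OF K measurable_face[OF that]]])
  have "smear n \<kappa> F (face n i t, x) = (\<integral>s. F (face n i (?K s), x) \<partial>W_pow (Suc n))" if i: "i \<le> n" for i
    using integral_face[OF i borel_measurable_integrable[OF integrable_slice[OF F tx(2)
      measurable_kernel_tuple_slice[OF \<kappa> face_mem_PiE[OF i tx(1)] tx(2)]]]] i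
    by (simp add: smear_def face_kernel_tuple)
  then have "dG n (smear n \<kappa> F) (t, x) = (\<Sum>i\<le>n. (- 1) ^ i * (\<integral>s. F (face n i (?K s), x) \<partial>W_pow (Suc n)))"
    unfolding dG_def differential_def by (auto intro!: sum.cong)
  also have "\<dots> = (\<integral>s. (\<Sum>i\<le>n. (- 1) ^ i * F (face n i (?K s), x)) \<partial>W_pow (Suc n))"
    using int by (subst Bochner_Integration.integral_sum) auto
  also have "\<dots> = smear (Suc n) \<kappa> (dG n F) (t, x)"
    by (simp add: smear_def dG_def differential_def)
  finally show ?thesis ..
qed

subsection \<open>The averaging kernel and the retraction onto a pattern\<close>

definition average :: "nat \<Rightarrow> ((nat \<Rightarrow> 'g) \<times> 'g set \<Rightarrow> real) \<Rightarrow> (nat \<Rightarrow> 'g) \<times> 'g set \<Rightarrow> real" where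
  "average n = smear n (\<lambda>t s x. t + s)"

text \<open>\<open>t \<mapsto> near t x\<close> is an equivariant retraction of the group onto \<open>{g. - g \<in> x}\<close>.\<close>

definition near :: "'g \<Rightarrow> 'g set \<Rightarrow> 'g" where
  "near t x = (if - t \<in> x then t else t - selection (act (- t) x))"

definition near_tuple :: "nat \<Rightarrow> (nat \<Rightarrow> 'g) \<Rightarrow> 'g set \<Rightarrow> nat \<Rightarrow> 'g" where
  "near_tuple n t x = (\<lambda>i\<in>{..<n}. near (t i) x)"

text \<open>A point \<open>q\<close> selected from \<open>act (- t) x\<close> satisfies
  \<open>q - t \<in> x\<close>, and \<open>q - t\<close> is the inverse of
  \<open>t - q\<close>.\<close>

lemma near_mem: "x \<in> pattern_hull P \<Longrightarrow> - near t x \<in> x"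
  using selection_mem[OF act_pattern_hull, of x "- t"] by (simp add: near_def mem_act)

lemma near_id: "- t \<in> x \<Longrightarrow> near t x = t"
  by (simp add: near_def)

text \<open>The patterns \<open>act (- (g + t)) (act g x)\<close> and \<open>act (- t) x\<close>
  coincide, so the same point is selected for both.\<close>

lemma near_equivariant: "near (g + t) (act g x) = g + near t x"
  by (simp add: near_def mem_act minus_add act_act add_diff_eq)

lemma near_measurable: "(\<lambda>(t, x). near t x) \<in> borel_measurable (borel \<Otimes>\<^sub>M hull_borel P)"
  unfolding near_def by measurable

lemma near_tuple_mem: "x \<in> pattern_hull P \<Longrightarrow> near_tuple n t x \<in> pattern_tuples n x"
  by (simp add: near_tuple_def PiE_iff mem_uminus_image near_mem)

lemma near_tuple_id: "t \<in> pattern_tuples n x \<Longrightarrow> near_tuple n t x = t"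
  by (auto simp: near_tuple_def fun_eq_iff PiE_iff extensional_def mem_uminus_image near_id)

lemma near_tuple_shift: "near_tuple n (shift n g t) (act g x) = shift n g (near_tuple n t x)"
  by (auto simp: near_tuple_def shift_def fun_eq_iff near_equivariant)

lemma face_near_tuple: "i \<le> n \<Longrightarrow> near_tuple n (face n i t) x = face n i (near_tuple (Suc n) t x)"
  by (auto simp: near_tuple_def face_def fun_eq_iff)

lemma measurable_near_tuple: "(\<lambda>p. near_tuple n (fst p) (snd p)) \<in> BX n \<rightarrow>\<^sub>M PiM {..<n} (\<lambda>_. borel)"
  unfolding near_tuple_def
proof (rule measurable_restrict)
  fix i assume "i \<in> {..<n}"
  then have "(\<lambda>p. (fst p i, snd p)) \<in> BX n \<rightarrow>\<^sub>M borel \<Otimes>\<^sub>M hull_borel P"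
    by (intro measurable_Pair measurable_compose[OF measurable_fst] measurable_component_singleton measurable_snd)
  from measurable_compose[OF this near_measurable]
  show "(\<lambda>p. near (fst p i) (snd p)) \<in> borel_measurable (BX n)" by simp
qed

lemma equivariant_kernel_add: "equivariant_kernel (\<lambda>t s x. t + s)"
  unfolding equivariant_kernel_def by (auto simp: add.assoc)

text \<open>The kernel of the composite group to groupoid to group.\<close>

lemma equivariant_kernel_near_add: "equivariant_kernel (\<lambda>t s x. near t x + s)"
proof -
  have "(\<lambda>q. near (fst q) (snd (snd q))) \<in> borel_measurable (borel \<Otimes>\<^sub>M borel \<Otimes>\<^sub>M hull_borel P)"
    using measurable_compose[OF _ near_measurable, of "\<lambda>q. (fst q, snd (snd q))" "borel \<Otimes>\<^sub>M borel \<Otimes>\<^sub>M hull_borel P"]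
    by simp
  then have "(\<lambda>q. near (fst q) (snd (snd q)) + fst (snd q)) \<in> borel_measurable (borel \<Otimes>\<^sub>M borel \<Otimes>\<^sub>M hull_borel P)"
    by (rule borel_measurable_add) measurable
  then show ?thesis
    unfolding equivariant_kernel_def case_prod_unfold by (auto simp: near_equivariant add.assoc)
qed

text \<open>The kernel that represents, on pattern tuples, the composite groupoid to group to
  groupoid.\<close>

lemma equivariant_kernel_add_near: "equivariant_kernel (\<lambda>t s x. near (t + s) x)"
proof -
  have "(\<lambda>q. near (fst q + fst (snd q)) (snd (snd q))) \<in> borel_measurable (borel \<Otimes>\<^sub>M borel \<Otimes>\<^sub>M hull_borel P)"
    using measurable_compose[OF _ near_measurable, of "\<lambda>q. (fst q + fst (snd q), snd (snd q))" "borel \<Otimes>\<^sub>M borel \<Otimes>\<^sub>M hull_borel P"]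
    by simp
  then show ?thesis
    unfolding equivariant_kernel_def case_prod_unfold by (auto simp: near_equivariant add.assoc)
qed

text \<open>The average at any tuple integrates against a law absolutely continuous with respect to
  the Haar power, so for almost every \<open>x\<close> it depends only on the class.\<close>

lemma average_cong_AE:
  assumes F: "admissible n F" and F': "admissible n F'" and AE: "AE p in cochain_measure m \<mu> n. F p = F' p"
  shows "AE x in \<mu>. \<forall>t \<in> tuples n. average n F (t, x) = average n F' (t, x)"
  using AE_cochain_D[OF AE]
proof (rule AE_mp[OF _ AE_I2[OF impI]], intro ballI)
  fix x t assume x: "x \<in> space \<mu>" and AE: "AE t in m_pow n. F (t, x) = F' (t, x)"
    and t: "t \<in> tuples n"
  have K: "(\<lambda>s. kernel_tuple n (\<lambda>t s x. t + s) t s x) \<in> W_pow n \<rightarrow>\<^sub>M PiM {..<n} (\<lambda>_. borel)"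
    using t x by (intro measurable_kernel_tuple_slice equivariant_kernel_add) auto
  show "average n F (t, x) = average n F' (t, x)"
    unfolding average_def smear_def prod.case
    using AE_translate[OF AE, of t] x
    by (intro integral_cong_AE borel_measurable_integrable integrable_slice[OF F _ K] integrable_slice[OF F' _ K])
      (auto simp: kernel_tuple_def)
qed

lemma average_bound_AE:
  assumes F: "admissible n F" and C: "0 \<le> C" and AE: "AE p in cochain_measure m \<mu> n. \<bar>F p\<bar> \<le> C"
  shows "AE x in \<mu>. \<forall>t \<in> tuples n. \<bar>average n F (t, x)\<bar> \<le> C"
  using AE_cochain_D[OF AE]
proof (rule AE_mp[OF _ AE_I2[OF impI]], intro ballI)
  interpret Wn: prob_space "W_pow n" by (rule prob_W_pow)
  fix x t assume x: "x \<in> space \<mu>" and AE: "AE t in m_pow n. \<bar>F (t, x)\<bar> \<le> C"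
    and t: "t \<in> tuples n"
  let ?K = "\<lambda>s. kernel_tuple n (\<lambda>t s x. t + s) t s x"
  have K: "?K \<in> W_pow n \<rightarrow>\<^sub>M PiM {..<n} (\<lambda>_. borel)"
    using t x by (intro measurable_kernel_tuple_slice equivariant_kernel_add) auto
  have int: "integrable (W_pow n) (\<lambda>s. F (?K s, x))" using x by (intro integrable_slice[OF F _ K]) simp
  have "\<bar>\<integral>s. F (?K s, x) \<partial>W_pow n\<bar> \<le> (\<integral>s. \<bar>F (?K s, x)\<bar> \<partial>W_pow n)"
    by (rule integral_abs_bound)
  also have "\<dots> \<le> (\<integral>s. C \<partial>W_pow n)"
    using AE_translate[OF AE, of t] int by (intro integral_mono_AE) (auto simp: kernel_tuple_def)
  finally show "\<bar>average n F (t, x)\<bar> \<le> C"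
    using Wn.prob_space by (simp add: average_def smear_def)
qed

end

section \<open>Comparison of the two complexes\<close>

context hull_system
begin

text \<open>Faces pull Haar null sets back to null sets for each fixed \<open>x\<close>. A
  measurable null set \<open>N\<close> containing the exceptions makes the Fubini argument
  applicable.\<close>

lemma AE_cochain_face:
  assumes i: "i \<le> n" and AE: "AE p in cochain_measure m \<mu> n. \<Psi> p"
  shows "AE p in cochain_measure m \<mu> (Suc n). \<Psi> (face n i (fst p), snd p)"
proof -
  let ?M = "cochain_measure m \<mu> n" and ?M' = "cochain_measure m \<mu> (Suc n)"
  obtain N where N: "N \<in> null_sets ?M" "{p \<in> space ?M. \<not> \<Psi> p} \<subseteq> N"
    using AE by (auto simp: eventually_ae_filter)
  have "AE x in \<mu>. AE t in m_pow n. (t, x) \<notin> N" using AE_cochain_D[OF AE_not_in[OF N(1)]] .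
  then have "AE x in \<mu>. AE t in m_pow (Suc n). (face n i t, x) \<notin> N"
    by (rule eventually_mono) (rule AE_face[OF i])
  moreover have "(\<lambda>p. (face n i (fst p), snd p)) \<in> ?M' \<rightarrow>\<^sub>M ?M"
    using measurable_face_pair[OF i]
    by (simp add: measurable_cochain_iff measurable_cong_sets[OF refl sets_cochain_measure] case_prod_unfold)
  then have "(\<lambda>p. (face n i (fst p), snd p)) -` (space ?M - N) \<inter> space ?M' \<in> sets ?M'"
    by (rule measurable_sets[OF _ sets.compl_sets[OF null_setsD2[OF N(1)]]])
  then have "{p \<in> space ?M'. (face n i (fst p), snd p) \<notin> N} \<in> sets ?M'"
    by (rule back_subst[where P = "\<lambda>S. S \<in> sets ?M'"]) (auto intro: face_mem_PiE[OF i, THEN PiE_mem] simp: face_def)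
  ultimately have "AE p in ?M'. (face n i (fst p), snd p) \<notin> N"
    by (intro AE_cochain_I) simp_all
  then show ?thesis
  proof (rule AE_mp[OF _ AE_I2[OF impI]])
    fix p assume p: "p \<in> space ?M'" "(face n i (fst p), snd p) \<notin> N"
    then have "fst p \<in> tuples (Suc n)" "snd p \<in> pattern_hull P" by (simp_all add: mem_Times_iff)
    then have "(face n i (fst p), snd p) \<in> space ?M"
      using face_mem_PiE[OF i, of "fst p" UNIV] by (simp only: space_cochain_measure mem_Times_iff fst_conv snd_conv)
    then show "\<Psi> (face n i (fst p), snd p)" using N(2) p(2) by blast
  qed
qed

lemma AE_cochain_all:
  assumes "AE x in \<mu>. \<forall>t \<in> tuples n. \<Psi> (t, x)"
  shows "AE p in cochain_measure m \<mu> n. \<Psi> p"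
proof -
  let ?M = "cochain_measure m \<mu> n"
  obtain N where N: "N \<in> null_sets \<mu>" "{x \<in> space \<mu>. \<not> (\<forall>t \<in> tuples n. \<Psi> (t, x))} \<subseteq> N"
    using assms by (auto simp: eventually_ae_filter)
  have "snd \<in> ?M \<rightarrow>\<^sub>M \<mu>" by (simp add: measurable_cochain_iff measurable_cong_sets[OF refl sets_mu])
  then have "snd -` (space \<mu> - N) \<inter> space ?M \<in> sets ?M"
    by (rule measurable_sets[OF _ sets.compl_sets[OF null_setsD2[OF N(1)]]])
  then have "{p \<in> space ?M. snd p \<notin> N} \<in> sets ?M"
    by (rule back_subst[where P = "\<lambda>S. S \<in> sets ?M"]) auto
  moreover have "AE x in \<mu>. AE t in m_pow n. x \<notin> N"
    using AE_not_in[OF N(1)] by (rule eventually_mono) simp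
  ultimately have "AE p in ?M. snd p \<notin> N" by (intro AE_cochain_I) simp_all
  then show ?thesis
  proof (rule AE_mp[OF _ AE_I2[OF impI]])
    fix p assume p: "p \<in> space ?M" "snd p \<notin> N"
    then have "fst p \<in> tuples n" "snd p \<in> space \<mu>" by (simp_all add: mem_Times_iff)
    then have "\<Psi> (fst p, snd p)" using p(2) N(2) by blast
    then show "\<Psi> p" by simp
  qed
qed

section \<open>The two cochain complexes as instances of \<open>fn_complex\<close>\<close>

lemma AE_faces:
  "(\<And>i. i \<le> n \<Longrightarrow> AE p in M. \<Psi> i p) \<Longrightarrow> AE p in M. \<forall>i\<in>{..n::nat}. \<Psi> i p"
  by (intro eventually_ball_finite) auto

lemma carr_essI: "f \<in> borel_measurable M \<Longrightarrow> AE x in M. \<bar>f x\<bar> \<le> C \<Longrightarrow> f \<in> carr (ess_bounded M)"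
  by (auto simp: ess_bounded_def)

lemma carr_essE:
  assumes "f \<in> carr (ess_bounded M)" obtains C where "0 \<le> C" "AE x in M. \<bar>f x\<bar> \<le> C"
  using assms snorm_ess_bounded_nonneg[of M f] snorm_ess_bounded_le_iff[OF assms snorm_ess_bounded_nonneg]
  by blast

lemma abs_differential_le:
  assumes "\<forall>i\<in>{..n}. \<bar>f (face n i t)\<bar> \<le> C"
  shows "\<bar>differential n f t\<bar> \<le> real (Suc n) * C"
proof -
  have "\<bar>differential n f t\<bar> \<le> (\<Sum>i\<le>n. C)"
    unfolding differential_def using assms
    by (intro order_trans[OF sum_abs] sum_mono) (simp add: abs_mult)
  then show ?thesis by simp
qed

lemma AE_dG_bound:
  assumes "AE p in cochain_measure m \<mu> n. \<bar>f p\<bar> \<le> C"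
  shows "AE p in cochain_measure m \<mu> (Suc n). \<bar>dG n f p\<bar> \<le> real (Suc n) * C"
proof -
  have "AE p in cochain_measure m \<mu> (Suc n). \<forall>i\<in>{..n}. \<bar>f (face n i (fst p), snd p)\<bar> \<le> C"
    by (intro AE_faces AE_cochain_face assms)
  then show ?thesis
    by (rule eventually_mono) (simp only: dG_def case_prod_unfold, rule abs_differential_le)
qed

lemma AE_dG_cong:
  assumes "AE p in cochain_measure m \<mu> n. f p = g p"
  shows "AE p in cochain_measure m \<mu> (Suc n). dG n f p = dG n g p"
proof -
  have "AE p in cochain_measure m \<mu> (Suc n). \<forall>i\<in>{..n}. f (face n i (fst p), snd p) = g (face n i (fst p), snd p)"
    by (intro AE_faces AE_cochain_face assms)
  then show ?thesis
    by eventually_elim (simp add: dG_def differential_def case_prod_unfold)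
qed

lemma invariant_cochain_dG:
  assumes "invariant_cochain m act \<mu> n f" shows "invariant_cochain m act \<mu> (Suc n) (dG n f)"
  unfolding invariant_cochain_def
proof
  fix g
  have "AE p in cochain_measure m \<mu> n. f (shift n g (fst p), act g (snd p)) = f p"
    using assms by (simp add: invariant_cochain_def shift_def case_prod_unfold)
  then have "AE p in cochain_measure m \<mu> (Suc n). \<forall>i\<in>{..n}.
      f (shift n g (face n i (fst p)), act g (snd p)) = f (face n i (fst p), snd p)"
    using AE_cochain_face[of _ n "\<lambda>p. f (shift n g (fst p), act g (snd p)) = f p"]
    by (intro AE_faces) simp
  then show "AE (t, x) in cochain_measure m \<mu> (Suc n). dG n f (\<lambda>i\<in>{..<Suc n}. g + t i, act g x) = dG n f (t, x)"
    unfolding shift_def[symmetric]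
    by eventually_elim (simp add: dG_def differential_def case_prod_unfold face_shift)
qed

lemma differential_add: "differential n (\<lambda>s. f s + g s) t = differential n f t + differential n g t"
  by (simp add: differential_def distrib_left sum.distrib)

lemma differential_scale: "differential n (\<lambda>s. c * f s) t = c * differential n f t"
  by (simp add: differential_def sum_distrib_left ac_simps)

sublocale group: fn_complex "\<lambda>k. cochain_measure m \<mu> (Suc k)" "\<lambda>k. invariant_cochain m act \<mu> (Suc k)"
  "\<lambda>k. dG (Suc k)"
proof
  fix k :: nat and f g :: "(nat \<Rightarrow> 'g) \<times> 'g set \<Rightarrow> real" and c :: real
  let ?M = "cochain_measure m \<mu> (Suc k)" and ?I = "invariant_cochain m act \<mu> (Suc k)"
  show "?I (\<lambda>x. 0)" by (simp add: invariant_cochain_def)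
  show "?I (\<lambda>x. f x + g x)" if "?I f" "?I g"
    unfolding invariant_cochain_def
  proof
    fix h
    from that have "AE (t, x) in ?M. f (\<lambda>i\<in>{..<Suc k}. h + t i, act h x) = f (t, x)"
      "AE (t, x) in ?M. g (\<lambda>i\<in>{..<Suc k}. h + t i, act h x) = g (t, x)"
      by (simp_all add: invariant_cochain_def)
    then show "AE (t, x) in ?M. f (\<lambda>i\<in>{..<Suc k}. h + t i, act h x) + g (\<lambda>i\<in>{..<Suc k}. h + t i, act h x)
        = f (t, x) + g (t, x)"
      by eventually_elim auto
  qed
  show "?I (\<lambda>x. c * f x)" if "?I f"
    unfolding invariant_cochain_def
  proof
    fix h
    from that have "AE (t, x) in ?M. f (\<lambda>i\<in>{..<Suc k}. h + t i, act h x) = f (t, x)"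
      by (simp add: invariant_cochain_def)
    then show "AE (t, x) in ?M. c * f (\<lambda>i\<in>{..<Suc k}. h + t i, act h x) = c * f (t, x)"
      by eventually_elim auto
  qed
  show "dG (Suc k) f \<in> carr (ess_bounded (cochain_measure m \<mu> (Suc (Suc k))))"
    if f: "f \<in> carr (ess_bounded ?M)"
  proof -
    obtain C where "AE p in ?M. \<bar>f p\<bar> \<le> C" using carr_essE[OF f] by blast
    from carr_essI[OF _ AE_dG_bound[OF this]] show ?thesis
      using f by (simp add: measurable_cochain_iff measurable_dG carr_cochain_measurable)
  qed
  show "invariant_cochain m act \<mu> (Suc (Suc k)) (dG (Suc k) f)" if "?I f"
    using that by (rule invariant_cochain_dG)
  show "dG (Suc k) (\<lambda>x. f x + g x) = (\<lambda>x. dG (Suc k) f x + dG (Suc k) g x)"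
    by (simp add: dG_def differential_add fun_eq_iff)
  show "dG (Suc k) (\<lambda>x. c * f x) = (\<lambda>x. c * dG (Suc k) f x)"
    by (simp add: dG_def differential_scale fun_eq_iff)
  show "AE x in cochain_measure m \<mu> (Suc (Suc k)). dG (Suc k) f x = dG (Suc k) g x"
    if "AE x in ?M. f x = g x"
    using that by (rule AE_dG_cong)
qed

lemma face_arrow_tuple: "i \<le> n \<Longrightarrow> face n i (arrow_tuple (Suc n) y t) = arrow_tuple n y (face n i t)"
  by (auto simp: face_def arrow_tuple_def fun_eq_iff)

text \<open>Faces of tuples over \<open>y\<close> are again tuples over \<open>y\<close>, so the
  same exceptional set of \<open>y\<close> serves.\<close>

lemma AE_T_face:
  assumes n: "0 < n" and i: "i \<le> n" and AE: "AE \<gamma> in T n. \<Phi> \<gamma>"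
  shows "AE \<gamma> in T (Suc n). \<Phi> (face n i \<gamma>)"
  using AE unfolding AE_T_iff[OF n] AE_T_iff[OF zero_less_Suc]
  by (rule eventually_mono) (use i in \<open>auto simp: face_arrow_tuple intro!: face_mem_PiE\<close>)

lemma face_fiber_tuples: "i \<le> n \<Longrightarrow> \<gamma> \<in> fiber_tuples \<G> (Suc n) \<Longrightarrow> face n i \<gamma> \<in> fiber_tuples \<G> n"
  by (auto simp: fiber_tuples_def face_def PiE_iff)

lemma measurable_T_face: "i \<le> n \<Longrightarrow> face n i \<in> T (Suc n) \<rightarrow>\<^sub>M T n"
proof (rule measurable_into_T)
  fix j assume "i \<le> n" "j < n"
  then show "(\<lambda>\<gamma>. face n i \<gamma> j) \<in> T (Suc n) \<rightarrow>\<^sub>M arrows \<G>"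
    using measurable_T_component[of j "Suc n"] measurable_T_component[of "Suc j" "Suc n"]
    by (simp add: face_def)
qed (simp add: face_fiber_tuples)

lemma measurable_T_differential:
  "f \<in> borel_measurable (T n) \<Longrightarrow> differential n f \<in> borel_measurable (T (Suc n))"
  unfolding differential_def[abs_def]
  by (intro borel_measurable_sum borel_measurable_times borel_measurable_const
      measurable_compose[OF measurable_T_face]) auto

lemma AE_T_differential_bound:
  assumes "0 < n" "AE \<gamma> in T n. \<bar>f \<gamma>\<bar> \<le> C"
  shows "AE \<gamma> in T (Suc n). \<bar>differential n f \<gamma>\<bar> \<le> real (Suc n) * C"
proof -
  have "AE \<gamma> in T (Suc n). \<forall>i\<in>{..n}. \<bar>f (face n i \<gamma>)\<bar> \<le> C"
    by (intro AE_faces AE_T_face assms)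
  then show ?thesis by (rule eventually_mono) (rule abs_differential_le)
qed

lemma AE_T_differential_cong:
  assumes "0 < n" "AE \<gamma> in T n. f \<gamma> = g \<gamma>"
  shows "AE \<gamma> in T (Suc n). differential n f \<gamma> = differential n g \<gamma>"
proof -
  have "AE \<gamma> in T (Suc n). \<forall>i\<in>{..n}. f (face n i \<gamma>) = g (face n i \<gamma>)"
    by (intro AE_faces AE_T_face assms)
  then show ?thesis by eventually_elim (simp add: differential_def)
qed

text \<open>The face with \<open>i = 0\<close> loses the entry from which the target is read, but
  all entries share it.\<close>

lemma target_face:
  assumes "0 < n" "i \<le> n" "\<gamma> \<in> fiber_tuples \<G> (Suc n)"
  shows "target \<G> (face n i \<gamma> 0) = target \<G> (\<gamma> 0)"
  using assms by (auto simp: face_def fiber_tuples_def)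

lemma invariant_tuple_function_differential:
  assumes n: "0 < n" and f: "invariant_tuple_function \<G> n f"
  shows "invariant_tuple_function \<G> (Suc n) (differential n f)"
  unfolding invariant_tuple_function_def
proof -
  let ?t = "\<lambda>n \<alpha> \<gamma>. \<lambda>i\<in>{..<n}. compose \<G> (inverse_arrow \<G> \<alpha>) (\<gamma> i)"
  have face: "face n i (?t (Suc n) \<alpha> \<gamma>) = ?t n \<alpha> (face n i \<gamma>)" if "i \<le> n" for i \<alpha> \<gamma>
    using that by (auto simp: face_def fun_eq_iff)
  have "AE \<gamma> in T (Suc n). \<forall>i\<in>{..n}. \<forall>\<alpha>\<in>target_fiber \<G> (target \<G> (face n i \<gamma> 0)).
      f (?t n \<alpha> (face n i \<gamma>)) = f (face n i \<gamma>)"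
    using f AE_T_face[OF n, of _ "\<lambda>\<gamma>. \<forall>\<alpha>\<in>target_fiber \<G> (target \<G> (\<gamma> 0)). f (?t n \<alpha> \<gamma>) = f \<gamma>"]
    by (intro AE_faces) (simp add: invariant_tuple_function_def)
  then show "AE \<gamma> in T (Suc n). \<forall>\<alpha>\<in>target_fiber \<G> (target \<G> (\<gamma> 0)).
      differential n f (?t (Suc n) \<alpha> \<gamma>) = differential n f \<gamma>"
  proof (rule AE_mp[OF _ AE_I2[OF impI]], intro ballI)
    fix \<gamma> \<alpha> assume \<gamma>: "\<gamma> \<in> space (T (Suc n))" and \<alpha>: "\<alpha> \<in> target_fiber \<G> (target \<G> (\<gamma> 0))"
      and *: "\<forall>i\<in>{..n}. \<forall>\<alpha>\<in>target_fiber \<G> (target \<G> (face n i \<gamma> 0)). f (?t n \<alpha> (face n i \<gamma>)) = f (face n i \<gamma>)"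
    have "f (face n i (?t (Suc n) \<alpha> \<gamma>)) = f (face n i \<gamma>)" if "i \<le> n" for i
      unfolding face[OF that] using * \<alpha> that \<gamma> target_face[OF n that, of \<gamma>] by simp
    then show "differential n f (?t (Suc n) \<alpha> \<gamma>) = differential n f \<gamma>"
      unfolding differential_def by (intro sum.cong refl) simp
  qed
qed

sublocale groupoid: fn_complex "\<lambda>k. T (Suc k)" "\<lambda>k. invariant_tuple_function \<G> (Suc k)"
  "\<lambda>k. differential (Suc k)"
proof
  fix k :: nat and f g :: "(nat \<Rightarrow> 'g \<times> 'g set) \<Rightarrow> real" and c :: real
  let ?M = "T (Suc k)" and ?I = "invariant_tuple_function \<G> (Suc k)"
  show "?I (\<lambda>x. 0)" by (simp add: invariant_tuple_function_def)
  show "?I (\<lambda>x. f x + g x)" if "?I f" "?I g"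
    using that unfolding invariant_tuple_function_def by eventually_elim simp
  show "?I (\<lambda>x. c * f x)" if "?I f"
    using that unfolding invariant_tuple_function_def by eventually_elim simp
  show "differential (Suc k) f \<in> carr (ess_bounded (T (Suc (Suc k))))"
    if f: "f \<in> carr (ess_bounded ?M)"
  proof -
    obtain C where "AE p in ?M. \<bar>f p\<bar> \<le> C" using carr_essE[OF f] by blast
    from carr_essI[OF _ AE_T_differential_bound[OF zero_less_Suc this]] show ?thesis
      using f by (simp add: measurable_T_differential ess_bounded_def)
  qed
  show "invariant_tuple_function \<G> (Suc (Suc k)) (differential (Suc k) f)" if "?I f"
    using that by (intro invariant_tuple_function_differential) simp
  show "differential (Suc k) (\<lambda>x. f x + g x) = (\<lambda>x. differential (Suc k) f x + differential (Suc k) g x)"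
    by (simp add: differential_add fun_eq_iff)
  show "differential (Suc k) (\<lambda>x. c * f x) = (\<lambda>x. c * differential (Suc k) f x)"
    by (simp add: differential_scale fun_eq_iff)
  show "AE x in T (Suc (Suc k)). differential (Suc k) f x = differential (Suc k) g x"
    if "AE x in ?M. f x = g x"
    using that by (intro AE_T_differential_cong) simp_all
qed

subsection \<open>From invariant functions to the groupoid and back\<close>

definition rep :: "nat \<Rightarrow> ((nat \<Rightarrow> 'g) \<times> 'g set \<Rightarrow> real) \<Rightarrow> (nat \<Rightarrow> 'g \<times> 'g set) \<Rightarrow> real" where
  "rep n F \<gamma> = F (\<lambda>i\<in>{..<n}. fst (\<gamma> i), base \<gamma>)"

text \<open>The tuple is first moved into \<open>- x\<close> and then shifted diagonally so that its
  first entry is the identity. The pattern moves to \<open>act (- u 0) x\<close>, which lies in the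
  transversal, where morphisms exist.\<close>

definition near_arrows :: "nat \<Rightarrow> (nat \<Rightarrow> 'g) \<times> 'g set \<Rightarrow> nat \<Rightarrow> 'g \<times> 'g set" where
  "near_arrows n = (\<lambda>(t, x). let u = near_tuple n t x in arrow_tuple n (act (- u 0) x) (shift n (- u 0) u))"

definition unrep :: "nat \<Rightarrow> ((nat \<Rightarrow> 'g \<times> 'g set) \<Rightarrow> real) \<Rightarrow> (nat \<Rightarrow> 'g) \<times> 'g set \<Rightarrow> real" where
  "unrep n f p = f (near_arrows n p)"

lemma base_mem: "0 < n \<Longrightarrow> \<gamma> \<in> fiber_tuples \<G> n \<Longrightarrow> base \<gamma> \<in> pattern_hull P"
  using transversal_subset by (auto simp: fiber_tuples_iff)

lemma measurable_rep:
  assumes n: "0 < n" and F: "F \<in> borel_measurable (BX n)"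
  shows "rep n F \<in> borel_measurable (T n)"
proof -
  have "(\<lambda>\<gamma>. \<lambda>i\<in>{..<n}. fst (\<gamma> i)) \<in> T n \<rightarrow>\<^sub>M PiM {..<n} (\<lambda>_. borel)"
    by (rule measurable_restrict) (intro measurable_compose[OF measurable_T_component measurable_arrows_fst], simp)
  from measurable_compose[OF measurable_Pair[OF this measurable_base[OF n]] F]
  show ?thesis by (simp add: rep_def[abs_def])
qed

text \<open>Left multiplication by the inverse of \<open>\<alpha>\<close> shifts all group
  components by one element and moves the base by the same element; this is the diagonal
  action.\<close>

lemma invariant_rep:
  assumes n: "0 < n" and F: "invariant n F"
  shows "invariant_tuple_function \<G> n (rep n F)"
  unfolding invariant_tuple_function_def
proof (rule AE_I2, rule ballI)
  fix \<gamma> \<alpha> assume \<gamma>: "\<gamma> \<in> space (T n)" and \<alpha>: "\<alpha> \<in> target_fiber \<G> (target \<G> (\<gamma> 0))"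
  obtain h z where hz: "\<alpha> = (h, z)" by (cases \<alpha>)
  have comp: "compose \<G> (inverse_arrow \<G> \<alpha>) (\<gamma> i) = (- h + fst (\<gamma> i), snd (\<gamma> i))" for i
    by (cases "\<gamma> i") (simp add: hz)
  let ?\<gamma>' = "\<lambda>i\<in>{..<n}. compose \<G> (inverse_arrow \<G> \<alpha>) (\<gamma> i)"
  have "(\<lambda>i\<in>{..<n}. fst (?\<gamma>' i)) = shift n (- h) (\<lambda>i\<in>{..<n}. fst (\<gamma> i))"
    by (auto simp: comp shift_def fun_eq_iff)
  moreover have "base ?\<gamma>' = act (- h) (base \<gamma>)"
    using n by (cases "\<gamma> 0") (simp add: base_def comp act_act)
  ultimately show "rep n F ?\<gamma>' = rep n F \<gamma>"
    unfolding rep_def using \<gamma> base_mem[OF n, of \<gamma>] by (simp add: invariantD[OF F])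
qed

lemma AE_rep_eq_iff:
  assumes n: "0 < n" and F: "invariant n F" and F': "invariant n F'"
  shows "(AE \<gamma> in T n. rep n F \<gamma> = rep n F' \<gamma>) \<longleftrightarrow> (AE x in \<mu>. \<forall>t \<in> pattern_tuples n x. F (t, x) = F' (t, x))"
  unfolding rep_def by (rule AE_T_invariant[OF n]) (simp add: invariantD[OF F] invariantD[OF F'])

lemma AE_rep_bound_iff:
  assumes n: "0 < n" and F: "invariant n F"
  shows "(AE \<gamma> in T n. \<bar>rep n F \<gamma>\<bar> \<le> C) \<longleftrightarrow> (AE x in \<mu>. \<forall>t \<in> pattern_tuples n x. \<bar>F (t, x)\<bar> \<le> C)"
  unfolding rep_def by (rule AE_T_invariant[OF n]) (simp add: invariantD[OF F])

lemma AE_pattern_tuples: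
  "AE x in \<mu>. \<forall>t \<in> tuples n. \<Psi> t x \<Longrightarrow> AE x in \<mu>. \<forall>t \<in> pattern_tuples n x. \<Psi> t x"
  by (erule eventually_mono) (auto simp: PiE_iff)

lemma differential_rep:
  assumes n: "0 < n" and \<gamma>: "\<gamma> \<in> fiber_tuples \<G> (Suc n)"
  shows "differential n (rep n F) \<gamma> = rep (Suc n) (dG n F) \<gamma>"
proof -
  have "rep n F (face n i \<gamma>) = F (face n i (\<lambda>i\<in>{..<Suc n}. fst (\<gamma> i)), base \<gamma>)" if "i \<le> n" for i
  proof -
    have "(\<lambda>j\<in>{..<n}. fst (face n i \<gamma> j)) = face n i (\<lambda>i\<in>{..<Suc n}. fst (\<gamma> i))"
      by (auto simp: face_def fun_eq_iff)
    then show ?thesis using target_face[OF n that \<gamma>] by (simp add: rep_def base_def)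
  qed
  then show ?thesis by (simp add: rep_def[of "Suc n"] dG_def differential_def)
qed

lemma near_arrows_mem:
  fixes t :: "nat \<Rightarrow> 'g"
  assumes n: "0 < n" and x: "x \<in> pattern_hull P"
  defines "u \<equiv> near_tuple n t x"
  shows "- u 0 \<in> x" "act (- u 0) x \<in> transversal P" "shift n (- u 0) u \<in> pattern_tuples n (act (- u 0) x)"
    "near_arrows n (t, x) \<in> fiber_tuples \<G> n"
proof -
  have u: "u \<in> pattern_tuples n x" unfolding u_def by (rule near_tuple_mem[OF x])
  then show 1: "- u 0 \<in> x" using n by (auto simp: PiE_iff mem_uminus_image)
  then show 2: "act (- u 0) x \<in> transversal P" by (simp add: transversal_act_iff x)
  have "u \<in> tuples n" using u by (auto simp: PiE_iff)
  then show 3: "shift n (- u 0) u \<in> pattern_tuples n (act (- u 0) x)"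
    using u by (simp add: shift_mem_iff)
  show "near_arrows n (t, x) \<in> fiber_tuples \<G> n"
    using arrow_tuple_mem(1)[OF n 2 3] by (simp add: near_arrows_def u_def Let_def)
qed

lemma measurable_near_arrows:
  assumes n: "0 < n" shows "near_arrows n \<in> BX n \<rightarrow>\<^sub>M T n"
proof (rule measurable_into_T)
  show "near_arrows n p \<in> fiber_tuples \<G> n" if "p \<in> space (BX n)" for p
    using that near_arrows_mem(4)[OF n] by (cases p) auto
  fix i assume i: "i < n"
  let ?u = "\<lambda>p. near_tuple n (fst p) (snd p)"
  have comp: "(\<lambda>p. ?u p j) \<in> borel_measurable (BX n)" if "j < n" for j
    by (rule measurable_compose[OF measurable_near_tuple measurable_component_singleton]) (use that in simp)
  have u0: "(\<lambda>p. - ?u p 0) \<in> borel_measurable (BX n)"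
    by (rule borel_measurable_group_uminus[OF comp[OF n]])
  have ui: "(\<lambda>p. - ?u p 0 + ?u p i) \<in> borel_measurable (BX n)"
    by (rule borel_measurable_add[OF u0 comp[OF i]])
  have "(\<lambda>p. (- ?u p 0 + ?u p i, act (- (- ?u p 0 + ?u p i)) (act (- ?u p 0) (snd p)))) \<in> BX n \<rightarrow>\<^sub>M arrows \<G>"
  proof (rule measurable_into_arrows[OF ui])
    show "(\<lambda>p. act (- (- ?u p 0 + ?u p i)) (act (- ?u p 0) (snd p))) \<in> BX n \<rightarrow>\<^sub>M hull_borel P"
      by (rule measurable_act[OF borel_measurable_group_uminus[OF ui] measurable_act[OF u0 measurable_snd]])
    fix p assume "p \<in> space (BX n)"
    then have x: "snd p \<in> pattern_hull P" by (simp add: mem_Times_iff)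
    have y: "act (- ?u p 0) (snd p) \<in> transversal P" by (rule near_arrows_mem(2)[OF n x])
    have "shift n (- ?u p 0) (?u p) i \<in> uminus ` act (- ?u p 0) (snd p)"
      by (rule PiE_mem[OF near_arrows_mem(3)[OF n x]]) (use i in simp)
    then have g: "- (- ?u p 0 + ?u p i) \<in> act (- ?u p 0) (snd p)"
      unfolding mem_uminus_image using i by (simp only: shift_def restrict_apply lessThan_iff if_True)
    have "act (- g) z \<in> transversal P \<and> act g (act (- g) z) \<in> transversal P"
      if "z \<in> transversal P" "- g \<in> z" for g z
      using that transversal_subset by (auto simp: act_act transversal_act_iff)
    from this[OF y g]
    show "act (- (- ?u p 0 + ?u p i)) (act (- ?u p 0) (snd p)) \<in> transversal P \<and>
        act (- ?u p 0 + ?u p i) (act (- (- ?u p 0 + ?u p i)) (act (- ?u p 0) (snd p))) \<in> transversal P" .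
  qed
  moreover have "near_arrows n p i = (- ?u p 0 + ?u p i, act (- (- ?u p 0 + ?u p i)) (act (- ?u p 0) (snd p)))" for p
    using i by (simp add: near_arrows_def case_prod_unfold Let_def arrow_tuple_def arrow_def shift_def)
  ultimately show "(\<lambda>p. near_arrows n p i) \<in> BX n \<rightarrow>\<^sub>M arrows \<G>" by simp
qed

text \<open>Normalising the first entry to the identity singles out one point of each diagonal
  orbit; hence \<open>unrep\<close> is strictly invariant even if \<open>f\<close> is invariant only
  almost everywhere.\<close>

lemma near_arrows_shift:
  assumes n: "0 < n"
  shows "near_arrows n (shift n g t, act g x) = near_arrows n (t, x)"
proof -
  let ?u = "near_tuple n t x"
  have s0: "shift n g ?u 0 = g + ?u 0" using n by (simp add: shift_def)
  have "- (g + ?u 0) + g = - ?u 0" by (simp add: minus_add)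
  then show ?thesis
    unfolding near_arrows_def prod.case Let_def near_tuple_shift s0 shift_shift act_act by simp
qed

lemma invariant_unrep:
  assumes n: "0 < n" and f: "f \<in> borel_measurable (T n)"
  shows "invariant n (unrep n f)"
  unfolding invariant_def
  using measurable_compose[OF measurable_near_arrows[OF n] f]
  by (auto simp: unrep_def[abs_def] near_arrows_shift[OF n])

lemma unrep_near_tuple:
  "x \<in> pattern_hull P \<Longrightarrow> unrep n f (near_tuple n t x, x) = unrep n f (t, x)"
  by (simp add: unrep_def near_arrows_def near_tuple_id near_tuple_mem)

text \<open>The base is \<open>act g x\<close> with \<open>g = - u 0 \<in> x\<close>, a return of
  \<open>x\<close>, so \<open>AE_nu_D\<close> covers it for every \<open>t\<close>.\<close>

lemma AE_near_arrows:
  assumes n: "0 < n" and AE: "AE \<gamma> in T n. \<Phi> \<gamma>"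
  shows "AE p in cochain_measure m \<mu> n. \<Phi> (near_arrows n p)"
proof (rule AE_cochain_all)
  have "AE x in \<mu>. \<forall>g\<in>x. \<forall>t \<in> pattern_tuples n (act g x). \<Phi> (arrow_tuple n (act g x) t)"
    using AE unfolding AE_T_iff[OF n] by (rule AE_nu_D)
  then show "AE x in \<mu>. \<forall>t \<in> tuples n. \<Phi> (near_arrows n (t, x))"
  proof (rule AE_mp[OF _ AE_I2[OF impI]], intro ballI)
    fix x t assume x: "x \<in> space \<mu>"
      and *: "\<forall>g\<in>x. \<forall>t \<in> pattern_tuples n (act g x). \<Phi> (arrow_tuple n (act g x) t)"
    then show "\<Phi> (near_arrows n (t, x))"
      using near_arrows_mem(1,3)[OF n, of x t] by (simp add: near_arrows_def Let_def)
  qed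
qed

text \<open>On a groupoid tuple \<open>near\<close> changes nothing, and the normalisation is
  multiplication by the inverse of \<open>\<gamma> 0\<close>. Invariance of \<open>f\<close> is used
  for this one morphism.\<close>

lemma rep_unrep_AE:
  assumes n: "0 < n" and f: "invariant_tuple_function \<G> n f"
  shows "AE \<gamma> in T n. rep n (unrep n f) \<gamma> = f \<gamma>"
  using f unfolding invariant_tuple_function_def
proof (rule AE_mp[OF _ AE_I2[OF impI]])
  fix \<gamma> assume \<gamma>: "\<gamma> \<in> space (T n)"
    and *: "\<forall>\<alpha>\<in>target_fiber \<G> (target \<G> (\<gamma> 0)). f (\<lambda>i\<in>{..<n}. compose \<G> (inverse_arrow \<G> \<alpha>) (\<gamma> i)) = f \<gamma>"
  let ?y = "base \<gamma>"
  obtain t where t: "t \<in> pattern_tuples n ?y" "\<gamma> = arrow_tuple n ?y t"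
    using fiber_tuples_arrow_tuple[OF n, of \<gamma>] \<gamma> by auto
  have t': "t \<in> tuples n" using t(1) by (auto simp: PiE_iff)
  have \<gamma>i: "\<gamma> i = (t i, act (- t i) ?y)" if "i < n" for i
    using fun_cong[OF t(2), of i] that by (simp add: arrow_tuple_def arrow_def)
  have "\<gamma> 0 \<in> space (arrows \<G>)" using \<gamma> n by (auto simp: fiber_tuples_def)
  then have \<gamma>0: "\<gamma> 0 \<in> target_fiber \<G> (target \<G> (\<gamma> 0))" by (rule space_arrows_nonempty_fiber)
  have "- (- t 0 + t i) + - t 0 = - t i" for i by (simp add: minus_add add.assoc)
  then have eq: "arrow_tuple n (act (- t 0) ?y) (shift n (- t 0) t)
      = (\<lambda>i\<in>{..<n}. compose \<G> (inverse_arrow \<G> (\<gamma> 0)) (\<gamma> i))"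
    using n by (auto simp: fun_eq_iff arrow_tuple_def arrow_def shift_def \<gamma>i act_act)
  have "(\<lambda>i\<in>{..<n}. fst (\<gamma> i)) = t" using fst_arrow_tuple[OF t', of ?y] t(2) by simp
  then have "rep n (unrep n f) \<gamma> = unrep n f (t, ?y)" by (simp add: rep_def)
  also have "\<dots> = f (arrow_tuple n (act (- t 0) ?y) (shift n (- t 0) t))"
    by (simp add: unrep_def near_arrows_def near_tuple_id[OF t(1)])
  also have "\<dots> = f \<gamma>" using * \<gamma>0 unfolding eq by blast
  finally show "rep n (unrep n f) \<gamma> = f \<gamma>" .
qed

lemma unrep_rep:
  assumes n: "0 < n" and F: "invariant n F" and x: "x \<in> pattern_hull P"
  shows "unrep n (rep n F) (t, x) = F (near_tuple n t x, x)"
proof -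
  let ?u = "near_tuple n t x"
  have u: "?u \<in> tuples n" using near_tuple_mem[OF x, of n t] by (auto simp: PiE_iff)
  have "unrep n (rep n F) (t, x) = F (shift n (- ?u 0) ?u, act (- ?u 0) x)"
    by (simp add: unrep_def near_arrows_def Let_def rep_def fst_arrow_tuple base_arrow_tuple[OF n])
  also have "\<dots> = F (?u, x)" by (rule invariantD[OF F u x])
  finally show ?thesis .
qed

text \<open>Each face is normalised by its own first entry, so the two sides agree only up to the
  almost everywhere invariance of \<open>f\<close>. The identity is first obtained on pattern tuples
  through \<open>rep\<close>.\<close>

lemma unrep_differential_AE:
  assumes n: "0 < n" and f: "f \<in> borel_measurable (T n)" and inv: "invariant_tuple_function \<G> n f"
  shows "AE p in cochain_measure m \<mu> (Suc n). dG n (unrep n f) p = unrep (Suc n) (differential n f) p"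
proof (rule AE_cochain_all)
  let ?F = "unrep n f" and ?G = "unrep (Suc n) (differential n f)"
  have F: "invariant n ?F" by (rule invariant_unrep[OF n f])
  have dF: "invariant (Suc n) (dG n ?F)"
    unfolding invariant_def
  proof (intro conjI allI ballI)
    show "dG n ?F \<in> borel_measurable (BX (Suc n))" by (intro measurable_dG invariant_measurable F)
    show "dG n ?F (shift (Suc n) g t, act g x) = dG n ?F (t, x)" for g t x
      by (simp add: dG_def differential_def face_shift unrep_def near_arrows_shift[OF n])
  qed
  have G: "invariant (Suc n) ?G" by (intro invariant_unrep measurable_T_differential f) simp
  have "AE \<gamma> in T (Suc n). rep (Suc n) (dG n ?F) \<gamma> = rep (Suc n) ?G \<gamma>"
    using AE_T_differential_cong[OF n rep_unrep_AE[OF n inv]]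
      rep_unrep_AE[OF zero_less_Suc invariant_tuple_function_differential[OF n inv]] AE_space[of "T (Suc n)"]
    by eventually_elim (simp add: differential_rep[OF n])
  then have "AE x in \<mu>. \<forall>t \<in> pattern_tuples (Suc n) x. dG n ?F (t, x) = ?G (t, x)"
    by (simp add: AE_rep_eq_iff dF G)
  then show "AE x in \<mu>. \<forall>t \<in> tuples (Suc n). dG n ?F (t, x) = ?G (t, x)"
  proof (rule AE_mp[OF _ AE_I2[OF impI]], intro ballI)
    fix x t assume "x \<in> space \<mu>"
      and *: "\<forall>t \<in> pattern_tuples (Suc n) x. dG n ?F (t, x) = ?G (t, x)"
    then have x: "x \<in> pattern_hull P" by simp
    \<comment> \<open>Both sides depend on \<open>t\<close> only through \<open>near_tuple\<close>,
      a pattern tuple, so the identity extends to all \<open>t\<close>.\<close>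
    have "dG n ?F (t, x) = dG n ?F (near_tuple (Suc n) t x, x)"
      unfolding dG_def differential_def prod.case
    proof (intro sum.cong refl arg_cong2[where f = "(*)"])
      fix i assume "i \<in> {..n}"
      then show "?F (face n i t, x) = ?F (face n i (near_tuple (Suc n) t x), x)"
        using unrep_near_tuple[OF x, of n f "face n i t"] by (simp add: face_near_tuple)
    qed
    also have "\<dots> = ?G (near_tuple (Suc n) t x, x)" using * near_tuple_mem[OF x] by blast
    also have "\<dots> = ?G (t, x)" by (rule unrep_near_tuple[OF x])
    finally show "dG n ?F (t, x) = ?G (t, x)" .
  qed
qed

text \<open>Restriction to pattern tuples comes last: after averaging, the values there are
  determined by the class of \<open>f\<close> for almost every \<open>x\<close>.\<close>

definition to_groupoid :: "nat \<Rightarrow> ((nat \<Rightarrow> 'g) \<times> 'g set \<Rightarrow> real) \<Rightarrow> (nat \<Rightarrow> 'g \<times> 'g set) \<Rightarrow> real" where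
  "to_groupoid k f = rep (Suc k) (average (Suc k) (regularize (Suc k) f))"

definition to_group :: "nat \<Rightarrow> ((nat \<Rightarrow> 'g \<times> 'g set) \<Rightarrow> real) \<Rightarrow> (nat \<Rightarrow> 'g) \<times> 'g set \<Rightarrow> real" where
  "to_group k f = unrep (Suc k) f"

lemma admissible_average: "admissible n F \<Longrightarrow> admissible n (average n F)"
  unfolding average_def by (intro admissible_smear equivariant_kernel_add)

lemma admissible_group_cochain:
  assumes "admissible (Suc k) F" shows "F \<in> group.cochains k"
proof -
  obtain C where C: "\<And>t x. t \<in> tuples (Suc k) \<Longrightarrow> x \<in> pattern_hull P \<Longrightarrow> \<bar>F (t, x)\<bar> \<le> C"
    using assms by (auto simp: admissible_def)
  have "F \<in> carr (ess_bounded (cochain_measure m \<mu> (Suc k)))"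
    using C by (intro carr_essI[of _ _ C] AE_cochain_all AE_I2)
      (simp_all add: measurable_cochain_iff admissible_measurable[OF assms])
  moreover have "invariant_cochain m act \<mu> (Suc k) F"
    unfolding invariant_cochain_def case_prod_unfold
    using invariantD[OF admissible_invariant[OF assms]]
    by (intro allI AE_cochain_all AE_I2 ballI) (simp add: shift_def)
  ultimately show ?thesis by (simp add: group.cochains_def)
qed

lemma admissible_groupoid_cochain:
  assumes "admissible (Suc k) F" shows "rep (Suc k) F \<in> groupoid.cochains k"
proof -
  note F = admissible_invariant[OF assms]
  obtain C where C: "\<And>t x. t \<in> tuples (Suc k) \<Longrightarrow> x \<in> pattern_hull P \<Longrightarrow> \<bar>F (t, x)\<bar> \<le> C"
    using assms by (auto simp: admissible_def)
  have "AE \<gamma> in T (Suc k). \<bar>rep (Suc k) F \<gamma>\<bar> \<le> C"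
    unfolding AE_rep_bound_iff[OF zero_less_Suc F]
    using C by (intro AE_pattern_tuples AE_I2 ballI) simp
  then show ?thesis
    unfolding groupoid.cochains_def
    by (auto intro!: carr_essI measurable_rep invariant_rep F admissible_measurable assms)
qed

lemma group_cochainD:
  assumes "f \<in> group.cochains k"
  shows "admissible (Suc k) (regularize (Suc k) f)"
    and "AE p in cochain_measure m \<mu> (Suc k). regularize (Suc k) f p = f p"
  using assms by (auto simp: group.cochains_def intro!: admissible_regularize regularize_AE)

text \<open>Any admissible representative gives the same class. This is needed because
  \<open>regularize\<close> involves truncation and is linear only almost everywhere.\<close>

lemma average_AE:
  assumes f: "f \<in> group.cochains k" and F: "admissible (Suc k) F"
    and AE: "AE p in cochain_measure m \<mu> (Suc k). f p = F p"
  shows "AE \<gamma> in T (Suc k). to_groupoid k f \<gamma> = rep (Suc k) (average (Suc k) F) \<gamma>"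
  unfolding to_groupoid_def
  using group_cochainD[OF f] F
proof (subst AE_rep_eq_iff)
  have "AE p in cochain_measure m \<mu> (Suc k). regularize (Suc k) f p = F p"
    using group_cochainD(2)[OF f] AE by eventually_elim simp
  then show "AE x in \<mu>. \<forall>t \<in> pattern_tuples (Suc k) x.
      average (Suc k) (regularize (Suc k) f) (t, x) = average (Suc k) F (t, x)"
    by (intro AE_pattern_tuples average_cong_AE group_cochainD[OF f] F)
qed (auto intro!: admissible_invariant admissible_average)

lemma average_integrable:
  assumes "admissible n F" "t \<in> tuples n" "x \<in> pattern_hull P"
  shows "integrable (W_pow n) (\<lambda>s. F (kernel_tuple n (\<lambda>t s x. t + s) t s x, x))"
  by (rule integrable_slice[OF assms(1,3) measurable_kernel_tuple_slice[OF equivariant_kernel_add assms(2,3)]])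

lemma rep_cong:
  assumes "0 < n" "\<And>t x. \<lbrakk>t \<in> tuples n; x \<in> pattern_hull P\<rbrakk> \<Longrightarrow> F (t, x) = F' (t, x)"
  shows "AE \<gamma> in T n. rep n F \<gamma> = rep n F' \<gamma>"
  using assms base_mem[OF assms(1)] by (intro AE_I2) (simp add: rep_def)

lemma chain_map_to_groupoid:
  "fn_chain_map (\<lambda>k. cochain_measure m \<mu> (Suc k)) (\<lambda>k. invariant_cochain m act \<mu> (Suc k)) (\<lambda>k. dG (Suc k))
    (\<lambda>k. T (Suc k)) (\<lambda>k. invariant_tuple_function \<G> (Suc k)) (\<lambda>k. differential (Suc k)) to_groupoid"
proof
  fix f g :: "(nat \<Rightarrow> 'g) \<times> 'g set \<Rightarrow> real" and k :: nat and c C :: real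
  let ?n = "Suc k"
  let ?M = "cochain_measure m \<mu> ?n"
  assume f: "f \<in> group.cochains k"
  note rf = group_cochainD[OF f]
  show "to_groupoid k f \<in> groupoid.cochains k"
    unfolding to_groupoid_def by (intro admissible_groupoid_cochain admissible_average rf)
  show "AE y in T ?n. to_groupoid k (\<lambda>x. f x + g x) y = to_groupoid k f y + to_groupoid k g y"
    if g: "g \<in> group.cochains k"
  proof -
    note rg = group_cochainD[OF g]
    \<comment> \<open>An admissible representative of the sum, on which averaging is additive at
      every point.\<close>
    let ?F = "\<lambda>p. regularize ?n f p + regularize ?n g p"
    have "AE p in ?M. f p + g p = ?F p" using rf(2) rg(2) by eventually_elim simp
    from average_AE[OF group.cochains_add[OF f g] admissible_add[OF rf(1) rg(1)] this]
    have "AE \<gamma> in T ?n. to_groupoid k (\<lambda>x. f x + g x) \<gamma> = rep ?n (average ?n ?F) \<gamma>" .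
    moreover have "average ?n ?F (t, x) = average ?n (regularize ?n f) (t, x) + average ?n (regularize ?n g) (t, x)"
      if "t \<in> tuples ?n" "x \<in> pattern_hull P" for t x
      using average_integrable[OF rf(1) that] average_integrable[OF rg(1) that]
      by (simp add: average_def smear_def)
    then have "AE \<gamma> in T ?n. rep ?n (average ?n ?F) \<gamma>
        = rep ?n (\<lambda>p. average ?n (regularize ?n f) p + average ?n (regularize ?n g) p) \<gamma>"
      by (intro rep_cong) auto
    ultimately show ?thesis by eventually_elim (simp add: to_groupoid_def rep_def)
  qed
  show "AE y in T ?n. to_groupoid k (\<lambda>x. c * f x) y = c * to_groupoid k f y"
  proof -
    let ?F = "\<lambda>p. c * regularize ?n f p"
    have "AE p in ?M. c * f p = ?F p" using rf(2) by eventually_elim simp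
    from average_AE[OF group.cochains_scale[OF f] admissible_scale[OF rf(1)] this]
    have "AE \<gamma> in T ?n. to_groupoid k (\<lambda>x. c * f x) \<gamma> = rep ?n (average ?n ?F) \<gamma>" .
    then show ?thesis
      by eventually_elim (simp add: to_groupoid_def rep_def average_def smear_def)
  qed
  show "AE y in T ?n. \<bar>to_groupoid k f y\<bar> \<le> C" if C: "0 \<le> C" "AE x in ?M. \<bar>f x\<bar> \<le> C"
  proof -
    have "AE p in ?M. \<bar>regularize ?n f p\<bar> \<le> C" using rf(2) C(2) by eventually_elim simp
    from average_bound_AE[OF rf(1) C(1) this] show ?thesis
      unfolding to_groupoid_def
      by (subst AE_rep_bound_iff)
        (auto intro!: AE_pattern_tuples admissible_invariant admissible_average rf)
  qed
  show "AE y in T (Suc ?n). differential ?n (to_groupoid k f) y = to_groupoid (Suc k) (dG ?n f) y"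
  proof -
    let ?F = "regularize ?n f"
    have "AE p in cochain_measure m \<mu> (Suc ?n). dG ?n f p = dG ?n ?F p"
      by (rule AE_dG_cong) (use rf(2) in \<open>auto elim!: eventually_mono\<close>)
    from average_AE[OF group.D_cochains[OF f] admissible_dG[OF rf(1)] this]
    have 1: "AE \<gamma> in T (Suc ?n). to_groupoid (Suc k) (dG ?n f) \<gamma> = rep (Suc ?n) (average (Suc ?n) (dG ?n ?F)) \<gamma>" .
    have 2: "AE \<gamma> in T (Suc ?n). rep (Suc ?n) (average (Suc ?n) (dG ?n ?F)) \<gamma> = rep (Suc ?n) (dG ?n (average ?n ?F)) \<gamma>"
      unfolding average_def by (intro rep_cong smear_dG rf equivariant_kernel_add) auto
    show ?thesis
      using 1 2 AE_space[of "T (Suc ?n)"]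
      by eventually_elim (simp add: to_groupoid_def differential_rep)
  qed
qed

lemma groupoid_cochainD:
  assumes "f \<in> groupoid.cochains k"
  shows "f \<in> borel_measurable (T (Suc k))" "invariant_tuple_function \<G> (Suc k) f"
    "f \<in> carr (ess_bounded (T (Suc k)))"
  using assms by (auto simp: groupoid.cochains_def ess_bounded_def)

lemma AE_unrep_bound:
  "0 < n \<Longrightarrow> AE \<gamma> in T n. \<bar>f \<gamma>\<bar> \<le> C \<Longrightarrow> AE p in cochain_measure m \<mu> n. \<bar>unrep n f p\<bar> \<le> C"
  unfolding unrep_def by (rule AE_near_arrows)

lemma chain_map_to_group:
  "fn_chain_map (\<lambda>k. T (Suc k)) (\<lambda>k. invariant_tuple_function \<G> (Suc k)) (\<lambda>k. differential (Suc k))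
    (\<lambda>k. cochain_measure m \<mu> (Suc k)) (\<lambda>k. invariant_cochain m act \<mu> (Suc k)) (\<lambda>k. dG (Suc k)) to_group"
proof
  fix f g :: "(nat \<Rightarrow> 'g \<times> 'g set) \<Rightarrow> real" and k :: nat and c C :: real
  let ?n = "Suc k"
  assume f: "f \<in> groupoid.cochains k"
  note f' = groupoid_cochainD[OF f]
  have inv: "invariant ?n (unrep ?n f)" by (rule invariant_unrep[OF zero_less_Suc f'(1)])
  show "to_group k f \<in> group.cochains k"
  proof -
    obtain C where "AE \<gamma> in T ?n. \<bar>f \<gamma>\<bar> \<le> C" using carr_essE[OF f'(3)] by blast
    then have "to_group k f \<in> carr (ess_bounded (cochain_measure m \<mu> ?n))"
      unfolding to_group_def
      by (intro carr_essI[OF _ AE_unrep_bound]) (simp_all add: measurable_cochain_iff invariant_measurable[OF inv])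
    moreover have "invariant_cochain m act \<mu> ?n (to_group k f)"
      unfolding invariant_cochain_def case_prod_unfold to_group_def
      using invariantD[OF inv]
      by (intro allI AE_cochain_all AE_I2 ballI) (simp add: shift_def)
    ultimately show ?thesis by (simp add: group.cochains_def)
  qed
  show "AE p in cochain_measure m \<mu> ?n. to_group k (\<lambda>x. f x + g x) p = to_group k f p + to_group k g p"
    by (simp add: to_group_def unrep_def)
  show "AE p in cochain_measure m \<mu> ?n. to_group k (\<lambda>x. c * f x) p = c * to_group k f p"
    by (simp add: to_group_def unrep_def)
  show "AE p in cochain_measure m \<mu> ?n. \<bar>to_group k f p\<bar> \<le> C" if "AE \<gamma> in T ?n. \<bar>f \<gamma>\<bar> \<le> C"
    unfolding to_group_def by (rule AE_unrep_bound[OF zero_less_Suc that])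
  show "AE p in cochain_measure m \<mu> (Suc ?n). dG ?n (to_group k f) p = to_group (Suc k) (differential ?n f) p"
    unfolding to_group_def by (rule unrep_differential_AE[OF zero_less_Suc f'(1,2)])
qed

text \<open>The homotopy on empty tuples is an empty sum; this agrees with the zero coboundaries in
  degree 0.\<close>

lemma dG_smear_homotopy_0: "dG 0 (smear_homotopy 0 \<kappa> F) p = 0"
  by (simp add: dG_def differential_def smear_homotopy_def prism_sum_def case_prod_unfold)

text \<open>\<open>h\<close> is a function of \<open>k\<close> group entries, hence a cochain of
  degree \<open>k - 1\<close>; for \<open>k = 0\<close> there is none and its differential has to
  vanish.\<close>

lemma group_cohomologous_dG:
  assumes "admissible k h" "k = 0 \<Longrightarrow> dG k h = (\<lambda>_. 0)"
    and "AE p in cochain_measure m \<mu> (Suc k). f p = g p + dG k h p"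
  shows "group.cohomologous k f g"
proof (rule group.cohomologousI[OF _ assms(3)])
  show "dG k h \<in> group.coboundaries k"
    using assms(1,2) by (cases k) (auto simp: group.coboundaries_def admissible_group_cochain)
qed

text \<open>The composite is smearing along \<open>near t x + s\<close>. The cocycle equation is
  known only almost everywhere, so the homotopy identity is shown for almost every \<open>t\<close>,
  at almost every \<open>s\<close>.\<close>

lemma to_group_to_groupoid:
  assumes f: "f \<in> group.cocycles k"
  shows "group.cohomologous k (to_group k (to_groupoid k f)) f"
proof (rule group_cohomologous_dG)
  let ?n = "Suc k" and ?\<kappa> = "\<lambda>t s x. near t x + s"
  let ?F = "regularize ?n f"
  let ?h = "smear_homotopy k ?\<kappa> ?F"
  have f': "f \<in> group.cochains k" using f by (rule group.cocycles_cochains)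
  note rf = group_cochainD[OF f']
  note \<kappa> = equivariant_kernel_near_add
  show h: "admissible k ?h" by (rule admissible_smear_homotopy[OF rf(1) \<kappa>])
  show "dG k ?h = (\<lambda>_. 0)" if "k = 0" unfolding that by (simp add: fun_eq_iff dG_smear_homotopy_0)
  have smear: "to_group k (to_groupoid k f) (t, x) = smear ?n ?\<kappa> ?F (t, x)" if "x \<in> pattern_hull P" for t x
  proof -
    have "kernel_tuple ?n (\<lambda>t s x. t + s) (near_tuple ?n t x) s x = kernel_tuple ?n ?\<kappa> t s x" for s
      by (auto simp: kernel_tuple_def near_tuple_def fun_eq_iff)
    then show ?thesis
      using unrep_rep[OF zero_less_Suc admissible_invariant[OF admissible_average[OF rf(1)]] that]
      by (simp add: to_group_def to_groupoid_def average_def smear_def)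
  qed
  have "AE p in cochain_measure m \<mu> (Suc ?n). dG ?n f p = 0"
    using f by (simp add: group.cocycles_def)
  moreover have "AE p in cochain_measure m \<mu> (Suc ?n). dG ?n ?F p = dG ?n f p"
    by (rule AE_dG_cong[OF rf(2)])
  ultimately have "AE p in cochain_measure m \<mu> (Suc ?n). dG ?n ?F p = 0" by eventually_elim simp
  from AE_cochain_D[OF this]
  have "AE x in \<mu>. AE t in m_pow ?n. dG k ?h (t, x) = smear ?n ?\<kappa> ?F (t, x) - ?F (t, x)"
  proof (rule AE_mp[OF _ AE_I2[OF impI]])
    fix x assume x: "x \<in> space \<mu>" and AE: "AE u in m_pow (Suc ?n). dG ?n ?F (u, x) = 0"
    \<comment> \<open>Fixes the good \<open>t\<close> first; for these the cocycle equation holds at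
      the prism with almost every second tuple.\<close>
    have "AE a in m_pow ?n. \<forall>j\<in>{..k}. AE b in m_pow ?n. dG ?n ?F (prism ?n j a b, x) = 0"
      by (intro AE_faces AE_prism AE) simp
    then show "AE t in m_pow ?n. dG k ?h (t, x) = smear ?n ?\<kappa> ?F (t, x) - ?F (t, x)"
    proof (rule AE_mp[OF _ AE_I2[OF impI]])
      fix t assume t: "t \<in> space (m_pow ?n)"
        and AE: "\<forall>j\<in>{..k}. AE b in m_pow ?n. dG ?n ?F (prism ?n j t b, x) = 0"
      have "AE s in W_pow ?n. \<forall>j\<in>{..k}. dG ?n ?F (prism ?n j t (kernel_tuple ?n ?\<kappa> t s x), x) = 0"
      proof (rule AE_faces)
        fix j assume "j \<le> k"
        then have "AE b in m_pow ?n. dG ?n ?F (prism ?n j t b, x) = 0" using AE by blast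
        \<comment> \<open>The second tuple is a translate of \<open>s\<close> by
          \<open>near (t i) x\<close>, which is constant in \<open>s\<close>, so it avoids the null
          set for almost every \<open>s\<close>.\<close>
        from AE_translate[OF this, of "\<lambda>i. near (t i) x"]
        show "AE s in W_pow ?n. dG ?n ?F (prism ?n j t (kernel_tuple ?n ?\<kappa> t s x), x) = 0"
          by (simp add: kernel_tuple_def)
      qed
      then show "dG k ?h (t, x) = smear ?n ?\<kappa> ?F (t, x) - ?F (t, x)"
        using t x by (intro smear_homotopy_identity rf \<kappa>) (auto elim!: eventually_mono)
    qed
  qed
  moreover have "{p \<in> space (cochain_measure m \<mu> ?n). dG k ?h p = smear ?n ?\<kappa> ?F p - ?F p}
      \<in> sets (cochain_measure m \<mu> ?n)"
  proof -
    have "dG k ?h \<in> borel_measurable (cochain_measure m \<mu> ?n)"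
      "smear ?n ?\<kappa> ?F \<in> borel_measurable (cochain_measure m \<mu> ?n)"
      "?F \<in> borel_measurable (cochain_measure m \<mu> ?n)"
      unfolding measurable_cochain_iff
      by (intro admissible_measurable admissible_dG h admissible_smear rf \<kappa>)+
    then show ?thesis by (intro sets_Collect_eq_borel borel_measurable_diff)
  qed
  ultimately have "AE p in cochain_measure m \<mu> ?n. dG k ?h p = smear ?n ?\<kappa> ?F p - ?F p"
    by (intro AE_cochain_I) auto
  with rf(2) AE_space[of "cochain_measure m \<mu> ?n"]
  show "AE p in cochain_measure m \<mu> ?n. to_group k (to_groupoid k f) p = f p + dG k ?h p"
    by eventually_elim (use smear in \<open>auto simp: mem_Times_iff\<close>)
qed

lemma groupoid_cohomologous_dG:
  assumes "admissible k h" "k = 0 \<Longrightarrow> dG k h = (\<lambda>_. 0)"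
    and AE: "AE \<gamma> in T (Suc k). f \<gamma> = g \<gamma> + rep (Suc k) (dG k h) \<gamma>"
  shows "groupoid.cohomologous k f g"
proof (cases k)
  case 0
  then show ?thesis
    using AE assms(2) by (intro groupoid.cohomologous_AE) (simp add: rep_def)
next
  case (Suc j)
  have "differential k (rep k h) \<in> groupoid.coboundaries k"
    using assms(1) by (auto simp: Suc groupoid.coboundaries_def admissible_groupoid_cochain)
  moreover have "AE \<gamma> in T (Suc k). f \<gamma> = g \<gamma> + differential k (rep k h) \<gamma>"
    using AE AE_space by eventually_elim (simp add: differential_rep Suc)
  ultimately show ?thesis by (rule groupoid.cohomologousI)
qed

text \<open>For \<open>t\<close> in \<open>- x\<close> the kernel \<open>near (t + s) x\<close>
  stays in \<open>- x\<close>, so every prism is a pattern tuple. The cocycle equation holds at all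
  of these for almost every \<open>x\<close>, with no exceptional \<open>s\<close>.\<close>

lemma to_groupoid_to_group:
  assumes f: "f \<in> groupoid.cocycles k"
  shows "groupoid.cohomologous k (to_groupoid k (to_group k f)) f"
proof -
  let ?n = "Suc k" and ?\<kappa> = "\<lambda>t s x. near (t + s) x"
  have f0: "f \<in> groupoid.cochains k" using f by (rule groupoid.cocycles_cochains)
  note f' = groupoid_cochainD[OF f0]
  obtain C where C: "0 \<le> C" "AE \<gamma> in T ?n. \<bar>f \<gamma>\<bar> \<le> C" using carr_essE[OF f'(3)] by blast
  \<comment> \<open>\<open>unrep\<close> of \<open>f\<close> is strictly invariant but bounded only
    almost everywhere; truncation makes it admissible.\<close>
  let ?F = "clamp C (unrep ?n f)"
  let ?h = "smear_homotopy k ?\<kappa> ?F"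
  have F: "admissible ?n ?F" by (intro admissible_clamp invariant_unrep f' C) simp
  note Fi = admissible_invariant[OF F]
  note \<kappa> = equivariant_kernel_add_near
  have h: "admissible k ?h" by (rule admissible_smear_homotopy[OF F \<kappa>])
  have zero: "dG k ?h = (\<lambda>_. 0)" if "k = 0" unfolding that by (simp add: fun_eq_iff dG_smear_homotopy_0)
  have repF: "AE \<gamma> in T ?n. rep ?n ?F \<gamma> = f \<gamma>"
    using rep_unrep_AE[OF zero_less_Suc f'(2)] C(2) by eventually_elim (simp add: rep_def clamp_def)
  have "to_group k f \<in> group.cochains k"
    using fn_chain_map.A_cochains[OF chain_map_to_group f0] .
  moreover have "AE p in cochain_measure m \<mu> ?n. to_group k f p = ?F p"
    using AE_unrep_bound[OF zero_less_Suc C(2)] by eventually_elim (simp add: to_group_def clamp_eq)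
  ultimately have A: "AE \<gamma> in T ?n. to_groupoid k (to_group k f) \<gamma> = rep ?n (average ?n ?F) \<gamma>"
    by (intro average_AE F)
  have inv0: "invariant (Suc ?n) (\<lambda>_. 0)" by (simp add: invariant_def)
  have "AE \<gamma> in T (Suc ?n). rep (Suc ?n) (dG ?n ?F) \<gamma> = rep (Suc ?n) (\<lambda>_. 0) \<gamma>"
  proof -
    have "AE \<gamma> in T (Suc ?n). differential ?n f \<gamma> = 0" using f by (simp add: groupoid.cocycles_def)
    with AE_T_differential_cong[OF zero_less_Suc repF] AE_space[of "T (Suc ?n)"] show ?thesis
      by eventually_elim (simp add: differential_rep rep_def[of _ "\<lambda>_. 0"])
  qed
  then have "AE x in \<mu>. \<forall>t \<in> pattern_tuples (Suc ?n) x. dG ?n ?F (t, x) = 0"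
    unfolding AE_rep_eq_iff[OF zero_less_Suc admissible_invariant[OF admissible_dG[OF F]] inv0] .
  then have "AE x in \<mu>. \<forall>t \<in> pattern_tuples ?n x. (\<lambda>p. ?F p + dG k ?h p) (t, x) = average ?n ?F (t, x)"
  proof (rule AE_mp[OF _ AE_I2[OF impI]], intro ballI)
    fix x t assume "x \<in> space \<mu>" and t: "t \<in> pattern_tuples ?n x"
      and zero: "\<forall>t \<in> pattern_tuples (Suc ?n) x. dG ?n ?F (t, x) = 0"
    then have x: "x \<in> pattern_hull P" by simp
    have t': "t \<in> tuples ?n" using t by (auto simp: PiE_iff)
    have K: "kernel_tuple ?n ?\<kappa> t s x \<in> pattern_tuples ?n x" for s
      by (simp add: kernel_tuple_def PiE_iff mem_uminus_image near_mem[OF x])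
    have "dG k ?h (t, x) = smear ?n ?\<kappa> ?F (t, x) - ?F (t, x)"
      using zero prism_mem_PiE[OF _ t K] by (intro smear_homotopy_identity F \<kappa> t' x AE_I2) auto
    \<comment> \<open>\<open>?F\<close> does not notice \<open>near\<close>, so smearing along this
      kernel is plain averaging.\<close>
    moreover have "smear ?n ?\<kappa> ?F (t, x) = average ?n ?F (t, x)"
    proof -
      have "kernel_tuple ?n ?\<kappa> t s x = near_tuple ?n (kernel_tuple ?n (\<lambda>t s x. t + s) t s x) x" for s
        by (auto simp: kernel_tuple_def near_tuple_def fun_eq_iff)
      then show ?thesis by (simp add: average_def smear_def clamp_def unrep_near_tuple[OF x])
    qed
    ultimately show "(\<lambda>p. ?F p + dG k ?h p) (t, x) = average ?n ?F (t, x)" by simp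
  qed
  then have "AE \<gamma> in T ?n. rep ?n (\<lambda>p. ?F p + dG k ?h p) \<gamma> = rep ?n (average ?n ?F) \<gamma>"
    unfolding AE_rep_eq_iff[OF zero_less_Suc
      admissible_invariant[OF admissible_add[OF F admissible_dG[OF h]]]
      admissible_invariant[OF admissible_average[OF F]]] .
  with A repF have "AE \<gamma> in T ?n. to_groupoid k (to_group k f) \<gamma> = f \<gamma> + rep ?n (dG k ?h) \<gamma>"
    by eventually_elim (simp add: rep_def)
  with h zero show ?thesis by (rule groupoid_cohomologous_dG)
qed

theorem isometric_Hmb_Hcb: "isometric (Hmb k \<G>) (Hcb k m act \<mu>)"
  unfolding Hmb_def Hcb_def dG_def[symmetric]
  by (rule isometric_cohomology[OF chain_map_to_group chain_map_to_groupoid])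
    (erule to_groupoid_to_group, erule to_group_to_groupoid)

lemma closed_ops_Hmb: "closed_ops (Hmb k \<G>)"
  using groupoid.closed_ops_H unfolding Hmb_def .

lemma closed_ops_Hcb: "closed_ops (Hcb k m act \<mu>)"
  using group.closed_ops_H unfolding Hcb_def dG_def .

end

theorem corollary7:
  fixes m :: "'g::{topological_group_add, t2_space, second_countable_topology} measure"
    and d :: "'g \<Rightarrow> 'g \<Rightarrow> real"
    and P :: "'g set"
    and k :: nat
  assumes "locally_compact_space (euclidean :: 'g topology)"
    and "unimodular TYPE('g)"
    and "haar_measure m"
    and "proper_right_invariant_metric d"
    and "locally_finite_set P"
    and "FLC P"
    and "measured_set P"
    and "finite_voronoi_volume d m P"
  shows "Hb k m P = {iso_class (Hcb k m act \<mu>) | \<mu>. \<mu> \<in> ergodic_measures P}"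
proof -
  \<comment> \<open>The enumeration and the density depend only on \<open>P\<close> and
    \<open>m\<close> and serve all measures \<open>\<mu>\<close> at once.\<close>
  obtain e E where "enumerated_hull P e E"
    using enumerated_hull_exists[OF assms(1,5,6)] by blast
  then interpret enumerated_hull P e E .
  obtain w where w: "w \<in> borel_measurable borel" "\<And>g. 0 < w g" "(\<integral>\<^sup>+ g. ennreal (w g) \<partial>m) = 1"
    using haar_density_exists[OF assms(1,3)] by blast
  \<comment> \<open>The sum type contains copies of both spaces, so equality of the classes amounts
    to an isometry for each \<open>\<mu>\<close> separately.\<close>
  have "(iso_class (Hb_pattern k m P \<mu>) :: 'g class_carrier snspace set) = iso_class (Hcb k m act \<mu>)"
    if "\<mu> \<in> ergodic_measures P" for \<mu>
  proof -
    interpret hull_system P e E m w \<mu>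
      using that assms(2,3) w haar_sigma_finite[OF assms(1,3)]
      by (intro hull_system.intro enumerated_hull_axioms hull_system_axioms.intro)
        (simp_all add: ergodic_measures_def unimodular_def)
    show ?thesis
      unfolding Hb_pattern_def iso_class_eq_iff[OF closed_ops_Hmb closed_ops_Hcb]
      by (rule isometric_Hmb_Hcb)
  qed
  then show ?thesis unfolding Hb_def by (intro Collect_cong) auto
qed

end
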